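(* All of the following problems are in $\mathsf{FPT}$: (i) LoadCVRP parameterized by $k+\ell$; (ii) GasCVRP parameterized by $k+g$; (iii) LoadGasCVRP parameterized by $k+\ell$. Here $k$ is the number of vehicles, $\ell$ the load capacity and $g$ the gas capacity.
   Context: All graphs are finite and undirected, and $\mathbb N = \{0,1,2,\dots\}$, $\mathbb N^+=\{1,2,\dots\}$. A walk in $G$ is a sequence of vertices $(v_1,\dots,v_m)$ with consecutive vertices adjacent; vertices and edges may be repeated. It is closed if $v_1 = v_m$. The weight of a walk is $w(p)=\sum_{i=1}^{m-1} w(v_i,v_{i+1})$. Common setting: an instance contains a graph $G$ with edge weights $w\colon E(G)\to\mathbb N$, a nonempty set of depots $D\subseteq V(G)$, a set of clients $C\subseteq V(G)$, a number of vehicles $k\in\mathbb N$, and a bound $r\in\mathbb N$. A routing is a set of $k'$ walks $R=\{p_1,\dots,p_{k'}\}$ (one walk per vehicle) together with an assignment $A\colon C\to[k']$ such that $k'\le k$, every walk starts at a vertex of $D$, every client $c\in C$ is a vertex of $p_{A(c)}$, every walk in $R$ is closed, and the additional constraints below hold. Its weight is $w(R)=\sum_{p\in R}w(p)$. The question is whether there exists a routing with $w(R)\le r$. LoadCVRP (Load-Capacitated Vehicle Routing Problem): the instance additionally contains a load capacity $\ell\in\mathbb N$ and demands $\Lambda\colon C\to\mathbb N^+$; the additional constraint is $\sum_{c\in A^{-1}(i)}\Lambda(c)\le\ell$ for every $i\in[k']$. GasCVRP (Gas-Capacitated Vehicle Routing Problem): the instance additionally contains a gas capacity $g\in\mathbb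 N$; the additional constraint is $w(p)\le g$ for every $p\in R$. LoadGasCVRP: the instance additionally contains $\ell$, $\Lambda$ and $g$, and both constraints are imposed. *)

theory Defs
  imports "HOL-Library.Log_Nat"
begin

section \<open>Machine model\<close>

text \<open>
  The model is a random access machine with finitely many registers (per program) and an unbounded
  memory, both holding natural numbers, programmed in structured form and charged with the uniform
  cost measure.  The only arithmetic is addition and truncated subtraction.  In particular there is
  no multiplication: one step increases the bit length of the largest stored number by at most a
  constant that depends only on the program, so uniform cost is polynomially related to running
  time on Turing machines.  Expressions inside a program have constant size, which is why a whole
  assignment or test can be charged one step.
\<close>

datatype aexp =
    Num nat
  | Reg nat
  | Mem aexp
  | Add aexp aexp
  | Sub aexp aexp

type_synonym state = "(nat \<Rightarrow> nat) \<times> (nat \<Rightarrow> nat)"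

fun aval :: "aexp \<Rightarrow> state \<Rightarrow> nat" where
  "aval (Num n) s = n"
| "aval (Reg x) s = fst s x"
| "aval (Mem e) s = snd s (aval e s)"
| "aval (Add d e) s = aval d s + aval e s"
| "aval (Sub d e) s = aval d s - aval e s"

text \<open>
  \<open>IfLess d e c1 c2\<close> and \<open>WhileLess d e c\<close> test whether the value of \<open>d\<close> is less than that of \<open>e\<close>;
  \<open>Store d e\<close> writes the value of \<open>e\<close> to the memory cell whose address is the value of \<open>d\<close>.
\<close>

datatype com =
    Skip
  | Assign nat aexp
  | Store aexp aexp
  | Seq com com
  | IfLess aexp aexp com com
  | WhileLess aexp aexp com

text \<open>\<open>exec c s t s'\<close>: started in \<open>s\<close>, the program \<open>c\<close> halts in \<open>s'\<close> after exactly \<open>t\<close> steps.\<close>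

inductive exec :: "com \<Rightarrow> state \<Rightarrow> nat \<Rightarrow> state \<Rightarrow> bool" where
  Skip: "exec Skip s 1 s"
| Assign: "exec (Assign x e) s 1 ((fst s)(x := aval e s), snd s)"
| Store: "exec (Store d e) s 1 (fst s, (snd s)(aval d s := aval e s))"
| Seq: "\<lbrakk>exec c1 s1 t1 s2; exec c2 s2 t2 s3\<rbrakk> \<Longrightarrow> exec (Seq c1 c2) s1 (t1 + t2) s3"
| IfTrue: "\<lbrakk>aval d s < aval e s; exec c1 s t s'\<rbrakk> \<Longrightarrow> exec (IfLess d e c1 c2) s (t + 1) s'"
| IfFalse: "\<lbrakk>\<not> aval d s < aval e s; exec c2 s t s'\<rbrakk> \<Longrightarrow> exec (IfLess d e c1 c2) s (t + 1) s'"
| WhileFalse: "\<not> aval d s < aval e s \<Longrightarrow> exec (WhileLess d e c) s 1 s"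
| WhileTrue: "\<lbrakk>aval d s1 < aval e s1; exec c s1 t1 s2; exec (WhileLess d e c) s2 t2 s3\<rbrakk>
    \<Longrightarrow> exec (WhileLess d e c) s1 (t1 + t2 + 1) s3"

inductive_cases SkipE: "exec Skip s t s'"
  and AssignE: "exec (Assign x e) s t s'"
  and StoreE: "exec (Store d e) s t s'"
  and SeqE: "exec (Seq c1 c2) s t s'"
  and IfE: "exec (IfLess d e c1 c2) s t s'"
  and WhileE: "exec (WhileLess d e c) s t s'"

lemma exec_deterministic:
  "\<lbrakk>exec c s t s'; exec c s u s''\<rbrakk> \<Longrightarrow> u = t \<and> s'' = s'"
proof (induction arbitrary: u s'' rule: exec.induct)
  case (Skip s)
  then show ?case by (auto elim: SkipE)
next
  case (Assign x e s)
  then show ?case by (auto elim: AssignE)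
next
  case (Store d e s)
  then show ?case by (auto elim: StoreE)
next
  case (Seq c1 s1 t1 s2 c2 t2 s3)
  from Seq.prems obtain u1 u2 s'
    where "exec c1 s1 u1 s'" "exec c2 s' u2 s''" "u = u1 + u2" by (rule SeqE)
  with Seq.IH show ?case by metis
next
  case (IfTrue d s e c1 t s' c2)
  from IfTrue.prems IfTrue.hyps obtain u1 where "exec c1 s u1 s''" "u = u1 + 1"
    by (auto elim: IfE)
  with IfTrue.IH show ?case by metis
next
  case (IfFalse d s e c2 t s' c1)
  from IfFalse.prems IfFalse.hyps obtain u1 where "exec c2 s u1 s''" "u = u1 + 1"
    by (auto elim: IfE)
  with IfFalse.IH show ?case by metis
next
  case (WhileFalse d s e c)
  from WhileFalse.prems show ?case by (rule WhileE) (use WhileFalse.hyps in auto)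
next
  case (WhileTrue d s1 e c t1 s2 t2 s3)
  from WhileTrue.prems have "\<exists>u1 u2 s'. exec c s1 u1 s' \<and>
      exec (WhileLess d e c) s' u2 s'' \<and> u = Suc (u1 + u2)"
    by (rule WhileE) (use WhileTrue.hyps in \<open>simp, force\<close>)
  with WhileTrue.IH show ?case by (metis Suc_eq_plus1)
qed

text \<open>
  A machine input is a finite sequence of natural numbers, stored in the initial memory cells; its
  length is in register 0, which also receives the output.
\<close>

definition init :: "nat list \<Rightarrow> state" where
  "init xs = ((\<lambda>_. 0)(0 := length xs), \<lambda>i. if i < length xs then xs ! i else 0)"

definition result :: "state \<Rightarrow> nat" where
  "result s = fst s 0"

text \<open>Numbers are written in binary, with one additional separator symbol per number.\<close>

definition input_size :: "nat list \<Rightarrow> nat" where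
  "input_size xs = (\<Sum>x\<leftarrow>xs. floorlog 2 x + 1)"

definition computable :: "(nat \<Rightarrow> nat) \<Rightarrow> bool" where
  "computable f \<longleftrightarrow> (\<exists>c. \<forall>n. \<exists>t s. exec c (init [n]) t s \<and> result s = f n)"


section \<open>Fixed-parameter tractability\<close>

text \<open>
  A parameterized problem is a set of pairs of a word and a parameter.  The parameter is passed to
  the machine in front of the word, and the machine has to halt on all pairs, including those whose
  word does not encode an instance and those whose parameter does not belong to the word.
\<close>

type_synonym parameterized_problem = "(nat list \<times> nat) set"

definition FPT :: "parameterized_problem set" where
  "FPT = {L. \<exists>c f d. computable f \<and>
     (\<forall>x \<kappa>. \<exists>t s. exec c (init (\<kappa> # x)) t s \<and>
        (result s = 1 \<longleftrightarrow> (x, \<kappa>) \<in> L) \<and>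
        t \<le> f \<kappa> * input_size (\<kappa> # x) ^ d)}"


section \<open>Vehicle routing\<close>

record 'v vrp =
  verts :: "'v set"
  edges :: "'v set set"
  weight :: "'v set \<Rightarrow> nat"
  depots :: "'v set"
  clients :: "'v set"
  vehicles :: nat
  bound :: nat

definition vrp_instance :: "'v vrp \<Rightarrow> bool" where
  "vrp_instance I \<longleftrightarrow>
     finite (verts I) \<and>
     (\<forall>e\<in>edges I. e \<subseteq> verts I \<and> card e = 2) \<and>
     depots I \<subseteq> verts I \<and> depots I \<noteq> {} \<and>
     clients I \<subseteq> verts I"

definition walk :: "'v vrp \<Rightarrow> 'v list \<Rightarrow> bool" where
  "walk I p \<longleftrightarrow> p \<noteq> [] \<and> set p \<subseteq> verts I \<and>
     (\<forall>i. Suc i < length p \<longrightarrow> {p ! i, p ! Suc i} \<in> edges I)"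

definition closed_walk :: "'v vrp \<Rightarrow> 'v list \<Rightarrow> bool" where
  "closed_walk I p \<longleftrightarrow> walk I p \<and> hd p = last p"

definition walk_weight :: "'v vrp \<Rightarrow> 'v list \<Rightarrow> nat" where
  "walk_weight I p = (\<Sum>i<length p - 1. weight I {p ! i, p ! Suc i})"

text \<open>
  The walks of a routing form a list, one entry per vehicle used, so two vehicles may drive the same
  walk and both are then counted in the weight.  Vehicles are numbered from 0.  The values of the
  assignment outside the clients are irrelevant.
\<close>

definition routing :: "'v vrp \<Rightarrow> 'v list list \<Rightarrow> ('v \<Rightarrow> nat) \<Rightarrow> bool" where
  "routing I R A \<longleftrightarrow>
     length R \<le> vehicles I \<and>
     (\<forall>p\<in>set R. closed_walk I p \<and> hd p \<in> depots I) \<and>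
     (\<forall>c\<in>clients I. A c < length R \<and> c \<in> set (R ! A c))"

definition routing_weight :: "'v vrp \<Rightarrow> 'v list list \<Rightarrow> nat" where
  "routing_weight I R = (\<Sum>p\<leftarrow>R. walk_weight I p)"

definition positive_demands :: "'v vrp \<Rightarrow> ('v \<Rightarrow> nat) \<Rightarrow> bool" where
  "positive_demands I \<Lambda> \<longleftrightarrow> (\<forall>c\<in>clients I. \<Lambda> c > 0)"

definition load_constraint ::
  "'v vrp \<Rightarrow> nat \<Rightarrow> ('v \<Rightarrow> nat) \<Rightarrow> 'v list list \<Rightarrow> ('v \<Rightarrow> nat) \<Rightarrow> bool" where
  "load_constraint I l \<Lambda> R A \<longleftrightarrow>
     (\<forall>i<length R. (\<Sum>c | c \<in> clients I \<and> A c = i. \<Lambda> c) \<le> l)"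

definition gas_constraint :: "'v vrp \<Rightarrow> nat \<Rightarrow> 'v list list \<Rightarrow> bool" where
  "gas_constraint I g R \<longleftrightarrow> (\<forall>p\<in>set R. walk_weight I p \<le> g)"

definition load_cvrp_solvable :: "'v vrp \<Rightarrow> nat \<Rightarrow> ('v \<Rightarrow> nat) \<Rightarrow> bool" where
  "load_cvrp_solvable I l \<Lambda> \<longleftrightarrow>
     (\<exists>R A. routing I R A \<and> load_constraint I l \<Lambda> R A \<and> routing_weight I R \<le> bound I)"

definition gas_cvrp_solvable :: "'v vrp \<Rightarrow> nat \<Rightarrow> bool" where
  "gas_cvrp_solvable I g \<longleftrightarrow>
     (\<exists>R A. routing I R A \<and> gas_constraint I g R \<and> routing_weight I R \<le> bound I)"

definition load_gas_cvrp_solvable :: "'v vrp \<Rightarrow> nat \<Rightarrow> ('v \<Rightarrow> nat) \<Rightarrow> nat \<Rightarrow> bool" where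
  "load_gas_cvrp_solvable I l \<Lambda> g \<longleftrightarrow>
     (\<exists>R A. routing I R A \<and> load_constraint I l \<Lambda> R A \<and> gas_constraint I g R \<and>
        routing_weight I R \<le> bound I)"


section \<open>Encoding of instances\<close>

text \<open>
  For the purpose of encoding, the vertices are \<open>0, \<dots>, n - 1\<close>.  The graph is given by its weighted
  adjacency matrix, in which 0 stands for a non-edge and \<open>m + 1\<close> for an edge of weight \<open>m\<close>;
  depots and clients are given by their characteristic vectors.
\<close>

definition standard_verts :: "nat vrp \<Rightarrow> bool" where
  "standard_verts I \<longleftrightarrow> (\<exists>n. verts I = {..<n})"

definition encode_vrp :: "nat vrp \<Rightarrow> nat list" where
  "encode_vrp I = (let vs = [0..<card (verts I)] in
     [length vs] @
     concat (map (\<lambda>u. map (\<lambda>v. if {u, v} \<in> edges I then weight I {u, v} + 1 else 0) vs) vs) @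
     map (\<lambda>v. if v \<in> depots I then 1 else 0) vs @
     map (\<lambda>v. if v \<in> clients I then 1 else 0) vs @
     [vehicles I, bound I])"

definition encode_load :: "nat vrp \<Rightarrow> nat \<Rightarrow> (nat \<Rightarrow> nat) \<Rightarrow> nat list" where
  "encode_load I l \<Lambda> =
     [l] @ map (\<lambda>v. if v \<in> clients I then \<Lambda> v else 0) [0..<card (verts I)]"

text \<open>The argument \<open>\<kappa>\<close> computes the parameter from the numbers that it is applied to.\<close>

definition LoadCVRP :: "(nat \<Rightarrow> nat \<Rightarrow> nat) \<Rightarrow> parameterized_problem" where
  "LoadCVRP \<kappa> = {(encode_vrp I @ encode_load I l \<Lambda>, \<kappa> (vehicles I) l) | I l \<Lambda>.
     vrp_instance I \<and> standard_verts I \<and> positive_demands I \<Lambda> \<and> load_cvrp_solvable I l \<Lambda>}"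

definition GasCVRP :: "(nat \<Rightarrow> nat \<Rightarrow> nat) \<Rightarrow> parameterized_problem" where
  "GasCVRP \<kappa> = {(encode_vrp I @ [g], \<kappa> (vehicles I) g) | I g.
     vrp_instance I \<and> standard_verts I \<and> gas_cvrp_solvable I g}"

definition LoadGasCVRP :: "(nat \<Rightarrow> nat \<Rightarrow> nat \<Rightarrow> nat) \<Rightarrow> parameterized_problem" where
  "LoadGasCVRP \<kappa> = {(encode_vrp I @ encode_load I l \<Lambda> @ [g], \<kappa> (vehicles I) l g) | I l \<Lambda> g.
     vrp_instance I \<and> standard_verts I \<and> positive_demands I \<Lambda> \<and>
     load_gas_cvrp_solvable I l \<Lambda> g}"

end

theory Submission
  imports Defs "HOL-Library.Sublist"
begin

text \<open>
  After computing all distances, only the order matters in which the clients are visited: a vehicle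
  drives from a depot along shortest paths through its clients and back, and the best depot can be
  found in polynomial time for each order.  With load capacities there are at most \<open>k * l\<close> clients,
  because demands are positive, so the orders can be enumerated.  With a gas capacity the number of
  clients is unbounded, but a client at distance 0 from another one can be visited by a free detour.
  It therefore suffices to keep a maximal set of clients with pairwise positive distances, and a walk of
  weight at most \<open>g\<close> visits at most \<open>g + 1\<close> of these.
\<close>

section \<open>A language with bounded loops\<close>

text \<open>All three problems become one search with both capacities: the budget serves as gas
  capacity when none is given, and unit demands with capacity \<open>n\<close> make the load
  constraint vacuous. A candidate is a function from the m clients kept to k*m slots, which fixes
  the assignment and the orders at once. Candidates are the numbers below
  \<open>(k * m) ^ m\<close>, so a single counter enumerates them without backtracking. The obstacle
  is that an FPT machine must respect its time bound on every input, also on malformed words and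
  wrong parameters, while its loops run up to numbers found in the input. Hence every such number is
  compared with a safe quantity before it limits a loop: \<open>n\<close> with the input length, the
  parameter with the value prescribed by the word, m with a bound in the parameter. All loop limits
  are then at most \<open>growth\<close> of the parameter times the input length, and a polynomial
  in this product splits into a function of the parameter times a polynomial in the input size.
  Weights, budget and gas capacity limit no loop, so they may be exponentially large.\<close>

datatype prg =
    Nop
  | SetR nat aexp
  | Write aexp aexp
  | Comp prg prg (infixr ";;" 60)
  | Cond aexp aexp prg prg
  | For nat nat prg

definition setr :: "nat \<Rightarrow> nat \<Rightarrow> state \<Rightarrow> state" where
  "setr x v s = ((fst s)(x := v), snd s)"

lemma fst_setr [simp]: "fst (setr x v s) = (fst s)(x := v)"
  and snd_setr [simp]: "snd (setr x v s) = snd s"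
  by (simp_all add: setr_def)

fun iter :: "nat \<Rightarrow> (state \<Rightarrow> state) \<Rightarrow> nat \<Rightarrow> state \<Rightarrow> state" where
  "iter i f 0 s = setr i 0 s"
| "iter i f (Suc k) s = setr i (Suc k) (f (iter i f k s))"

fun sem :: "prg \<Rightarrow> state \<Rightarrow> state" where
  "sem Nop s = s"
| "sem (SetR x e) s = setr x (aval e s) s"
| "sem (Write d e) s = (fst s, (snd s)(aval d s := aval e s))"
| "sem (p ;; q) s = sem q (sem p s)"
| "sem (Cond d e p q) s = (if aval d s < aval e s then sem p s else sem q s)"
| "sem (For i j p) s = iter i (sem p) (fst s j) s"

fun compile :: "prg \<Rightarrow> com" where
  "compile Nop = Skip"
| "compile (SetR x e) = Assign x e"
| "compile (Write d e) = Store d e"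
| "compile (p ;; q) = Seq (compile p) (compile q)"
| "compile (Cond d e p q) = IfLess d e (compile p) (compile q)"
| "compile (For i j p) = Seq (Assign i (Num 0))
     (WhileLess (Reg i) (Reg j) (Seq (compile p) (Assign i (Add (Reg i) (Num 1)))))"

text \<open>The outer 2 of a loop pays for clearing the counter and for the final failing test; the
  2 in each round pays for the successful test and the increment.\<close>

fun etime :: "prg \<Rightarrow> state \<Rightarrow> nat" where
  "etime Nop s = 1"
| "etime (SetR x e) s = 1"
| "etime (Write d e) s = 1"
| "etime (p ;; q) s = etime p s + etime q (sem p s)"
| "etime (Cond d e p q) s = (if aval d s < aval e s then etime p s else etime q s) + 1"
| "etime (For i j p) s = 2 + (\<Sum>k<fst s j. etime p (iter i (sem p) k s) + 2)"

fun writes :: "prg \<Rightarrow> nat set" where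
  "writes Nop = {}"
| "writes (SetR x e) = {x}"
| "writes (Write d e) = {}"
| "writes (p ;; q) = writes p \<union> writes q"
| "writes (Cond d e p q) = writes p \<union> writes q"
| "writes (For i j p) = insert i (writes p)"

fun no_write :: "prg \<Rightarrow> bool" where
  "no_write Nop = True"
| "no_write (SetR x e) = True"
| "no_write (Write d e) = False"
| "no_write (p ;; q) = (no_write p \<and> no_write q)"
| "no_write (Cond d e p q) = (no_write p \<and> no_write q)"
| "no_write (For i j p) = no_write p"

text \<open>Loops must not tamper with their counter and their limit; this makes \<^const>\<open>sem\<close> agree with
  the while loop of the compiled program, which evaluates both registers anew in every round.\<close>

fun wf_prg :: "prg \<Rightarrow> bool" where
  "wf_prg Nop = True"
| "wf_prg (SetR x e) = True"
| "wf_prg (Write d e) = True"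
| "wf_prg (p ;; q) = (wf_prg p \<and> wf_prg q)"
| "wf_prg (Cond d e p q) = (wf_prg p \<and> wf_prg q)"
| "wf_prg (For i j p) = (wf_prg p \<and> i \<noteq> j \<and> i \<notin> writes p \<and> j \<notin> writes p)"

section \<open>Frame properties and the loop rule\<close>

lemma iter_frame:
  assumes "\<And>s x. x \<notin> W \<Longrightarrow> fst (f s) x = fst s x" and "x \<notin> insert i W"
  shows "fst (iter i f k s) x = fst s x"
  using assms by (induction k) auto

lemma sem_frame [simp]: "x \<notin> writes p \<Longrightarrow> fst (sem p s) x = fst s x"
proof (induction p arbitrary: s x)
  case (For i j p)
  show ?case unfolding sem.simps
    by (rule iter_frame[of "writes p"]) (use For in auto)
qed auto

lemma iter_counter [simp]: "fst (iter i f k s) i = k"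
  by (cases k) auto

lemma iter_pure: "(\<And>s. snd (f s) = snd s) \<Longrightarrow> snd (iter i f k s) = snd s"
  by (induction k) auto

lemma sem_pure [simp]: "no_write p \<Longrightarrow> snd (sem p s) = snd s"
  by (induction p arbitrary: s) (auto simp: iter_pure)

text \<open>The loop rule supplies the frame condition, so that invariants only mention what changes.\<close>

lemma For_rule:
  assumes "P 0 (setr i 0 s)"
    and "\<And>k s'. \<lbrakk>k < fst s j; P k s'; fst s' i = k; \<And>x. x \<notin> insert i (writes p) \<Longrightarrow> fst s' x = fst s x;
        no_write p \<Longrightarrow> snd s' = snd s\<rbrakk> \<Longrightarrow> P (Suc k) (setr i (Suc k) (sem p s'))"
  shows "P (fst s j) (sem (For i j p) s)"
proof -
  have "P k (iter i (sem p) k s)" if "k \<le> fst s j" for k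
    using that
  proof (induction k)
    case 0
    then show ?case using assms(1) by simp
  next
    case (Suc k)
    show ?case unfolding iter.simps
    proof (rule assms(2))
      show "P k (iter i (sem p) k s)" using Suc by simp
      show "fst (iter i (sem p) k s) x = fst s x" if "x \<notin> insert i (writes p)" for x
        using that by (rule iter_frame[rotated]) simp
      show "snd (iter i (sem p) k s) = snd s" if "no_write p"
        using that by (simp add: iter_pure)
    qed (use Suc.prems in auto)
  qed
  then show ?thesis by simp
qed

text \<open>A while loop unrolls at its first round, but \<open>iter\<close> at its last. Induction
  on the number \<open>m\<close> of rounds still to run, for an arbitrary number \<open>k\<close> of
  rounds done, reconciles the two.\<close>

lemma exec_loop:
  assumes body: "\<And>s. exec c s (etime p s) (sem p s)"
    and ij: "i \<noteq> j" "i \<notin> writes p" "j \<notin> writes p"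
    and "k + m = fst s j"
  shows "exec (WhileLess (Reg i) (Reg j) (Seq c (Assign i (Add (Reg i) (Num 1)))))
    (iter i (sem p) k s) ((\<Sum>k'=k..<k+m. etime p (iter i (sem p) k' s) + 2) + 1)
    (iter i (sem p) (k + m) s)"
  using assms(5)
proof (induction m arbitrary: k)
  case 0
  have "fst (iter i (sem p) k s) j = fst s j"
    using ij by (simp add: iter_frame[where W = "writes p"])
  then show ?case
    using 0 exec.WhileFalse[of "Reg i" "iter i (sem p) k s" "Reg j"] by simp
next
  case (Suc m)
  let ?s = "iter i (sem p) k s"
  let ?W = "WhileLess (Reg i) (Reg j) (Seq c (Assign i (Add (Reg i) (Num 1))))"
  have j: "fst ?s j = fst s j"
    using ij by (simp add: iter_frame[where W = "writes p"])
  have lt: "aval (Reg i) ?s < aval (Reg j) ?s"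
    using j Suc.prems by simp
  have "exec (Seq c (Assign i (Add (Reg i) (Num 1)))) ?s (etime p ?s + 1) (iter i (sem p) (Suc k) s)"
    using exec.Seq[OF body[of ?s] exec.Assign[of i "Add (Reg i) (Num 1)" "sem p ?s"]] ij
    by (simp add: setr_def)
  moreover have "Suc k + m = fst s j" using Suc.prems by simp
  note Suc.IH[OF this]
  ultimately have "exec ?W ?s (etime p ?s + 1 + ((\<Sum>k'=Suc k..<Suc k+m. etime p (iter i (sem p) k' s) + 2) + 1) + 1)
      (iter i (sem p) (Suc k + m) s)"
    by (rule exec.WhileTrue[OF lt])
  moreover have "Suc k + m = k + Suc m" by simp
  moreover have "etime p ?s + 1 + ((\<Sum>k'=Suc k..<k+Suc m. etime p (iter i (sem p) k' s) + 2) + 1) + 1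
      = (\<Sum>k'=k..<k+Suc m. etime p (iter i (sem p) k' s) + 2) + 1"
    by (subst (2) sum.atLeast_Suc_lessThan) simp_all
  ultimately show ?case by metis
qed

theorem compile_correct: "wf_prg p \<Longrightarrow> exec (compile p) s (etime p s) (sem p s)"
proof (induction p arbitrary: s)
  case Nop
  show ?case using exec.Skip[of s] by simp
next
  case (SetR x e)
  show ?case using exec.Assign[of x e s] by (simp add: setr_def)
next
  case (Write d e)
  show ?case using exec.Store[of d e s] by simp
next
  case (Comp p q)
  then show ?case using exec.Seq[of "compile p" s "etime p s" "sem p s"] by simp
next
  case (Cond d e p q)
  then show ?case
    using exec.IfTrue[of d s e "compile p" "etime p s" "sem p s" "compile q"]
      exec.IfFalse[of d s e "compile q" "etime q s" "sem q s" "compile p"] by simp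
next
  case (For i j p)
  then have "exec (WhileLess (Reg i) (Reg j) (Seq (compile p) (Assign i (Add (Reg i) (Num 1)))))
    (iter i (sem p) 0 s) ((\<Sum>k'=0..<0+fst s j. etime p (iter i (sem p) k' s) + 2) + 1)
    (iter i (sem p) (0 + fst s j) s)"
    by (intro exec_loop) auto
  from exec.Seq[OF exec.Assign[of i "Num 0" s]] this
  have "exec (compile (For i j p)) s (1 + ((\<Sum>k'=0..<0+fst s j. etime p (iter i (sem p) k' s) + 2) + 1))
      (iter i (sem p) (0 + fst s j) s)"
    by (simp add: setr_def)
  then show ?case by (simp add: lessThan_atLeast0)
qed

text \<open>Only limits met in the actual run count. A guarded branch may contain loops with
  arbitrarily large limits, as long as the guard fails whenever they are too large.\<close>

fun loops_le :: "nat \<Rightarrow> prg \<Rightarrow> state \<Rightarrow> bool" where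
  "loops_le X Nop s = True"
| "loops_le X (SetR x e) s = True"
| "loops_le X (Write d e) s = True"
| "loops_le X (p ;; q) s = (loops_le X p s \<and> loops_le X q (sem p s))"
| "loops_le X (Cond d e p q) s = (if aval d s < aval e s then loops_le X p s else loops_le X q s)"
| "loops_le X (For i j p) s = (fst s j \<le> X \<and> (\<forall>k<fst s j. loops_le X p (iter i (sem p) k s)))"

fun limits :: "prg \<Rightarrow> nat set" where
  "limits Nop = {}"
| "limits (SetR x e) = {}"
| "limits (Write d e) = {}"
| "limits (p ;; q) = limits p \<union> limits q"
| "limits (Cond d e p q) = limits p \<union> limits q"
| "limits (For i j p) = insert j (limits p)"

text \<open>A limit register that the program never writes keeps its initial value, so one check at
  the start suffices. Longer programs are cut at the places where their limits are computed.\<close>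

lemma loops_le_static:
  "\<forall>j\<in>limits p. j \<notin> writes p \<and> fst s j \<le> X \<Longrightarrow> loops_le X p s"
proof (induction p arbitrary: s)
  case (Comp p q)
  have "loops_le X q (sem p s)"
    by (rule Comp.IH) (use Comp.prems in auto)
  then show ?case using Comp by auto
next
  case (For i j p)
  have "loops_le X p (iter i (sem p) k s)" for k
    by (rule For.IH) (use For.prems in \<open>auto simp: iter_frame[where W = "writes p"]\<close>)
  then show ?case using For by auto
qed auto

fun tbound :: "prg \<Rightarrow> nat \<Rightarrow> nat" where
  "tbound Nop X = 1"
| "tbound (SetR x e) X = 1"
| "tbound (Write d e) X = 1"
| "tbound (p ;; q) X = tbound p X + tbound q X"
| "tbound (Cond d e p q) X = tbound p X + tbound q X + 1"
| "tbound (For i j p) X = 2 + X * (tbound p X + 2)"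

lemma etime_le: "loops_le X p s \<Longrightarrow> etime p s \<le> tbound p X"
proof (induction p arbitrary: s)
  case (Comp p q)
  show ?case using Comp.IH[of s] Comp.IH(2)[of "sem p s"] Comp.prems by simp
next
  case (Cond d e p q)
  show ?case using Cond.IH[of s] Cond.prems by (simp split: if_splits)
next
  case (For i j p)
  have "(\<Sum>k<fst s j. etime p (iter i (sem p) k s) + 2) \<le> fst s j * (tbound p X + 2)"
    using sum_bounded_above[of "{..<fst s j}" "\<lambda>k. etime p (iter i (sem p) k s) + 2" "tbound p X + 2"]
      For by (auto simp del: iter.simps)
  also have "\<dots> \<le> X * (tbound p X + 2)" using For.prems by (intro mult_right_mono) auto
  finally show ?case by simp
qed auto

lemma power_weaken:
  fixes X :: nat
  assumes "X \<ge> 1" "t \<le> a * X ^ d"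
  shows "t \<le> a * X ^ (d + d')"
  using assms(2) mult_left_mono[OF power_increasing[OF le_add1 assms(1)], of a d d'] by linarith

text \<open>Only nesting of loops multiplies, so the degree depends on the program alone. The
  degrees of two parts are added rather than maximised, which is wasteful but lets
  \<open>power_weaken\<close> treat both parts alike.\<close>

lemma tbound_poly: "\<exists>a d. \<forall>X\<ge>1. tbound p X \<le> a * X ^ d"
proof (induction p)
  case Nop
  have "\<forall>X\<ge>1. tbound Nop X \<le> 1 * X ^ 0" by simp
  then show ?case by blast
next
  case (SetR x e)
  have "\<forall>X\<ge>1. tbound (SetR x e) X \<le> 1 * X ^ 0" by simp
  then show ?case by blast
next
  case (Write d e)
  have "\<forall>X\<ge>1. tbound (Write d e) X \<le> 1 * X ^ 0" by simp
  then show ?case by blast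
next
  case (Comp p q)
  then obtain a d a' d' where p: "\<forall>X\<ge>1. tbound p X \<le> a * X ^ d" and q: "\<forall>X\<ge>1. tbound q X \<le> a' * X ^ d'"
    by blast
  have "tbound (p ;; q) X \<le> (a + a') * X ^ (d + d')" if X: "X \<ge> 1" for X
  proof -
    have "tbound p X \<le> a * X ^ (d + d')" using p X by (blast intro: power_weaken)
    moreover have "tbound q X \<le> a' * X ^ (d' + d)" using q X by (blast intro: power_weaken)
    ultimately show ?thesis by (simp add: add_mult_distrib add.commute[of d'])
  qed
  then show ?case by blast
next
  case (Cond b e p q)
  then obtain a d a' d' where p: "\<forall>X\<ge>1. tbound p X \<le> a * X ^ d" and q: "\<forall>X\<ge>1. tbound q X \<le> a' * X ^ d'"
    by blast
  have "tbound (Cond b e p q) X \<le> (a + a' + 1) * X ^ (d + d')" if X: "X \<ge> 1" for X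
  proof -
    have "tbound p X \<le> a * X ^ (d + d')" using p X by (blast intro: power_weaken)
    moreover have "tbound q X \<le> a' * X ^ (d' + d)" using q X by (blast intro: power_weaken)
    moreover have "1 \<le> X ^ (d + d')" using X by (rule one_le_power)
    ultimately show ?thesis by (simp add: add_mult_distrib add.commute[of d'])
  qed
  then show ?case by blast
next
  case (For i j p)
  then obtain a d where ad: "\<forall>X\<ge>1. tbound p X \<le> a * X ^ d" by blast
  have "tbound (For i j p) X \<le> (a + 4) * X ^ Suc d" if X: "X \<ge> 1" for X
  proof -
    have 1: "X * tbound p X \<le> a * X ^ Suc d" using ad X mult_left_mono[of "tbound p X" "a * X ^ d" X]
      by (simp add: mult_ac)
    have "1 \<le> X ^ Suc d" using one_le_power[OF X, of "Suc d"] .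
    moreover have "X \<le> X ^ Suc d" using self_le_power[OF X, of "Suc d"] by simp
    ultimately have "2 + X * 2 \<le> 4 * X ^ Suc d" by linarith
    with 1 show ?thesis
      unfolding tbound.simps add_mult_distrib add_mult_distrib2 by linarith
  qed
  then show ?case by blast
qed

section \<open>From programs to computability and FPT\<close>

lemma computable_prg:
  assumes "wf_prg p" "\<And>n. fst (sem p (init [n])) 0 = f n"
  shows "computable f"
  unfolding computable_def result_def using compile_correct[OF assms(1)] assms(2) by blast

text \<open>Powers are multiplicative, so a bound of the form
  \<open>a * (G \<kappa> * length) ^ d\<close> separates into a function of the parameter and a
  polynomial in the input size.\<close>

theorem FPT_prg:
  assumes "wf_prg p" and f: "computable (\<lambda>\<kappa>. a * G \<kappa> ^ d)"
    and ad: "\<And>X. X \<ge> 1 \<Longrightarrow> tbound p X \<le> a * X ^ d"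
    and loops_le: "\<And>\<kappa> x. loops_le (G \<kappa> * length (\<kappa> # x)) p (init (\<kappa> # x))"
    and G: "\<And>\<kappa>. G \<kappa> \<ge> 1"
    and correct: "\<And>\<kappa> x. fst (sem p (init (\<kappa> # x))) 0 = 1 \<longleftrightarrow> (x, \<kappa>) \<in> L"
  shows "L \<in> FPT"
proof -
  have "etime p (init (\<kappa> # x)) \<le> a * G \<kappa> ^ d * input_size (\<kappa> # x) ^ d" for \<kappa> x
  proof -
    \<comment> \<open>Each number contributes at least its separator symbol, so the input size
      dominates the number of entries.\<close>
    have len: "length y \<le> input_size y" for y
      by (induction y) (auto simp: input_size_def)
    note len = len[of "\<kappa> # x"]
    have "etime p (init (\<kappa> # x)) \<le> tbound p (G \<kappa> * length (\<kappa> # x))"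
      by (rule etime_le) (rule loops_le)
    also have "\<dots> \<le> a * (G \<kappa> * length (\<kappa> # x)) ^ d" using G[of \<kappa>] by (intro ad) simp
    also have "\<dots> \<le> a * (G \<kappa> * input_size (\<kappa> # x)) ^ d"
      by (intro mult_left_mono power_mono len) auto
    finally show ?thesis by (simp add: power_mult_distrib mult_ac)
  qed
  moreover have "result (sem p (init (\<kappa> # x))) = 1 \<longleftrightarrow> (x, \<kappa>) \<in> L" for \<kappa> x
    using correct by (simp add: result_def)
  ultimately show ?thesis
    using compile_correct[OF assms(1)] f unfolding FPT_def by blast
qed

section \<open>Walks and the metric closure\<close>

fun plen :: "('v \<Rightarrow> 'v \<Rightarrow> nat) \<Rightarrow> 'v list \<Rightarrow> nat" where
  "plen f (x # y # zs) = f x y + plen f (y # zs)"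
| "plen f _ = 0"

lemma plen_append: "plen f (xs @ x # ys) = plen f (xs @ [x]) + plen f (x # ys)"
  by (induction f xs rule: plen.induct) (cases ys; auto)+

lemma plen_snoc: "xs \<noteq> [] \<Longrightarrow> plen f (xs @ [y]) = plen f xs + f (last xs) y"
  by (induction f xs rule: plen.induct) auto

lemma walk_weight_plen: "walk_weight I p = plen (\<lambda>u v. weight I {u, v}) p"
proof (induction "\<lambda>u v. weight I {u, v}" p rule: plen.induct)
  case (1 x y zs)
  then show ?case by (simp add: walk_weight_def sum.lessThan_Suc_shift del: sum.lessThan_Suc)
qed (auto simp: walk_weight_def)

lemma walk_Nil [simp]: "\<not> walk I []"
  and walk_single [simp]: "walk I [v] \<longleftrightarrow> v \<in> verts I"
  by (auto simp: walk_def)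

lemma walk_Cons [simp]:
  "walk I (x # y # zs) \<longleftrightarrow> x \<in> verts I \<and> {x, y} \<in> edges I \<and> walk I (y # zs)"
  by (auto simp: walk_def less_Suc_eq_0_disj)

lemma walk_append: "walk I (xs @ x # ys) \<longleftrightarrow> walk I (xs @ [x]) \<and> walk I (x # ys)"
proof (induction xs)
  case Nil
  show ?case by (cases ys) auto
next
  case (Cons a xs)
  then show ?case by (cases xs) auto
qed

lemma walk_rev: "walk I p \<Longrightarrow> walk I (rev p)"
proof (induction p rule: induct_list012)
  case (3 x y zs)
  then have "y \<in> verts I" by (simp add: walk_def)
  then show ?case using 3 walk_append[of I "rev zs" y "[x]"] by (simp add: insert_commute)
qed auto

lemma walk_weight_rev: "walk_weight I (rev p) = walk_weight I p"
proof (induction p rule: induct_list012)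
  case (3 x y zs)
  then show ?case
    using plen_append[of "\<lambda>u v. weight I {u, v}" "rev zs" y "[x]"]
    by (simp add: walk_weight_plen insert_commute)
qed (auto simp: walk_weight_plen)

lemma walk_verts: "walk I p \<Longrightarrow> set p \<subseteq> verts I"
  by (simp add: walk_def)

section \<open>Distances realised by walks\<close>

definition reach :: "'v vrp \<Rightarrow> 'v \<Rightarrow> 'v \<Rightarrow> nat \<Rightarrow> bool" where
  "reach I u v c \<longleftrightarrow> (\<exists>p. walk I p \<and> hd p = u \<and> last p = v \<and> walk_weight I p \<le> c)"

lemma reach_sym: "reach I u v c \<Longrightarrow> reach I v u c"
  unfolding reach_def by (metis walk_rev walk_weight_rev hd_rev last_rev)

lemma walk_join:
  assumes "walk I p" "walk I q" "last p = hd q"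
  shows "walk I (p @ tl q)" "hd (p @ tl q) = hd p" "last (p @ tl q) = last q"
    "set (p @ tl q) = set p \<union> set q" "walk_weight I (p @ tl q) = walk_weight I p + walk_weight I q"
proof -
  obtain x ys where q: "q = x # ys" using assms(2) by (cases q) auto
  obtain xs where p: "p = xs @ [x]" using assms(1,3) q by (cases p rule: rev_cases) auto
  show "walk I (p @ tl q)" using assms walk_append[of I xs x ys] by (simp add: p q)
  show "hd (p @ tl q) = hd p" using p by (cases xs) auto
  show "last (p @ tl q) = last q" using p q by simp
  show "set (p @ tl q) = set p \<union> set q" using p q by auto
  show "walk_weight I (p @ tl q) = walk_weight I p + walk_weight I q"
    using plen_append[of "\<lambda>u v. weight I {u, v}" xs x ys] by (simp add: p q walk_weight_plen)
qed

lemma reach_trans: "\<lbrakk>reach I u v c; reach I v w d\<rbrakk> \<Longrightarrow> reach I u w (c + d)"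
  unfolding reach_def using walk_join by (metis add_mono)

text \<open>Distances are only needed up to the budget of the instance, so larger ones, including
  infinite ones, may be replaced by any number above the budget.\<close>

definition upper_dist :: "'v vrp \<Rightarrow> ('v \<Rightarrow> 'v \<Rightarrow> nat) \<Rightarrow> bool" where
  "upper_dist I D \<longleftrightarrow> (\<forall>u\<in>verts I. \<forall>v\<in>verts I. D u v \<le> bound I \<longrightarrow> reach I u v (D u v))"

text \<open>In contrast to \<open>upper_dist\<close> this is not cut off at the budget. Turning a
  candidate into a routing rests on \<open>upper_dist\<close> alone, and the converse on
  \<open>lower_dist\<close> alone.\<close>

definition lower_dist :: "'v vrp \<Rightarrow> ('v \<Rightarrow> 'v \<Rightarrow> nat) \<Rightarrow> bool" where
  "lower_dist I D \<longleftrightarrow> (\<forall>p. walk I p \<longrightarrow> D (hd p) (last p) \<le> walk_weight I p)"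

text \<open>No leg exceeds the total, so every distance used is within the budget, where
  \<open>upper_dist\<close> guarantees an actual walk.\<close>

lemma walk_of_tour:
  assumes D: "upper_dist I D" and "set (u # xs) \<subseteq> verts I" "plen D (u # xs) \<le> bound I"
  shows "\<exists>p. walk I p \<and> hd p = u \<and> last p = last (u # xs) \<and> set (u # xs) \<subseteq> set p \<and>
    walk_weight I p \<le> plen D (u # xs)"
  using assms(2,3)
proof (induction xs arbitrary: u)
  case Nil
  then show ?case by (intro exI[of _ "[u]"]) (auto simp: walk_weight_plen)
next
  case (Cons v xs)
  from Cons.IH[of v] Cons.prems obtain q where q: "walk I q" "hd q = v" "last q = last (v # xs)"
    "set (v # xs) \<subseteq> set q" "walk_weight I q \<le> plen D (v # xs)" by auto
  have "reach I u v (D u v)" using D Cons.prems by (auto simp: upper_dist_def)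
  then obtain p where p: "walk I p" "hd p = u" "last p = v" "walk_weight I p \<le> D u v"
    by (auto simp: reach_def)
  have "u \<in> set p" using p by (cases p) auto
  then show ?case using walk_join[OF p(1) q(1)] p q by (intro exI[of _ "p @ tl q"]) auto
qed

text \<open>Cut the walk at the listed vertices; each piece weighs at least as much as the distance
  between its ends.\<close>

lemma tour_of_walk:
  assumes D: "lower_dist I D" and "walk I p" "subseq xs p"
  shows "plen D (hd p # xs @ [last p]) \<le> walk_weight I p"
  using assms(2,3)
proof (induction xs arbitrary: p)
  case Nil
  then show ?case using D by (auto simp: lower_dist_def)
next
  case (Cons x xs)
  from Cons.prems(2) obtain a b where p: "p = a @ x # b" and "subseq xs b"
    by (auto dest: list_emb_ConsD)
  then have "subseq xs (x # b)" by blast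
  moreover have w: "walk I (a @ [x])" "walk I (x # b)"
    using Cons.prems(1) walk_append[of I a x b] p by auto
  ultimately have "plen D (x # xs @ [last (x # b)]) \<le> walk_weight I (x # b)"
    using Cons.IH[of "x # b"] by simp
  moreover have "D (hd p) x \<le> walk_weight I (a @ [x])"
    using D[unfolded lower_dist_def, rule_format, OF w(1)] p by (cases a) simp_all
  ultimately show ?case
    using plen_append[of "\<lambda>u v. weight I {u, v}" a x b] p by (simp add: walk_weight_plen)
qed

lemma D_self: "\<lbrakk>lower_dist I D; v \<in> verts I\<rbrakk> \<Longrightarrow> D v v = 0"
  unfolding lower_dist_def by (drule spec[of _ "[v]"]) (simp add: walk_weight_plen)

text \<open>A walk of weight 0 from \<open>u\<close> to \<open>v\<close>, driven backwards, bounds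
  the distance in the other direction.\<close>

lemma D_zero_sym:
  assumes "upper_dist I D" "lower_dist I D" "u \<in> verts I" "v \<in> verts I" "D u v = 0"
  shows "D v u = 0"
proof -
  have "reach I u v (D u v)" using assms(1,3-5) unfolding upper_dist_def by (metis zero_le)
  then have "reach I v u 0" using assms(5) reach_sym[of I u v 0] by simp
  then show ?thesis using assms(2) unfolding reach_def lower_dist_def by fastforce
qed

text \<open>Driving out and back along a walk of weight 0 costs nothing, and such a round trip can
  be inserted wherever its start occurs.\<close>

lemma walk_detours:
  assumes "finite X" "walk I p" "\<forall>x\<in>X. \<exists>y\<in>set p. reach I y x 0"
  shows "\<exists>p'. walk I p' \<and> hd p' = hd p \<and> last p' = last p \<and> set p \<union> X \<subseteq> set p' \<and>
    walk_weight I p' \<le> walk_weight I p"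
  using assms(1,3)
proof (induction X rule: finite_induct)
  case empty
  then show ?case using assms(2) by auto
next
  case (insert x X)
  then obtain p' where p': "walk I p'" "hd p' = hd p" "last p' = last p" "set p \<union> X \<subseteq> set p'"
    "walk_weight I p' \<le> walk_weight I p" by auto
  from insert.prems obtain y where y: "y \<in> set p" "reach I y x 0" by auto
  then obtain z where z: "walk I z" "hd z = y" "last z = x" "walk_weight I z = 0"
    by (auto simp: reach_def)
  have z': "walk I (rev z)" "hd (rev z) = x" "last (rev z) = y" "walk_weight I (rev z) = 0"
    using z by (auto simp: walk_rev walk_weight_rev hd_rev last_rev)
  let ?zz = "z @ tl (rev z)"
  have "z \<noteq> []" using z(1) by auto
  then have "x \<in> set ?zz" using last_in_set[of z] z(3) by simp
  moreover have "last z = hd (rev z)" using z(3) z'(2) by simp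
  note walk_join[OF z(1) z'(1) this]
  ultimately have zz: "walk I ?zz" "hd ?zz = y" "last ?zz = y" "x \<in> set ?zz" "walk_weight I ?zz = 0"
    using z z' by (simp_all del: set_append)
  obtain a b where ab: "p' = a @ y # b" using split_list[of y p'] y(1) p'(4) by blast
  have w: "walk I (a @ [y])" "walk I (y # b)" using p'(1) walk_append[of I a y b] ab by auto
  let ?q = "(a @ [y]) @ tl ?zz"
  have q: "walk I ?q" "hd ?q = hd (a @ [y])" "last ?q = y" "set ?q = set (a @ [y]) \<union> set ?zz"
    "walk_weight I ?q = walk_weight I (a @ [y])"
    using walk_join[OF w(1) zz(1)] zz by simp_all
  let ?p = "?q @ tl (y # b)"
  have p: "walk I ?p" "hd ?p = hd ?q" "last ?p = last (y # b)" "set ?p = set ?q \<union> set (y # b)"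
    "walk_weight I ?p = walk_weight I (a @ [y]) + walk_weight I (y # b)"
    using walk_join[OF q(1) w(2)] q(3,5) by (simp_all only: list.sel)
  show ?case
  proof (intro exI[of _ ?p] conjI)
    show "walk I ?p" by (rule p(1))
    show "hd ?p = hd p" using p(2) q(2) p'(2) ab by (cases a) auto
    show "last ?p = last p" using p(3) p'(3) ab by simp
    show "set p \<union> insert x X \<subseteq> set ?p"
      using p(4) q(4) zz(4) p'(4) ab by (auto simp del: set_append) auto
    show "walk_weight I ?p \<le> walk_weight I p"
      using p(5) p'(5) ab plen_append[of "\<lambda>u v. weight I {u, v}" a y b]
      by (simp add: walk_weight_plen)
  qed
qed


section \<open>The Floyd-Warshall recurrence\<close>

text \<open>The lower-bound half of Floyd-Warshall at stage \<open>w\<close>, where the inner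
  vertices of a walk are below \<open>w\<close>. The other half, \<open>upper_dist\<close>, is
  preserved by every single relaxation and so carries no stage.\<close>

definition dom :: "nat vrp \<Rightarrow> nat \<Rightarrow> nat \<Rightarrow> nat \<Rightarrow> nat \<Rightarrow> bool" where
  "dom I w u v x \<longleftrightarrow> (\<forall>p. walk I p \<and> hd p = u \<and> last p = v \<and> set (butlast (tl p)) \<subseteq> {..<w} \<longrightarrow>
     x \<le> walk_weight I p)"

lemma dom_mono: "\<lbrakk>dom I w u v x; y \<le> x\<rbrakk> \<Longrightarrow> dom I w u v y"
  unfolding dom_def using le_trans by blast

lemma dom_Suc:
  assumes "dom I w u v a" "dom I w u w b" "dom I w w v c" "x \<le> a" "x \<le> b + c"
  shows "dom I (Suc w) u v x"
  unfolding dom_def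
proof (intro allI impI, elim conjE)
  fix p assume p: "walk I p" "hd p = u" "last p = v" "set (butlast (tl p)) \<subseteq> {..<Suc w}"
  show "x \<le> walk_weight I p"
  proof (cases "w \<in> set (butlast (tl p))")
    case False
    then have "set (butlast (tl p)) \<subseteq> {..<w}" using p(4) by (auto simp: less_Suc_eq)
    then show ?thesis using assms(1,4) p unfolding dom_def by fastforce
  next
    case True
    define q where "q = butlast (tl p)"
    have "tl p \<noteq> []" using True by auto
    then have "last (tl p) = v" using p(3) by (metis last_tl)
    then have pq: "p = u # q @ [v]"
      using \<open>tl p \<noteq> []\<close> p(2) unfolding q_def by (metis append_butlast_last_id list.collapse tl_Nil)
    \<comment> \<open>Split at the first and at the last visit of \<open>w\<close>; whatever lies
      between is dropped, which can only reduce the weight.\<close>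
    obtain q1 q2 where q1: "q = q1 @ w # q2" "w \<notin> set q1"
      using True split_list_first unfolding q_def by metis
    obtain z q4 where q4: "w # q2 = z @ w # q4" "w \<notin> set q4"
      using split_list_last[of w "w # q2"] by auto
    have sub: "set q1 \<subseteq> {..<w}" "set q4 \<subseteq> {..<w}"
    proof -
      have "set q4 \<subseteq> set (w # q2)" unfolding q4(1) by auto
      then show "set q1 \<subseteq> {..<w}" "set q4 \<subseteq> {..<w}"
        using p(4) q1 q4(2) unfolding q_def[symmetric] by (auto simp: less_Suc_eq)
    qed
    have e1: "p = (u # q1) @ w # (q2 @ [v])" using pq q1 by simp
    have e2: "w # (q2 @ [v]) = z @ w # (q4 @ [v])" using q4(1) by (metis append_Cons append_assoc)
    have w: "walk I (u # q1 @ [w])" "walk I (w # q4 @ [v])"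
      using p(1) walk_append[of I "u # q1" w "q2 @ [v]"] walk_append[of I z w "q4 @ [v]"] e1 e2 by auto
    have "b \<le> walk_weight I (u # q1 @ [w])"
      using assms(2) w(1) sub(1) unfolding dom_def by (auto dest!: spec[of _ "u # q1 @ [w]"])
    moreover have "c \<le> walk_weight I (w # q4 @ [v])"
      using assms(3) w(2) sub(2) unfolding dom_def by (auto dest!: spec[of _ "w # q4 @ [v]"])
    moreover have "walk_weight I (u # q1 @ [w]) + walk_weight I (w # q4 @ [v]) \<le> walk_weight I p"
      unfolding walk_weight_plen
      using plen_append[of "\<lambda>u v. weight I {u, v}" "u # q1" w "q2 @ [v]"]
        plen_append[of "\<lambda>u v. weight I {u, v}" z w "q4 @ [v]"] e1 e2 by simp
    ultimately show ?thesis using assms(5) by linarith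
  qed
qed

lemma dom_init:
  assumes "vrp_instance I" "D = (if u = v then 0 else if {u, v} \<in> edges I then weight I {u, v} else x)"
  shows "dom I 0 u v D"
  unfolding dom_def
proof (intro allI impI, elim conjE)
  fix p assume p: "walk I p" "hd p = u" "last p = v" "set (butlast (tl p)) \<subseteq> {..<0}"
  show "D \<le> walk_weight I p"
  proof -
    \<comment> \<open>Without inner vertices a walk has at most two vertices. For distinct
      non-adjacent \<open>u\<close> and \<open>v\<close> there is none, so \<open>x\<close> may be
      anything.\<close>
    consider a where "p = [a]" | a b where "p = [a, b]" | a b c q where "p = a # b # c # q"
      using p(1) by (cases p rule: remdups_adj.cases) (auto, metis list.exhaust)
    then show ?thesis using p assms by cases (auto simp: walk_weight_plen vrp_instance_def)
  qed
qed

lemma dom_lower_dist: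
  fixes I :: "nat vrp"
  assumes "verts I = {..<n}" "\<And>u v. u < n \<Longrightarrow> v < n \<Longrightarrow> dom I n u v (D u v)"
  shows "lower_dist I D"
  unfolding lower_dist_def
proof (intro allI impI)
  fix p assume p: "walk I p"
  then have s: "set p \<subseteq> {..<n}" "p \<noteq> []" using walk_verts[OF p] assms(1) by auto
  then have "hd p < n" "last p < n" using hd_in_set[of p] last_in_set[of p] by (meson lessThan_iff subsetD)+
  moreover have "set (butlast (tl p)) \<subseteq> {..<n}"
    using s by (meson in_set_butlastD list.set_sel(2) subset_code(1) tl_Nil)
  ultimately show "D (hd p) (last p) \<le> walk_weight I p"
    using assms(2)[of "hd p" "last p"] p unfolding dom_def by blast
qed

lemma upper_dist_init:
  assumes "vrp_instance I"
    "\<And>u v. u \<in> verts I \<Longrightarrow> v \<in> verts I \<Longrightarrow>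
      D u v = (if u = v then 0 else if {u, v} \<in> edges I then weight I {u, v} else Suc (bound I))"
  shows "upper_dist I D"
  unfolding upper_dist_def
proof (intro ballI impI)
  fix u v assume uv: "u \<in> verts I" "v \<in> verts I" and le: "D u v \<le> bound I"
  show "reach I u v (D u v)"
  proof (cases "u = v")
    case True
    then show ?thesis using uv unfolding reach_def by (intro exI[of _ "[u]"]) (auto simp: walk_weight_plen)
  next
    case False
    then show ?thesis using uv le assms(2)[OF uv] unfolding reach_def
      by (intro exI[of _ "[u, v]"]) (auto simp: walk_weight_plen split: if_splits)
  qed
qed

lemma upper_dist_relax:
  assumes "upper_dist I D" "u \<in> verts I" "w \<in> verts I" "v \<in> verts I"
  shows "upper_dist I (D(u := (D u)(v := D u w + D w v)))"
proof -
  have "reach I u v (D u w + D w v)" if "D u w + D w v \<le> bound I"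
    using that assms by (intro reach_trans[of _ u w _ v]) (auto simp: upper_dist_def)
  then show ?thesis using assms(1) by (auto simp: upper_dist_def)
qed


section \<open>Searching for a routing\<close>

text \<open>
  A candidate solution assigns to the client with index \<open>j\<close> a slot \<open>e j < k * m\<close>, where \<open>m\<close> is the
  number of clients: slot \<open>i * m + p\<close> means position \<open>p\<close> on the tour of vehicle \<open>i\<close>.  Clients in the
  same slot are visited in the order of their indices.
\<close>

fun visits :: "nat \<Rightarrow> (nat \<Rightarrow> nat) \<Rightarrow> nat \<Rightarrow> nat \<Rightarrow> nat list" where
  "visits m e b 0 = []"
| "visits m e b (Suc p) = visits m e b p @ filter (\<lambda>j. e j = b + p) [0..<m]"

text \<open>The default \<open>Suc r\<close> exceeds the budget by itself, so a sum within the
  budget certifies that every vehicle has a feasible tour.\<close>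

fun best :: "(nat \<Rightarrow> nat \<Rightarrow> nat) \<Rightarrow> nat set \<Rightarrow> nat \<Rightarrow> nat \<Rightarrow> nat \<Rightarrow> (nat \<Rightarrow> nat) \<Rightarrow> nat list \<Rightarrow> nat \<Rightarrow> nat" where
  "best D S r l g \<Lambda> xs 0 = Suc r"
| "best D S r l g \<Lambda> xs (Suc d) =
     (let b = best D S r l g \<Lambda> xs d; t = plen D (d # xs @ [d]) in
      if d \<in> S \<and> sum_list (map \<Lambda> xs) \<le> l \<and> t \<le> g \<and> t < b then t else b)"

definition total_cost :: "(nat \<Rightarrow> nat \<Rightarrow> nat) \<Rightarrow> nat set \<Rightarrow> nat \<Rightarrow> nat \<Rightarrow> nat \<Rightarrow> (nat \<Rightarrow> nat) \<Rightarrow> nat list \<Rightarrow> nat \<Rightarrow>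
    (nat \<Rightarrow> nat) \<Rightarrow> nat \<Rightarrow> nat" where
  "total_cost D S r l g \<Lambda> lst n e k =
     (\<Sum>i<k. best D S r l g \<Lambda> (map ((!) lst) (visits (length lst) e (i * length lst) (length lst))) n)"

lemma best_le:
  assumes "d < n" "d \<in> S" "sum_list (map \<Lambda> xs) \<le> l" "plen D (d # xs @ [d]) \<le> g"
  shows "best D S r l g \<Lambda> xs n \<le> plen D (d # xs @ [d])"
  using assms by (induction n) (auto simp: Let_def less_Suc_eq)

lemma best_feasible:
  "best D S r l g \<Lambda> xs n \<le> r \<Longrightarrow> \<exists>d<n. d \<in> S \<and> sum_list (map \<Lambda> xs) \<le> l \<and>
     plen D (d # xs @ [d]) \<le> g \<and> plen D (d # xs @ [d]) = best D S r l g \<Lambda> xs n"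
  by (induction n) (auto simp: Let_def less_Suc_eq)

lemma set_visits: "set (visits m e b p) = {j. j < m \<and> (\<exists>q<p. e j = b + q)}"
  by (induction p) (auto simp: less_Suc_eq)

lemma distinct_visits: "distinct (visits m e b p)"
  by (induction p) (auto simp: set_visits)

lemma filter_unique:
  assumes "j < m" "\<And>i. i < m \<Longrightarrow> P i \<longleftrightarrow> i = j"
  shows "filter P [0..<m] = [j]"
proof -
  have "[0..<m] = [0..<j] @ j # [Suc j..<m]"
    using assms(1) by (metis le0 le_add_diff_inverse less_imp_le upt_add_eq_append upt_conv_Cons)
  then show ?thesis using assms by (auto simp: filter_empty_conv)
qed

lemma subseq_remdups: "subseq (remdups xs) xs"
  by (induction xs) auto

text \<open>The vehicle of a client is the quotient of its slot by \<open>m\<close>. Each summand of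
  the cost is within the budget, so \<open>best\<close> comes with a depot, and the tour with an
  actual walk.\<close>

lemma routing_of_slots:
  assumes inst: "vrp_instance J" "verts J = {..<n}" "clients J = set lst" "distinct lst"
    and D: "upper_dist J D" and e: "\<And>j. j < length lst \<Longrightarrow> e j < k * length lst"
    and tot: "total_cost D (depots J) (bound J) l g \<Lambda> lst n e k \<le> bound J" and k: "k = vehicles J"
  shows "load_gas_cvrp_solvable J l \<Lambda> g"
proof -
  define m where "m = length lst"
  define V where "V i = visits m e (i * m) m" for i
  define xs where "xs i = map ((!) lst) (V i)" for i
  define b where "b i = best D (depots J) (bound J) l g \<Lambda> (xs i) n" for i
  have tot: "(\<Sum>i<k. b i) \<le> bound J"
    using tot by (simp add: total_cost_def b_def xs_def V_def m_def)
  have setV: "set (V i) = {j. j < m \<and> e j div m = i}" for i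
  proof -
    have "(\<exists>q<m. e j = i * m + q) \<longleftrightarrow> e j div m = i" if "j < m" for j
      using that by (metis div_mult_mod_eq div_mult_self3 div_less add.right_neutral add.commute
        mod_less_divisor not_less_zero bot_nat_0.not_eq_extremum)
    then show ?thesis by (auto simp: V_def set_visits)
  qed
  have xsn: "set (xs i) \<subseteq> {..<n}" for i
    using inst by (auto simp: xs_def setV m_def vrp_instance_def)
  have ex: "\<exists>d p. d \<in> depots J \<and> sum_list (map \<Lambda> (xs i)) \<le> l \<and> walk J p \<and> hd p = d \<and> last p = d \<and>
      set (xs i) \<subseteq> set p \<and> walk_weight J p \<le> b i \<and> b i \<le> g" if "i < k" for i
  proof -
    have bi: "b i \<le> bound J"
      using tot member_le_sum[of i "{..<k}" b] that by auto
    then obtain d where d: "d < n" "d \<in> depots J" "sum_list (map \<Lambda> (xs i)) \<le> l"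
       "plen D (d # xs i @ [d]) \<le> g" "plen D (d # xs i @ [d]) = b i"
      using best_feasible unfolding b_def by blast
    moreover obtain p where "walk J p" "hd p = d" "last p = last (d # xs i @ [d])"
       "set (d # xs i @ [d]) \<subseteq> set p" "walk_weight J p \<le> plen D (d # xs i @ [d])"
      using walk_of_tour[OF D, of d "xs i @ [d]"] d bi xsn inst(2) by auto
    ultimately show ?thesis by (intro exI[of _ d] exI[of _ p]) auto
  qed
  then obtain p where p: "\<And>i. i < k \<Longrightarrow> hd (p i) \<in> depots J \<and> sum_list (map \<Lambda> (xs i)) \<le> l \<and>
      walk J (p i) \<and> last (p i) = hd (p i) \<and> set (xs i) \<subseteq> set (p i) \<and> walk_weight J (p i) \<le> b i \<and> b i \<le> g"
    by metis
  have "\<forall>c\<in>set lst. \<exists>j<m. lst ! j = c" by (auto simp: in_set_conv_nth m_def)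
  \<comment> \<open>Clients are assigned through their index in \<open>lst\<close>, which is unique
    because \<open>lst\<close> is distinct.\<close>
  then obtain ix where ix: "\<And>c. c \<in> set lst \<Longrightarrow> ix c < m \<and> lst ! ix c = c" by metis
  have ix_nth: "ix (lst ! j) = j" if "j < m" for j
    using that ix[of "lst ! j"] inst(4) by (metis m_def nth_eq_iff_index_eq nth_mem)
  define A where "A c = e (ix c) div m" for c
  let ?R = "map p [0..<k]"
  have Ac: "A c < k" "c \<in> set (p (A c))" if "c \<in> set lst" for c
  proof -
    have "e (ix c) < k * m" using e ix[OF that] by (simp add: m_def)
    then show "A c < k" by (simp add: A_def less_mult_imp_div_less)
    have "ix c \<in> set (V (A c))" using ix[OF that] by (simp add: setV A_def)
    then have "c \<in> set (xs (A c))" using ix[OF that] unfolding xs_def by force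
    then show "c \<in> set (p (A c))" using p[OF \<open>A c < k\<close>] by blast
  qed
  have load: "(\<Sum>c | c \<in> clients J \<and> A c = i. \<Lambda> c) \<le> l" if "i < k" for i
  proof -
    \<comment> \<open>No client occurs twice on a tour, so the load summed along the tour is the
      load of the vehicle.\<close>
    have "distinct (xs i)"
      unfolding xs_def distinct_map using distinct_visits[of m e "i * m" m] inst(4)
      by (auto simp: V_def inj_on_def set_visits nth_eq_iff_index_eq m_def)
    moreover have "set (xs i) = {c. c \<in> clients J \<and> A c = i}"
    proof -
      have "lst ! j \<in> set lst \<and> A (lst ! j) = i" if "j \<in> set (V i)" for j
        using that ix_nth by (auto simp: setV A_def m_def)
      moreover have "c \<in> set (xs i)" if "c \<in> set lst" "A c = i" for c
        using ix[OF that(1)] that(2) unfolding xs_def by (force simp: setV A_def)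
      ultimately show ?thesis using inst(3) by (auto simp: xs_def)
    qed
    ultimately show ?thesis using p[OF that] by (metis sum_list_distinct_conv_sum_set)
  qed
  have "routing J ?R A"
    using p Ac inst(3) k by (auto simp: routing_def closed_walk_def)
  moreover have "load_constraint J l \<Lambda> ?R A" using load by (auto simp: load_constraint_def)
  moreover have "gas_constraint J g ?R"
    using p by (auto simp: gas_constraint_def) (meson le_trans)
  moreover have "routing_weight J ?R \<le> bound J"
  proof -
    have "routing_weight J ?R = (\<Sum>i<k. walk_weight J (p i))"
      by (simp add: routing_weight_def comp_def interv_sum_list_conv_sum_set_nat lessThan_atLeast0)
    also have "\<dots> \<le> (\<Sum>i<k. b i)" using p by (intro sum_mono) auto
    finally show ?thesis using tot by linarith
  qed
  ultimately show ?thesis unfolding load_gas_cvrp_solvable_def by blast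
qed

text \<open>Each client gets the slot given by its vehicle and its rank among the clients of that
  vehicle. At most \<open>m\<close> clients share a vehicle, so the ranks fit, and no two clients
  share a slot.\<close>

lemma slots_of_routing:
  assumes inst: "vrp_instance J" "verts J = {..<n}" "clients J = set lst" "distinct lst"
    and D: "lower_dist J D" and solv: "load_gas_cvrp_solvable J l \<Lambda> g" and k: "k = vehicles J"
  shows "\<exists>e. (\<forall>j<length lst. e j < k * length lst) \<and>
    total_cost D (depots J) (bound J) l g \<Lambda> lst n e k \<le> bound J"
proof -
  define m where "m = length lst"
  from solv obtain R A where R: "routing J R A" "load_constraint J l \<Lambda> R A" "gas_constraint J g R"
    "routing_weight J R \<le> bound J" unfolding load_gas_cvrp_solvable_def by blast
  have Rk: "length R \<le> k" using R(1) k by (simp add: routing_def)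
  have A: "A c < length R" "c \<in> set (R ! A c)" if "c \<in> set lst" for c
    using R(1) inst(3) that by (auto simp: routing_def)
  \<comment> \<open>Each client of the vehicle is kept once, in an order in which the walk meets
    them; clients served by other vehicles are passed without stopping.\<close>
  define xs where "xs i = (if i < length R then filter (\<lambda>c. c \<in> set lst \<and> A c = i) (remdups (R ! i)) else [])" for i
  have dxs: "distinct (xs i)" for i by (simp add: xs_def)
  have sxs: "set (xs i) = {c \<in> set lst. A c = i}" for i
    using A by (auto simp: xs_def)
  have lxs: "length (xs i) \<le> m" for i
  proof -
    have "length (xs i) = card (set (xs i))" using dxs distinct_card by metis
    also have "\<dots> \<le> card (set lst)" by (rule card_mono) (auto simp: sxs)
    also have "\<dots> \<le> m" by (simp add: m_def card_length)
    finally show ?thesis .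
  qed
  have "\<forall>c\<in>set lst. \<exists>p<length (xs (A c)). xs (A c) ! p = c"
    using sxs by (force simp flip: in_set_conv_nth)
  then obtain pos where pos: "\<And>c. c \<in> set lst \<Longrightarrow> pos c < length (xs (A c)) \<and> xs (A c) ! pos c = c"
    by metis
  have posm: "pos c < m" if "c \<in> set lst" for c using pos[OF that] lxs[of "A c"] by linarith
  define e where "e j = A (lst ! j) * m + pos (lst ! j)" for j
  have e_less: "e j < k * m" if "j < m" for j
  proof -
    have c: "lst ! j \<in> set lst" using that by (simp add: m_def)
    have "e j < Suc (A (lst ! j)) * m" using posm[OF c] by (simp add: e_def)
    also have "\<dots> \<le> k * m" using A(1)[OF c] Rk by (intro mult_right_mono) auto
    finally show ?thesis .
  qed
  have e_iff: "e j = i * m + p \<longleftrightarrow> A (lst ! j) = i \<and> pos (lst ! j) = p" if "j < m" "p < m" for i j p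
  proof
    assume eq: "e j = i * m + p"
    have "pos (lst ! j) < m" using posm that by (simp add: m_def)
    then have "e j div m = A (lst ! j)" "e j mod m = pos (lst ! j)" by (auto simp: e_def)
    moreover have "(i * m + p) div m = i" "(i * m + p) mod m = p" using that by auto
    ultimately show "A (lst ! j) = i \<and> pos (lst ! j) = p" using eq by simp
  qed (simp add: e_def)
  \<comment> \<open>Reading the slots of vehicle \<open>i\<close> recovers its clients in order; the
    slots beyond the last one are empty.\<close>
  have vis: "map ((!) lst) (visits m e (i * m) p) = take p (xs i)" if "p \<le> m" for i p
    using that
  proof (induction p)
    case (Suc p)
    have "map ((!) lst) (filter (\<lambda>j. e j = i * m + p) [0..<m]) = (if p < length (xs i) then [xs i ! p] else [])"
    proof (cases "p < length (xs i)")
      case True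
      then have c: "xs i ! p \<in> set lst" "A (xs i ! p) = i" using sxs[of i] nth_mem[OF True] by auto
      then obtain j where j: "j < m" "lst ! j = xs i ! p" by (metis in_set_conv_nth m_def)
      have "e j' = i * m + p \<longleftrightarrow> j' = j" if "j' < m" for j'
      proof -
        have c': "lst ! j' \<in> set lst" using that by (simp add: m_def)
        have "A (lst ! j') = i \<and> pos (lst ! j') = p \<longleftrightarrow> lst ! j' = xs i ! p"
          using pos[OF c'] pos[OF c(1)] c True dxs[of i] by (metis nth_eq_iff_index_eq)
        then show ?thesis using e_iff[OF that] Suc.prems j that inst(4)
          by (metis Suc_le_lessD m_def nth_eq_iff_index_eq)
      qed
      then have "filter (\<lambda>j. e j = i * m + p) [0..<m] = [j]" by (intro filter_unique) (auto simp: j)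
      then show ?thesis using True j by simp
    next
      case False
      have "e j \<noteq> i * m + p" if "j < m" for j
      proof
        assume "e j = i * m + p"
        then have "A (lst ! j) = i" "pos (lst ! j) = p" using e_iff[OF that] Suc.prems by auto
        then show False using pos[of "lst ! j"] that False by (auto simp: m_def)
      qed
      then show ?thesis using False by (auto simp: filter_empty_conv)
    qed
    then show ?case using Suc by (simp add: take_Suc_conv_app_nth)
  qed simp
  define b where "b i = best D (depots J) (bound J) l g \<Lambda> (xs i) n" for i
  have "total_cost D (depots J) (bound J) l g \<Lambda> lst n e k = (\<Sum>i<k. b i)"
    unfolding total_cost_def b_def using vis lxs by (simp add: m_def)
  also have "\<dots> = (\<Sum>i<length R. b i) + (\<Sum>i=length R..<k. b i)"
    using Rk by (simp add: lessThan_atLeast0 sum.atLeastLessThan_concat)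
  also have "\<dots> \<le> (\<Sum>i<length R. walk_weight J (R ! i)) + (\<Sum>i=length R..<k. 0)"
  proof (intro add_mono sum_mono)
    fix i assume "i \<in> {..<length R}"
    then have i: "i < length R" by simp
    let ?p = "R ! i"
    have p: "walk J ?p" "last ?p = hd ?p" "hd ?p \<in> depots J" "walk_weight J ?p \<le> g"
      using R(1,3) nth_mem[OF i] by (auto simp: routing_def closed_walk_def gas_constraint_def)
    have "subseq (xs i) ?p"
      unfolding xs_def using i
      by (auto intro: subseq_order.order_trans[OF subseq_filter_left subseq_remdups])
    then have t: "plen D (hd ?p # xs i @ [hd ?p]) \<le> walk_weight J ?p"
      using tour_of_walk[OF D p(1), of "xs i"] p(2) by simp
    have "sum_list (map \<Lambda> (xs i)) = (\<Sum>c | c \<in> clients J \<and> A c = i. \<Lambda> c)"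
      using sum_list_distinct_conv_sum_set[OF dxs] sxs inst(3) by simp
    also have "\<dots> \<le> l" using R(2) i by (auto simp: load_constraint_def)
    finally have "b i \<le> plen D (hd ?p # xs i @ [hd ?p])"
      unfolding b_def using p t inst by (intro best_le) (auto simp: vrp_instance_def)
    then show "b i \<le> walk_weight J ?p" using t by linarith
  next
    \<comment> \<open>A candidate always uses \<open>k\<close> vehicles. A surplus one stays at some
      depot, which costs \<open>D d d = 0\<close>.\<close>
    fix i assume "i \<in> {length R..<k}"
    then have "xs i = []" by (simp add: xs_def)
    moreover obtain d where d: "d \<in> depots J" "d \<in> verts J" using inst(1) by (auto simp: vrp_instance_def)
    ultimately have "b i \<le> plen D (d # xs i @ [d])"
      unfolding b_def using inst(2) D_self[OF D d(2)] by (intro best_le) auto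
    then show "b i \<le> 0" using \<open>xs i = []\<close> D_self[OF D d(2)] by simp
  qed
  also have "\<dots> = routing_weight J R"
    by (simp add: routing_weight_def sum_list_sum_nth lessThan_atLeast0)
  also note R(4)
  finally show ?thesis using e_less unfolding m_def by blast
qed


section \<open>Bounding the number of clients\<close>

lemma card_by_vehicle:
  assumes "finite C" "\<And>c. c \<in> C \<Longrightarrow> A c < k'" "k' \<le> k" "\<And>i. i < k' \<Longrightarrow> card {c \<in> C. A c = i} \<le> b"
  shows "card C \<le> k * (b::nat)"
proof -
  have "C = (\<Union>i<k'. {c \<in> C. A c = i})" using assms(2) by auto
  then have "card C \<le> (\<Sum>i<k'. card {c \<in> C. A c = i})" using card_UN_le[of "{..<k'}"] by (metis finite_lessThan)
  also have "\<dots> \<le> k' * b" using sum_bounded_above[of "{..<k'}" "\<lambda>i. card {c \<in> C. A c = i}" b] assms(4) by simp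
  also have "\<dots> \<le> k * b" using assms(3) by simp
  finally show ?thesis .
qed

lemma load_client_bound:
  assumes "vrp_instance I" "positive_demands I \<Lambda>" "load_cvrp_solvable I l \<Lambda>"
  shows "card (clients I) \<le> vehicles I * l"
proof -
  from assms obtain R A where R: "routing I R A" "load_constraint I l \<Lambda> R A"
    unfolding load_cvrp_solvable_def by blast
  have fin: "finite (clients I)" using assms(1) by (auto simp: vrp_instance_def intro: finite_subset)
  show ?thesis
  proof (rule card_by_vehicle[OF fin])
    fix i assume i: "i < length R"
    have "card {c \<in> clients I. A c = i} = (\<Sum>c | c \<in> clients I \<and> A c = i. 1)" by simp
    also have "\<dots> \<le> (\<Sum>c | c \<in> clients I \<and> A c = i. \<Lambda> c)"
      using assms(2) by (intro sum_mono) (auto simp: positive_demands_def Suc_leI)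
    also have "\<dots> \<le> l" using R(2) i by (auto simp: load_constraint_def)
    finally show "card {c \<in> clients I. A c = i} \<le> l" .
  qed (use R(1) in \<open>auto simp: routing_def\<close>)
qed

lemma length_le_plen:
  "\<lbrakk>distinct xs; \<And>x y. x \<in> set xs \<Longrightarrow> y \<in> set xs \<Longrightarrow> x \<noteq> y \<Longrightarrow> f x y \<ge> 1\<rbrakk> \<Longrightarrow> length xs \<le> plen f xs + 1"
proof (induction f xs rule: plen.induct)
  case (1 f x y zs)
  have "length (y # zs) \<le> plen f (y # zs) + 1" by (rule 1) (use 1 in auto)
  moreover have "f x y \<ge> 1" by (rule "1.prems"(2)) (use 1 in auto)
  ultimately show ?case by simp
qed auto

lemma plen_infix: "plen f xs \<le> plen f (u # xs @ [v])"
proof (cases xs)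
  case (Cons x zs)
  then show ?thesis using plen_snoc[of xs f v] by simp
qed simp

text \<open>Visiting clients at pairwise positive distances costs at least 1 per leg, and there is
  one leg fewer than clients, whence \<open>Suc g\<close>. The legs from and to the depot are
  discarded.\<close>

lemma gas_client_bound:
  assumes "vrp_instance I" "lower_dist I D" "gas_cvrp_solvable I g"
    and sep: "\<And>x y. x \<in> clients I \<Longrightarrow> y \<in> clients I \<Longrightarrow> x \<noteq> y \<Longrightarrow> D x y \<ge> 1"
  shows "card (clients I) \<le> vehicles I * Suc g"
proof -
  from assms obtain R A where R: "routing I R A" "gas_constraint I g R"
    unfolding gas_cvrp_solvable_def by blast
  have fin: "finite (clients I)" using assms(1) by (auto simp: vrp_instance_def intro: finite_subset)
  show ?thesis
  proof (rule card_by_vehicle[OF fin])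
    fix i assume i: "i < length R"
    let ?S = "{c \<in> clients I. A c = i}" and ?p = "R ! i"
    define xs where "xs = filter (\<lambda>c. c \<in> ?S) (remdups ?p)"
    have "subseq xs ?p"
      unfolding xs_def by (auto intro: subseq_order.order_trans[OF subseq_filter_left subseq_remdups])
    then have "plen D (hd ?p # xs @ [last ?p]) \<le> walk_weight I ?p"
      by (intro tour_of_walk[OF assms(2)]) (use R(1) nth_mem[OF i] in \<open>auto simp: routing_def closed_walk_def\<close>)
    also have "\<dots> \<le> g" using R(2) nth_mem[OF i] by (auto simp: gas_constraint_def)
    finally have "plen D xs \<le> g" using plen_infix[of D xs "hd ?p" "last ?p"] by linarith
    moreover have "length xs \<le> plen D xs + 1"
      by (rule length_le_plen) (auto simp: xs_def intro: sep[unfolded One_nat_def])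
    moreover have "set xs = ?S" using R(1) i by (auto simp: xs_def routing_def)
    moreover have "card (set xs) = length xs" by (rule distinct_card) (simp add: xs_def)
    ultimately show "card ?S \<le> Suc g" by simp
  qed (use R(1) in \<open>auto simp: routing_def\<close>)
qed

text \<open>A dropped client joins the vehicle of its representative, whose walk makes a free detour
  to it. Neither total weight nor gas increases, and no load constraint is present that moving
  clients could violate.\<close>

lemma gas_reduce:
  assumes I: "vrp_instance I" and D: "upper_dist I D" and C: "C \<subseteq> clients I"
    and near: "\<And>c. c \<in> clients I \<Longrightarrow> \<exists>c'\<in>C. D c' c = 0"
  shows "gas_cvrp_solvable (I\<lparr>clients := C\<rparr>) g \<longleftrightarrow> gas_cvrp_solvable I g"
proof
  let ?J = "I\<lparr>clients := C\<rparr>"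
  have w: "walk ?J = walk I" "walk_weight ?J = walk_weight I" by (auto simp: walk_def walk_weight_def fun_eq_iff)
  have cw: "closed_walk ?J = closed_walk I" by (auto simp: closed_walk_def w fun_eq_iff)
  show "gas_cvrp_solvable ?J g" if "gas_cvrp_solvable I g"
  proof -
    from that obtain R A where R: "routing I R A" "gas_constraint I g R" "routing_weight I R \<le> bound I"
      unfolding gas_cvrp_solvable_def by blast
    have "routing ?J R A" using R(1) C by (auto simp: routing_def cw)
    moreover have "gas_constraint ?J g R" "routing_weight ?J R \<le> bound ?J"
      using R(2,3) by (simp_all add: gas_constraint_def routing_weight_def w)
    ultimately show ?thesis unfolding gas_cvrp_solvable_def by blast
  qed
  assume "gas_cvrp_solvable ?J g"
  then obtain R A where R: "routing ?J R A" "gas_constraint I g R" "routing_weight I R \<le> bound I"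
    unfolding gas_cvrp_solvable_def by (auto simp: gas_constraint_def routing_weight_def w)
  from near obtain rep where rep: "\<And>c. c \<in> clients I \<Longrightarrow> rep c \<in> C \<and> D (rep c) c = 0" by metis
  have fin: "finite (clients I)" using I by (auto simp: vrp_instance_def intro: finite_subset)
  have "\<forall>i\<in>{..<length R}. \<exists>p'. walk I p' \<and> hd p' = hd (R ! i) \<and> last p' = last (R ! i) \<and>
      set (R ! i) \<union> {c \<in> clients I. A (rep c) = i} \<subseteq> set p' \<and> walk_weight I p' \<le> walk_weight I (R ! i)"
  proof (rule ballI, rule walk_detours)
    fix i assume "i \<in> {..<length R}"
    then have that: "i < length R" by simp
    show "walk I (R ! i)" using R(1) nth_mem[OF that] by (auto simp: routing_def closed_walk_def w)
    show "\<forall>x\<in>{c \<in> clients I. A (rep c) = i}. \<exists>y\<in>set (R ! i). reach I y x 0"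
    proof
      fix c assume c: "c \<in> {c \<in> clients I. A (rep c) = i}"
      then have "rep c \<in> C" "D (rep c) c = 0" using rep by auto
      moreover have "rep c \<in> verts I" "c \<in> verts I" using I C c \<open>rep c \<in> C\<close> by (auto simp: vrp_instance_def)
      ultimately have "reach I (rep c) c 0" using D unfolding upper_dist_def by (metis zero_le)
      moreover have "rep c \<in> set (R ! i)" using R(1) \<open>rep c \<in> C\<close> c by (auto simp: routing_def)
      ultimately show "\<exists>y\<in>set (R ! i). reach I y c 0" by blast
    qed
  qed (use fin in auto)
  from bchoice[OF this] obtain p where p: "\<And>i. i < length R \<Longrightarrow> walk I (p i) \<and> hd (p i) = hd (R ! i) \<and> last (p i) = last (R ! i) \<and>
      set (R ! i) \<union> {c \<in> clients I. A (rep c) = i} \<subseteq> set (p i) \<and> walk_weight I (p i) \<le> walk_weight I (R ! i)"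
    by (auto simp only: Ball_def lessThan_iff)
  let ?R = "map p [0..<length R]"
  have "routing I ?R (A \<circ> rep)"
    unfolding routing_def
  proof (intro conjI ballI)
    show "length ?R \<le> vehicles I" using R(1) by (simp add: routing_def)
    fix q assume "q \<in> set ?R"
    then obtain i where i: "i < length R" "q = p i" by auto
    have "closed_walk I (R ! i)" "hd (R ! i) \<in> depots I"
      using R(1) nth_mem[OF i(1)] by (simp_all add: routing_def cw)
    then show "closed_walk I q" "hd q \<in> depots I"
      using p[OF i(1)] i(2) by (simp_all add: closed_walk_def)
  next
    fix c assume c: "c \<in> clients I"
    then have "A (rep c) < length R" using rep[OF c] R(1) by (simp add: routing_def)
    then show "(A \<circ> rep) c < length ?R" "c \<in> set (?R ! (A \<circ> rep) c)"
      using p[of "A (rep c)"] c by auto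
  qed
  moreover have "gas_constraint I g ?R"
    unfolding gas_constraint_def
  proof
    fix q assume "q \<in> set ?R"
    then obtain i where "i < length R" "q = p i" by auto
    then show "walk_weight I q \<le> g"
      using R(2) p[of i] nth_mem[of i R] by (meson gas_constraint_def le_trans)
  qed
  moreover have "routing_weight I ?R \<le> routing_weight I R"
  proof -
    have "(\<Sum>i=0..<length R. walk_weight I (p i)) \<le> (\<Sum>i=0..<length R. walk_weight I (R ! i))"
      by (rule sum_mono) (use p in simp)
    then show ?thesis by (simp add: routing_weight_def sum_list_sum_nth)
  qed
  ultimately show "gas_cvrp_solvable I g"
    using R(3) unfolding gas_cvrp_solvable_def by (metis le_trans)
qed

lemma load_gas_of_gas:
  assumes "finite (clients J)" "card (clients J) \<le> n" "\<And>c. c \<in> clients J \<Longrightarrow> \<Lambda> c = 1"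
  shows "load_gas_cvrp_solvable J n \<Lambda> g \<longleftrightarrow> gas_cvrp_solvable J g"
proof -
  have "load_constraint J n \<Lambda> R A" for R A
    unfolding load_constraint_def
  proof (intro allI impI)
    fix i
    have "(\<Sum>c | c \<in> clients J \<and> A c = i. \<Lambda> c) = card {c \<in> clients J. A c = i}" using assms(3) by simp
    also have "\<dots> \<le> card (clients J)" using assms(1) by (intro card_mono) auto
    finally show "(\<Sum>c | c \<in> clients J \<and> A c = i. \<Lambda> c) \<le> n" using assms(2) by linarith
  qed
  then show ?thesis unfolding load_gas_cvrp_solvable_def gas_cvrp_solvable_def by blast
qed

text \<open>A single walk is no heavier than the whole routing, so the budget is a harmless gas
  capacity.\<close>

lemma load_gas_of_load:
  "load_gas_cvrp_solvable I l \<Lambda> (bound I) \<longleftrightarrow> load_cvrp_solvable I l \<Lambda>"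
proof -
  have "gas_constraint I (bound I) R" if "routing_weight I R \<le> bound I" for R
    using that member_le_sum_list[of _ "map (walk_weight I) R"] unfolding gas_constraint_def routing_weight_def
    by fastforce
  then show ?thesis unfolding load_gas_cvrp_solvable_def load_cvrp_solvable_def by blast
qed

text \<open>For \<open>q = 0\<close> all clients are kept; for \<open>q = 1\<close> the list is a maximal set of clients with pairwise
  positive distances.  So one program handles both the load and the gas problems.\<close>

definition representatives :: "(nat \<Rightarrow> nat \<Rightarrow> nat) \<Rightarrow> nat \<Rightarrow> nat set \<Rightarrow> nat list \<Rightarrow> bool" where
  "representatives D q C lst \<longleftrightarrow> distinct lst \<and> set lst \<subseteq> C \<and>
     (\<forall>c\<in>C. c \<in> set lst \<or> (\<exists>c'\<in>set lst. D c' c < q)) \<and> sorted_wrt (\<lambda>x y. \<not> D x y < q) lst"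

lemma representatives_snoc:
  "\<lbrakk>representatives D q C lst; c \<notin> C; \<And>c'. c' \<in> set lst \<Longrightarrow> \<not> D c' c < q\<rbrakk> \<Longrightarrow>
    representatives D q (insert c C) (lst @ [c])"
  unfolding representatives_def sorted_wrt_append by (intro conjI) auto

lemma representatives_skip:
  "\<lbrakk>representatives D q C lst; c' \<in> set lst; D c' c < q\<rbrakk> \<Longrightarrow> representatives D q (insert c C) lst"
  by (auto simp: representatives_def)

lemma representatives_0: "representatives D 0 C lst \<Longrightarrow> set lst = C"
  by (auto simp: representatives_def)

text \<open>The list is separated only from earlier to later entries, since the greedy choice
  compares a new client with those already kept. Symmetry of zero distances extends this to all
  pairs; a kept client represents itself by \<open>D_self\<close>.\<close>

lemma representatives_1:
  assumes "representatives D 1 C lst" "upper_dist I D" "lower_dist I D" "C \<subseteq> verts I"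
  shows "\<And>x y. x \<in> set lst \<Longrightarrow> y \<in> set lst \<Longrightarrow> x \<noteq> y \<Longrightarrow> D x y \<ge> 1"
    and "\<And>c. c \<in> C \<Longrightarrow> \<exists>c'\<in>set lst. D c' c = 0"
proof -
  fix x y assume xy: "x \<in> set lst" "y \<in> set lst" "x \<noteq> y"
  then obtain i j where ij: "i < length lst" "j < length lst" "x = lst ! i" "y = lst ! j" "i \<noteq> j"
    by (metis in_set_conv_nth)
  have "D x y \<noteq> 0 \<or> D y x \<noteq> 0"
    using assms(1) ij unfolding representatives_def
    by (cases "i < j") (auto simp: sorted_wrt_iff_nth_less)
  then show "D x y \<ge> 1"
    using D_zero_sym[OF assms(2,3), of x y] xy assms(1,4) unfolding representatives_def by fastforce
next
  fix c assume "c \<in> C"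
  then show "\<exists>c'\<in>set lst. D c' c = 0"
    using assms(1,4) D_self[OF assms(3), of c] unfolding representatives_def by fastforce
qed

section \<open>Basic blocks\<close>

text \<open>The machine only adds and subtracts. The rounds are counted by the factor in register
  \<open>j\<close>, so only that one must be small, while the one in \<open>x\<close> may be
  large.\<close>

definition mulp :: "nat \<Rightarrow> nat \<Rightarrow> nat \<Rightarrow> nat \<Rightarrow> prg" where
  "mulp z y j x = SetR z (Num 0) ;; For y j (SetR z (Add (Reg z) (Reg x)))"

lemma mulp_simps [simp]:
  "writes (mulp z y j x) = {z, y}" "no_write (mulp z y j x)" "limits (mulp z y j x) = {j}"
  "wf_prg (mulp z y j x) \<longleftrightarrow> y \<noteq> j \<and> y \<noteq> z \<and> j \<noteq> z"
  by (auto simp: mulp_def)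

lemma sem_mulp [simp]:
  assumes "z \<noteq> y" "j \<notin> {z, y}" "x \<notin> {z, y}"
  shows "sem (mulp z y j x) s = setr y (fst s j) (setr z (fst s j * fst s x) s)"
proof -
  have "iter y (sem (SetR z (Add (Reg z) (Reg x)))) k (setr z 0 s) = setr y k (setr z (k * fst s x) s)" for k
    using assms by (induction k) (auto simp: setr_def fun_upd_twist add.commute)
  then show ?thesis using assms by (simp add: mulp_def)
qed

definition ifeq :: "aexp \<Rightarrow> aexp \<Rightarrow> prg \<Rightarrow> prg \<Rightarrow> prg" where
  "ifeq d e p q = Cond d e q (Cond e d q p)"

lemma ifeq_simps [simp]:
  "writes (ifeq d e p q) = writes p \<union> writes q"
  "no_write (ifeq d e p q) \<longleftrightarrow> no_write p \<and> no_write q"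
  "limits (ifeq d e p q) = limits p \<union> limits q"
  "wf_prg (ifeq d e p q) \<longleftrightarrow> wf_prg p \<and> wf_prg q"
  "sem (ifeq d e p q) s = (if aval d s = aval e s then sem p s else sem q s)"
  "loops_le X (ifeq d e p q) s = (if aval d s = aval e s then loops_le X p s else loops_le X q s)"
  by (auto simp: ifeq_def)

text \<open>The growing power is the repeated summand and the base is the number of rounds, so no
  loop is limited by a register that changes.\<close>

definition powp :: "nat \<Rightarrow> nat \<Rightarrow> nat \<Rightarrow> prg" where
  "powp z x j = SetR z (Num 1) ;; For 25 j (mulp 20 21 x z ;; SetR z (Reg 20))"

lemma powp_simps [simp]:
  "writes (powp z x j) = {z, 20, 21, 25}" "no_write (powp z x j)" "limits (powp z x j) = {x, j}"
  "wf_prg (powp z x j) \<longleftrightarrow> j \<notin> {z, 20, 21, 25} \<and> z \<notin> {25} \<and> x \<notin> {20, 21}"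
  by (auto simp: powp_def)

lemma sem_powp [simp]:
  assumes "x \<notin> {z, 20, 21, 25}" "j \<notin> {z, 20, 21, 25}" "z \<notin> {20, 21, 25}"
  shows "fst (sem (powp z x j) s) z = fst s x ^ fst s j"
proof -
  let ?s = "setr z 1 s"
  have "fst (sem (For 25 j (mulp 20 21 x z ;; SetR z (Reg 20))) ?s) z = fst ?s x ^ fst ?s j"
    by (rule For_rule[where P = "\<lambda>k s'. fst s' z = fst ?s x ^ k"]) (use assms in auto)
  then show ?thesis using assms by (simp add: powp_def)
qed


section \<open>The program\<close>

text \<open>
  Registers: 0 input length, 1 parameter, 2 number \<open>n\<close> of vertices, 3 vehicles \<open>k\<close>, 4 budget, 5 load
  capacity, 6 gas capacity, 7 threshold \<open>q\<close> for representatives; 8, 9, 10 addresses of the depots,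
  clients and demands; 11 number \<open>m\<close> of representatives, 12 \<open>k * m\<close>, 13 \<open>(k * m) ^ m\<close>,
  14 bound on \<open>m\<close>, 15 \<open>n * n\<close>, 16 validity of the input, 19 result of the search; all others are
  temporary.  The adjacency matrix starts at address 2 and is overwritten by the distances, where
  budget + 1 stands for infinity.  The \<open>n\<close> cells after the input receive the representatives, the
  next ones the candidate solution, which is decoded from a number below \<open>(k * m) ^ m\<close>.
\<close>

abbreviation cell :: "nat \<Rightarrow> nat \<Rightarrow> aexp" where
  "cell ru v \<equiv> Add (Num 2) (Add (Reg ru) (Reg v))"

abbreviation "elem a i \<equiv> Mem (Add (Reg a) (Reg i))"

definition row_check :: prg where
  "row_check = For 25 2 (mulp 23 24 2 25 ;; ifeq (Mem (cell 20 25)) (Mem (cell 23 22)) Nop (SetR 16 (Num 0)))"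

definition require_le :: "aexp \<Rightarrow> aexp \<Rightarrow> prg" where
  "require_le d e = Cond e d (SetR 16 (Num 0)) Nop"

definition require_same_zero :: "aexp \<Rightarrow> aexp \<Rightarrow> prg" where
  "require_same_zero d e = ifeq d (Num 0) (require_le e (Num 0)) (Cond (Num 0) e Nop (SetR 16 (Num 0)))"

lemma require_simps [simp]:
  "writes (require_le d e) = {16}" "no_write (require_le d e)"
  "limits (require_le d e) = {}" "wf_prg (require_le d e)"
  "sem (require_le d e) s = setr 16 (if aval d s \<le> aval e s then fst s 16 else 0) s"
  "writes (require_same_zero d e) = {16}" "no_write (require_same_zero d e)"
  "limits (require_same_zero d e) = {}" "wf_prg (require_same_zero d e)"
  "sem (require_same_zero d e) s = setr 16 (if aval d s = 0 \<longleftrightarrow> aval e s = 0 then fst s 16 else 0) s"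
  by (simp_all add: require_le_def require_same_zero_def setr_def)

definition vertex_check :: prg where
  "vertex_check =
     mulp 20 21 2 22 ;; row_check ;;
     require_le (Mem (cell 20 22)) (Num 0) ;; require_le (elem 8 22) (Num 1) ;;
     require_le (elem 9 22) (Num 1) ;; require_same_zero (elem 9 22) (elem 10 22) ;;
     Cond (Num 0) (elem 8 22) (SetR 18 (Num 1)) Nop"

definition input_check :: prg where
  "input_check = SetR 16 (Num 1) ;; SetR 18 (Num 0) ;; For 22 2 vertex_check ;;
     ifeq (Reg 18) (Num 0) (SetR 16 (Num 0)) Nop"

definition init_cell :: prg where
  "init_cell = ifeq (Reg 22) (Reg 25) (Write (cell 20 25) (Num 0))
     (ifeq (Mem (cell 20 25)) (Num 0) (Write (cell 20 25) (Add (Reg 4) (Num 1)))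
       (Write (cell 20 25) (Sub (Mem (cell 20 25)) (Num 1))))"

definition init_dist :: prg where
  "init_dist = For 22 2 (mulp 20 21 2 22 ;; For 25 2 init_cell)"

definition floyd_cell :: prg where
  "floyd_cell = SetR 28 (Add (Mem (cell 20 26)) (Mem (cell 27 25))) ;;
     Cond (Reg 28) (Mem (cell 20 25)) (Write (cell 20 25) (Reg 28)) Nop"

definition floyd_row :: prg where
  "floyd_row = mulp 20 21 2 22 ;; For 25 2 floyd_cell"

definition floyd :: prg where
  "floyd = For 26 2 (mulp 27 21 2 26 ;; For 22 2 floyd_row)"

text \<open>Register 11 grows while the representatives are chosen, so the loop runs to the fixed
  \<open>n\<close> instead and skips the indices from \<open>m\<close> on.\<close>

definition near :: prg where
  "near = SetR 25 (Num 0) ;; For 26 2 (Cond (Reg 26) (Reg 11)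
     (SetR 27 (elem 0 26) ;; mulp 20 21 2 27 ;; Cond (Mem (cell 20 22)) (Reg 7) (SetR 25 (Num 1)) Nop) Nop)"

definition choose_reps :: prg where
  "choose_reps = SetR 11 (Num 0) ;; For 22 2 (Cond (Num 0) (elem 9 22)
     (near ;; Cond (Reg 25) (Num 1)
       (Write (Add (Reg 0) (Reg 11)) (Reg 22) ;; SetR 11 (Add (Reg 11) (Num 1))) Nop) Nop)"

text \<open>Repeated subtraction. Register 13 bounds the number to be divided and hence the
  quotient; the surplus rounds do nothing.\<close>

definition divide :: prg where
  "divide = SetR 31 (Num 0) ;; For 26 13 (Cond (Reg 30) (Reg 12) Nop
     (SetR 30 (Sub (Reg 30) (Reg 12)) ;; SetR 31 (Add (Reg 31) (Num 1))))"

definition decode :: prg where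
  "decode = SetR 30 (Reg 29) ;; For 25 11 (divide ;;
     Write (Add (Reg 0) (Add (Reg 2) (Reg 25))) (Reg 30) ;; SetR 30 (Reg 31))"

text \<open>Registers 37, 38 and 39 carry the current position, the distance driven and the load of
  the tour in progress.\<close>

definition visit :: prg where
  "visit = SetR 42 (elem 0 41) ;; mulp 20 21 2 37 ;; SetR 38 (Add (Reg 38) (Mem (cell 20 42))) ;;
     SetR 39 (Add (Reg 39) (elem 10 42)) ;; SetR 37 (Reg 42)"

definition slot :: prg where
  "slot = For 41 11 (ifeq (Mem (Add (Reg 0) (Add (Reg 2) (Reg 41)))) (Add (Reg 33) (Reg 40)) visit Nop)"

definition tour :: prg where
  "tour = SetR 37 (Reg 36) ;; SetR 38 (Num 0) ;; SetR 39 (Num 0) ;; For 40 11 slot ;;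
     mulp 20 21 2 37 ;; SetR 38 (Add (Reg 38) (Mem (cell 20 36)))"

definition vehicle :: prg where
  "vehicle = SetR 35 (Add (Reg 4) (Num 1)) ;; For 36 2 (Cond (Num 0) (elem 8 36)
     (tour ;; Cond (Reg 5) (Reg 39) Nop (Cond (Reg 6) (Reg 38) Nop
       (Cond (Reg 38) (Reg 35) (SetR 35 (Reg 38)) Nop))) Nop)"

text \<open>Register 33 is the first slot \<open>i * m\<close> of the current vehicle, maintained by
  addition.\<close>

definition evaluate :: prg where
  "evaluate = SetR 32 (Num 0) ;; SetR 33 (Num 0) ;; For 34 3 (vehicle ;;
     SetR 32 (Add (Reg 32) (Reg 35)) ;; SetR 33 (Add (Reg 33) (Reg 11)))"

definition search :: prg where
  "search = SetR 19 (Num 0) ;; For 29 13 (decode ;; evaluate ;;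
     Cond (Reg 32) (Add (Reg 4) (Num 1)) (SetR 19 (Num 1)) Nop)"

lemmas search_defs = divide_def decode_def visit_def slot_def tour_def vehicle_def evaluate_def search_def

lemma All_less_Suc_nat: "(\<forall>i<Suc n. P i) \<longleftrightarrow> (\<forall>i<n. P i) \<and> P n"
  by (auto simp: less_Suc_eq)

lemma Ex_less_Suc_nat: "(\<exists>i<Suc n. P i) \<longleftrightarrow> (\<exists>i<n. P i) \<or> P n"
  by (auto simp: less_Suc_eq)


section \<open>Checking the input\<close>

abbreviation mat :: "(nat \<Rightarrow> nat) \<Rightarrow> nat \<Rightarrow> nat \<Rightarrow> nat \<Rightarrow> nat" where
  "mat M n u v \<equiv> M (2 + (n * u + v))"

lemma row_check_writes [simp]: "writes row_check = {16, 23, 24, 25}" "no_write row_check"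
  by (auto simp: row_check_def)

lemma sem_row_check:
  assumes "fst s 20 = fst s 2 * fst s 22"
  shows "fst (sem row_check s) 16 =
    (if \<forall>v<fst s 2. mat (snd s) (fst s 2) (fst s 22) v = mat (snd s) (fst s 2) v (fst s 22) then fst s 16 else 0)"
  unfolding row_check_def
  by (rule For_rule[where P = "\<lambda>k s'. fst s' 16 = (if \<forall>v<k. mat (snd s) (fst s 2) (fst s 22) v =
      mat (snd s) (fst s 2) v (fst s 22) then fst s 16 else 0)"])
    (use assms in \<open>simp_all add: All_less_Suc_nat, blast\<close>)

definition vertex_ok :: "(nat \<Rightarrow> nat) \<Rightarrow> nat \<Rightarrow> nat \<Rightarrow> nat \<Rightarrow> nat \<Rightarrow> nat \<Rightarrow> bool" where
  "vertex_ok M n aD aC aL u \<longleftrightarrow> (\<forall>v<n. mat M n u v = mat M n v u) \<and> mat M n u u = 0 \<and>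
     M (aD + u) \<le> 1 \<and> M (aC + u) \<le> 1 \<and> (M (aC + u) = 0 \<longleftrightarrow> M (aL + u) = 0)"

lemma vertex_check_writes [simp]:
  "writes vertex_check = {16, 18, 20, 21, 23, 24, 25}" "no_write vertex_check"
  by (auto simp: vertex_check_def)

lemma sem_vertex_check:
  "fst (sem vertex_check s) 16 =
    (if vertex_ok (snd s) (fst s 2) (fst s 8) (fst s 9) (fst s 10) (fst s 22) then fst s 16 else 0)"
  "fst (sem vertex_check s) 18 = (if 0 < snd s (fst s 8 + fst s 22) then 1 else fst s 18)"
  by (auto simp: vertex_check_def sem_row_check vertex_ok_def)

lemma input_check_writes [simp]:
  "writes input_check = {16, 18, 20, 21, 22, 23, 24, 25}" "no_write input_check"
  "limits input_check = {2}" "wf_prg input_check"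
  by (auto simp: input_check_def vertex_check_def row_check_def)

lemma sem_input_check:
  "fst (sem input_check s) 16 = 1 \<longleftrightarrow>
    (\<forall>u<fst s 2. vertex_ok (snd s) (fst s 2) (fst s 8) (fst s 9) (fst s 10) u) \<and>
    (\<exists>u<fst s 2. 0 < snd s (fst s 8 + u))"
proof -
  let ?s = "setr 18 0 (setr 16 1 s)"
  let ?ok = "\<lambda>u. vertex_ok (snd s) (fst s 2) (fst s 8) (fst s 9) (fst s 10) u"
  have "(\<lambda>k s'. fst s' 16 = (if \<forall>u<k. ?ok u then 1 else 0) \<and>
      fst s' 18 = (if \<exists>u<k. 0 < snd s (fst s 8 + u) then 1 else 0)) (fst ?s 2) (sem (For 22 2 vertex_check) ?s)"
    by (rule For_rule) (simp_all add: All_less_Suc_nat Ex_less_Suc_nat sem_vertex_check)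
  then show ?thesis by (auto simp: input_check_def)
qed


section \<open>Computing the distances\<close>

text \<open>Every memory reached while distances are computed has this form for the original
  \<open>M\<close>, so writing a cell becomes a function update of \<open>D\<close>.\<close>

definition with_mat :: "(nat \<Rightarrow> nat) \<Rightarrow> nat \<Rightarrow> (nat \<Rightarrow> nat \<Rightarrow> nat) \<Rightarrow> nat \<Rightarrow> nat" where
  "with_mat M n D a = (if 2 \<le> a \<and> a < 2 + n * n then D ((a - 2) div n) ((a - 2) mod n) else M a)"

lemma cell_less: "u < n \<Longrightarrow> v < n \<Longrightarrow> n * u + v < n * (n::nat)"
proof -
  assume "u < n" "v < n"
  then have "n * u + v < n * Suc u" by simp
  also have "\<dots> \<le> n * n" using \<open>u < n\<close> by (intro mult_left_mono) auto
  finally show ?thesis .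
qed

lemma with_mat_cell [simp]: "u < n \<Longrightarrow> v < n \<Longrightarrow> with_mat M n D (Suc (Suc (n * u + v))) = D u v"
  using cell_less by (simp add: with_mat_def)

lemma with_mat_other [simp]: "2 + n * n \<le> a \<Longrightarrow> with_mat M n D a = M a"
  by (simp add: with_mat_def)

lemma with_mat_cong: "(\<And>u v. u < n \<Longrightarrow> v < n \<Longrightarrow> D u v = E u v) \<Longrightarrow> with_mat M n D = with_mat M n E"
  by (cases "n = 0") (auto simp: with_mat_def fun_eq_iff less_mult_imp_div_less)

lemma with_mat_self: "with_mat M n (\<lambda>u v. M (Suc (Suc (n * u + v)))) = M"
proof
  fix a
  have "Suc (Suc (a - 2)) = a" if "2 \<le> a" using that by simp
  then show "with_mat M n (\<lambda>u v. M (Suc (Suc (n * u + v)))) a = M a" by (simp add: with_mat_def)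
qed

lemma with_mat_upd [simp]:
  assumes "u < n" "v < n"
  shows "(with_mat M n D)(Suc (Suc (n * u + v)) := x) = with_mat M n (D(u := (D u)(v := x)))"
proof
  fix a
  have "a = 2 + (n * u + v)" if "2 \<le> a" "(a - 2) div n = u" "(a - 2) mod n = v"
    using that mult_div_mod_eq[of n "a - 2"] by simp
  then show "((with_mat M n D)(Suc (Suc (n * u + v)) := x)) a = with_mat M n (D(u := (D u)(v := x))) a"
    using assms cell_less[OF assms] unfolding with_mat_def fun_upd_apply
    by (cases "a = Suc (Suc (n * u + v))") (simp_all, blast)
qed

definition start_dist :: "(nat \<Rightarrow> nat) \<Rightarrow> nat \<Rightarrow> nat \<Rightarrow> nat \<Rightarrow> nat \<Rightarrow> nat" where
  "start_dist M n r u v = (if u = v then 0 else if mat M n u v = 0 then Suc r else mat M n u v - 1)"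

lemma init_dist_simps [simp]:
  "writes init_cell = {}" "writes init_dist = {20, 21, 22, 25}" "limits init_dist = {2}" "wf_prg init_dist"
  by (auto simp: init_dist_def init_cell_def)

lemma sem_init_dist:
  "snd (sem init_dist s) = with_mat (snd s) (fst s 2) (start_dist (snd s) (fst s 2) (fst s 4))"
proof -
  let ?M = "snd s" and ?n = "fst s 2"
  let ?E = "start_dist ?M ?n (fst s 4)"
  \<comment> \<open>The memory once the rows below \<open>U\<close> and the first \<open>k\<close>
    cells of row \<open>U\<close> are converted; the other cells still hold the input.\<close>
  define I where "I U k = with_mat ?M ?n (\<lambda>u v. if u < U \<or> (u = U \<and> v < k) then ?E u v else mat ?M ?n u v)"
    for U k
  have step: "I (Suc U) 0 = I U ?n" for U
    unfolding I_def by (rule with_mat_cong) (auto simp: less_Suc_eq)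
  have "snd (sem init_dist s) = I ?n 0"
    unfolding init_dist_def
  proof (rule For_rule[where P = "\<lambda>U s'. snd s' = I U 0"])
    show "snd (setr 22 0 s) = I 0 0" by (simp add: I_def with_mat_self del: One_nat_def)
  next
    fix U and s' :: state
    assume U: "U < fst s 2" "snd s' = I U 0" "fst s' 22 = U"
      and fr: "\<And>x. x \<notin> insert 22 (writes (mulp 20 21 2 22 ;; For 25 2 init_cell)) \<Longrightarrow> fst s' x = fst s x"
    let ?s = "setr 21 ?n (setr 20 (?n * U) s')"
    have "snd (sem (For 25 2 init_cell) ?s) = I U (fst ?s 2)"
    proof (rule For_rule[where P = "\<lambda>k s''. snd s'' = I U k"], goal_cases)
      case (2 k s'')
      have k: "k < ?n" using 2(1) fr by simp
      have "fst s'' 22 = U" "fst s'' 20 = ?n * U" "fst s'' 4 = fst s 4" using 2(4) fr U by simp_all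
      moreover have "(I U k) (Suc (Suc (?n * U + k))) = mat ?M ?n U k"
        unfolding I_def using U k by simp
      moreover have "(I U k)(Suc (Suc (?n * U + k)) := ?E U k) = I U (Suc k)"
        unfolding I_def
        by (subst with_mat_upd) (use U k in \<open>auto intro!: with_mat_cong simp: less_Suc_eq\<close>)
      ultimately show ?case using 2(2,3) by (auto simp: start_dist_def init_cell_def split: if_splits)
    qed (use U in auto)
    then show "snd (setr 22 (Suc U) (sem (mulp 20 21 2 22 ;; For 25 2 init_cell) s')) = I (Suc U) 0"
      using U fr by (simp add: step)
  qed
  also have "\<dots> = with_mat ?M ?n ?E" unfolding I_def by (rule with_mat_cong) auto
  finally show ?thesis .
qed

lemma floyd_simps [simp]:
  "writes floyd_cell = {28}" "writes floyd_row = {20, 21, 25, 28}"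
  "writes floyd = {20, 21, 22, 25, 26, 27, 28}" "limits floyd = {2}" "wf_prg floyd"
  by (auto simp: floyd_def floyd_row_def floyd_cell_def)

text \<open>Updates are done in place, so a relaxation may read cells that are already at stage
  \<open>w + 1\<close>. This is harmless: lowering a value keeps its bound of stage
  \<open>w\<close>, which is all that \<open>dom_Suc\<close> asks of the three values read.\<close>

definition floyd_inv :: "nat vrp \<Rightarrow> nat \<Rightarrow> nat \<Rightarrow> nat \<Rightarrow> nat \<Rightarrow> (nat \<Rightarrow> nat \<Rightarrow> nat) \<Rightarrow> bool" where
  "floyd_inv I n w u v D \<longleftrightarrow> upper_dist I D \<and> (\<forall>u'<n. \<forall>v'<n.
     dom I w u' v' (D u' v') \<and> (u' < u \<or> u' = u \<and> v' < v \<longrightarrow> dom I (Suc w) u' v' (D u' v')))"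

lemma floyd_inv_step:
  assumes "floyd_inv I n w u v D" "verts I = {..<n}" "w < n" "u < n" "v < n"
  shows "floyd_inv I n w u (Suc v)
    (if D u w + D w v < D u v then D(u := (D u)(v := D u w + D w v)) else D)"
proof -
  have d: "dom I w a b (D a b)" if "a < n" "b < n" for a b
    using assms(1) that by (simp add: floyd_inv_def)
  have "dom I (Suc w) u v x" if "x \<le> D u v" "x \<le> D u w + D w v" for x
    using dom_Suc[OF d d d that] assms by simp
  moreover have "dom I w u v x" if "x \<le> D u v" for x
    using dom_mono[OF d that] assms by simp
  moreover have "upper_dist I (D(u := (D u)(v := D u w + D w v)))"
    using upper_dist_relax[of I D u w v] assms by (simp add: floyd_inv_def)
  ultimately show ?thesis using assms(1)
    by (auto simp: floyd_inv_def less_Suc_eq)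
qed

lemma sem_floyd_row:
  assumes "snd s = with_mat M n D" "floyd_inv I n w u 0 D" "verts I = {..<n}" "w < n" "u < n"
    "fst s 2 = n" "fst s 22 = u" "fst s 26 = w" "fst s 27 = n * w"
  shows "\<exists>D'. snd (sem floyd_row s) = with_mat M n D' \<and> floyd_inv I n w (Suc u) 0 D'"
proof -
  let ?s = "setr 21 n (setr 20 (n * u) s)"
  have "(\<lambda>k s'. \<exists>D'. snd s' = with_mat M n D' \<and> floyd_inv I n w u k D') (fst ?s 2) (sem (For 25 2 floyd_cell) ?s)"
  proof (rule For_rule, goal_cases)
    case 1
    then show ?case using assms by auto
  next
    case (2 k s')
    then obtain D' where D': "snd s' = with_mat M n D'" "floyd_inv I n w u k D'" by blast
    have k: "k < n" using 2(1) assms by simp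
    have r: "fst s' 20 = n * u" "fst s' 26 = w" "fst s' 27 = n * w" using 2(4) assms by simp_all
    show ?case
      using floyd_inv_step[OF D'(2) assms(3-5) k] D'(1) r 2(3) k assms(4,5)
      by (intro exI[of _ "if D' u w + D' w k < D' u k then D'(u := (D' u)(k := D' u w + D' w k)) else D'"])
        (auto simp: floyd_cell_def)
  qed
  then obtain D' where D': "snd (sem (For 25 2 floyd_cell) ?s) = with_mat M n D'" "floyd_inv I n w u n D'"
    using assms by auto
  moreover have "floyd_inv I n w (Suc u) 0 D'" using D'(2) by (auto simp: floyd_inv_def less_Suc_eq)
  ultimately show ?thesis using assms by (auto simp: floyd_row_def)
qed

lemma sem_floyd:
  assumes "snd s = with_mat M n D" "floyd_inv I n 0 0 0 D" "verts I = {..<n}" "fst s 2 = n"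
  shows "\<exists>D'. snd (sem floyd s) = with_mat M n D' \<and> upper_dist I D' \<and> lower_dist I D'"
proof -
  have "(\<lambda>w s'. \<exists>D'. snd s' = with_mat M n D' \<and> floyd_inv I n w 0 0 D') (fst s 2) (sem floyd s)"
    unfolding floyd_def
  proof (rule For_rule, goal_cases)
    case 1
    then show ?case using assms by auto
  next
    case (2 w s')
    let ?s = "setr 21 n (setr 27 (n * w) s')"
    have w: "w < n" "fst s' 2 = n" using 2 assms by simp_all
    have "(\<lambda>u s'. \<exists>D'. snd s' = with_mat M n D' \<and> floyd_inv I n w u 0 D') (fst ?s 2) (sem (For 22 2 floyd_row) ?s)"
    proof (rule For_rule, goal_cases)
      case 1
      then show ?case using 2 by auto
    next
      case (2 u s'')
      then obtain D' where D': "snd s'' = with_mat M n D'" "floyd_inv I n w u 0 D'" by blast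
      have u: "u < n" using 2(1) w by simp
      have r: "fst s'' 2 = n" "fst s'' 22 = u" "fst s'' 26 = w" "fst s'' 27 = n * w"
        using 2(3,4) \<open>fst s' 26 = w\<close> w by simp_all
      show ?case using sem_floyd_row[OF D' assms(3) w(1) u r] by simp
    qed
    then obtain D' where D': "snd (sem (For 22 2 floyd_row) ?s) = with_mat M n D'" "floyd_inv I n w n 0 D'"
      using w by auto
    moreover have "floyd_inv I n (Suc w) 0 0 D'" using D'(2) by (auto simp: floyd_inv_def)
    ultimately show ?case using 2(3) w by auto
  qed
  then obtain D' where D': "snd (sem floyd s) = with_mat M n D'" "floyd_inv I n n 0 0 D'"
    using assms by auto
  moreover have "lower_dist I D'"
    by (rule dom_lower_dist[OF assms(3)]) (use D'(2) in \<open>auto simp: floyd_inv_def\<close>)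
  ultimately show ?thesis by (auto simp: floyd_inv_def)
qed

section \<open>Choosing representatives\<close>

lemma choose_reps_simps [simp]:
  "writes near = {20, 21, 25, 26, 27}" "no_write near" 
  "writes choose_reps = {11, 20, 21, 22, 25, 26, 27}" "limits choose_reps = {2}" "wf_prg choose_reps"
  by (auto simp: choose_reps_def near_def)

lemma Bex_nth: "(\<exists>x\<in>set xs. P x) \<longleftrightarrow> (\<exists>j<length xs. P (xs ! j))"
  by (metis in_set_conv_nth)

lemma sem_near:
  assumes "fst s 11 = length lst" "length lst \<le> fst s 2" "\<And>j. j < length lst \<Longrightarrow> snd s (fst s 0 + j) = lst ! j"
  shows "fst (sem near s) 25 =
    (if \<exists>c'\<in>set lst. mat (snd s) (fst s 2) c' (fst s 22) < fst s 7 then 1 else 0)"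
proof -
  let ?s = "setr 25 0 s"
  let ?near = "\<lambda>j. j < length lst \<and> mat (snd s) (fst s 2) (lst ! j) (fst s 22) < fst s 7"
  define P where "P k s' \<longleftrightarrow> fst s' 25 = (if \<exists>j<k. ?near j then 1 else 0)" for k and s' :: state
  have "P (fst ?s 2) (sem near s)"
    unfolding near_def sem.simps(4) sem.simps(2) aval.simps
    by (rule For_rule; unfold P_def)
      (use assms in \<open>simp_all add: Ex_less_Suc_nat, blast\<close>)
  then have "fst (sem near s) 25 = (if \<exists>j<fst s 2. ?near j then 1 else 0)"
    by (simp add: P_def)
  also have "(\<exists>j<fst s 2. ?near j) \<longleftrightarrow> (\<exists>c'\<in>set lst. mat (snd s) (fst s 2) c' (fst s 22) < fst s 7)"
    using assms(2) by (subst Bex_nth) (meson less_le_trans)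
  finally show ?thesis .
qed

lemma sem_choose_reps:
  assumes n: "fst s 2 = n" and C: "C \<subseteq> {..<n}" "\<And>c. c < n \<Longrightarrow> 0 < snd s (fst s 9 + c) \<longleftrightarrow> c \<in> C"
    and D: "\<And>u v. u < n \<Longrightarrow> v < n \<Longrightarrow> mat (snd s) n u v = D u v"
    and len: "2 + n * n \<le> fst s 0" "fst s 9 + n \<le> fst s 0"
  shows "\<exists>lst. representatives D (fst s 7) C lst \<and> fst (sem choose_reps s) 11 = length lst \<and>
    length lst \<le> n \<and> (\<forall>a<fst s 0. snd (sem choose_reps s) a = snd s a) \<and>
    (\<forall>j<length lst. snd (sem choose_reps s) (fst s 0 + j) = lst ! j)"
proof -
  define P where "P k s' \<longleftrightarrow> (\<exists>lst. representatives D (fst s 7) {c \<in> C. c < k} lst \<and> fst s' 11 = length lst \<and>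
    length lst \<le> k \<and> (\<forall>a<fst s 0. snd s' a = snd s a) \<and>
    (\<forall>j<length lst. snd s' (fst s 0 + j) = lst ! j))" for k and s' :: state
  let ?s = "setr 11 0 s"
  have "P (fst ?s 2) (sem choose_reps s)"
    unfolding choose_reps_def sem.simps(4) sem.simps(2) aval.simps
  proof (rule For_rule, goal_cases)
    case 1
    show ?case unfolding P_def by (intro exI[of _ "[]"]) (auto simp: representatives_def)
  next
    case (2 k s')
    then obtain lst where lst: "representatives D (fst s 7) {c \<in> C. c < k} lst" "fst s' 11 = length lst"
      "length lst \<le> k" "\<And>a. a < fst s 0 \<Longrightarrow> snd s' a = snd s a" "\<And>j. j < length lst \<Longrightarrow> snd s' (fst s 0 + j) = lst ! j"
      unfolding P_def by blast
    have r: "fst s' 0 = fst s 0" "fst s' 2 = n" "fst s' 7 = fst s 7" "fst s' 9 = fst s 9" "fst s' 22 = k"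
      using 2(3,4) n by simp_all
    have k: "k < n" using 2(1) n by simp
    have kC: "0 < snd s' (fst s 9 + k) \<longleftrightarrow> k \<in> C" using C(2)[OF k] lst(4) len k by simp
    show ?case
    proof (cases "k \<in> C")
      case False
      then have "{c \<in> C. c < Suc k} = {c \<in> C. c < k}" by (auto simp: less_Suc_eq)
      then show ?thesis using False kC r lst unfolding P_def by (intro exI[of _ lst]) simp
    next
      case True
      then have S: "{c \<in> C. c < Suc k} = insert k {c \<in> C. c < k}" by (auto simp: less_Suc_eq)
      have lstn: "c' < n" if "c' \<in> set lst" for c' using that lst(1) C(1) by (auto simp: representatives_def)
      have "mat (snd s') n c' k = D c' k" if "c' \<in> set lst" for c'
        using cell_less[OF lstn[OF that] k] lst(4) len D[OF lstn[OF that] k] by simp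
      then have nr: "fst (sem near s') 25 = (if \<exists>c'\<in>set lst. D c' k < fst s 7 then 1 else 0)"
        using sem_near[of s' lst] lst r k by simp
      show ?thesis
      proof (cases "\<exists>c'\<in>set lst. D c' k < fst s 7")
        case near: True
        then have "representatives D (fst s 7) {c \<in> C. c < Suc k} lst"
          using representatives_skip[OF lst(1)] S by auto
        then show ?thesis using near nr kC True r lst unfolding P_def by (intro exI[of _ lst]) simp
      next
        case far: False
        then have "representatives D (fst s 7) {c \<in> C. c < Suc k} (lst @ [k])"
          using representatives_snoc[OF lst(1), of k] S by auto
        then show ?thesis using far nr kC True r lst unfolding P_def
          by (intro exI[of _ "lst @ [k]"]) (auto simp: nth_append less_Suc_eq)
      qed
    qed
  qed
  moreover have "{c \<in> C. c < n} = C" using C(1) by auto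
  ultimately show ?thesis using n by (simp add: P_def)
qed


section \<open>The search\<close>

lemma writes_search [simp]:
  "writes divide = {26, 30, 31}" "no_write divide" "limits divide = {13}"
  "writes decode = {25, 26, 30, 31}" "limits decode = {11, 13}"
  "writes visit = {20, 21, 37, 38, 39, 42}" "no_write visit" "limits visit = {2}"
  "writes slot = {20, 21, 37, 38, 39, 41, 42}" "no_write slot" "limits slot = {2, 11}"
  "writes tour = {20, 21, 37, 38, 39, 40, 41, 42}" "no_write tour" "limits tour = {2, 11}"
  "writes vehicle = {20, 21, 35, 36, 37, 38, 39, 40, 41, 42}" "no_write vehicle" "limits vehicle = {2, 11}"
  "writes evaluate = {20, 21, 32, 33, 34, 35, 36, 37, 38, 39, 40, 41, 42}" "no_write evaluate"
  "limits evaluate = {2, 3, 11}"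
  by (auto simp: search_defs)

lemma search_simps [simp]:
  "writes search = {19, 20, 21, 25, 26, 29, 30, 31, 32, 33, 34, 35, 36, 37, 38, 39, 40, 41, 42}"
  "limits search = {2, 3, 11, 13}" "wf_prg search"
  by (auto simp: search_def) (auto simp: search_defs)

section \<open>Candidates as numbers in base k*m\<close>

lemma sem_divide:
  assumes "fst s 30 \<le> fst s 13" "0 < fst s 12"
  shows "fst (sem divide s) 30 = fst s 30 mod fst s 12" "fst (sem divide s) 31 = fst s 30 div fst s 12"
proof -
  let ?s = "setr 31 0 s" and ?x = "fst s 30" and ?b = "fst s 12"
  \<comment> \<open>Once the quotient is reached the guard fails and the remaining rounds idle,
    hence \<open>min\<close>.\<close>
  define P where "P k s' \<longleftrightarrow> fst s' 31 = min k (?x div ?b) \<and> fst s' 30 = ?x - ?b * min k (?x div ?b)" for k and s' :: state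
  have *: "P (fst ?s 13) (sem divide s)"
    unfolding divide_def sem.simps(4) sem.simps(2) aval.simps
  proof (rule For_rule, unfold P_def, goal_cases)
    case (2 k s')
    let ?q = "?x div ?b"
    have b: "fst s' 12 = ?b" using 2(4) by simp
    have x: "?x = ?b * ?q + ?x mod ?b" "?x mod ?b < ?b" using assms(2) by simp_all
    show ?case
    proof (cases "k < ?q")
      case True
      then have "?b * k + ?b \<le> ?b * ?q" using mult_le_mono2[of "Suc k" ?q ?b] by simp
      then have "\<not> ?x - ?b * k < ?b" using x(1) by linarith
      then show ?thesis using 2(2) b True by (simp add: min_def)
    next
      case False
      then have "min k ?q = ?q" "min (Suc k) ?q = ?q" by auto
      then show ?thesis using 2(2) b x by (simp add: minus_mult_div_eq_mod)
    qed
  qed simp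
  have "?x div ?b \<le> fst s 13" using assms(1) div_le_dividend[of ?x ?b] by linarith
  then have "min (fst s 13) (?x div ?b) = ?x div ?b" by simp
  then show "fst (sem divide s) 30 = ?x mod ?b" "fst (sem divide s) 31 = ?x div ?b"
    using * by (simp_all add: P_def minus_mult_div_eq_mod)
qed

text \<open>Without clients the base is 0, but then there are no digits to extract; hence the
  conditional hypothesis.\<close>

lemma sem_decode:
  assumes "fst s 29 \<le> fst s 13" "fst s 11 > 0 \<Longrightarrow> 0 < fst s 12"
  shows "(\<forall>j<fst s 11. snd (sem decode s) (fst s 0 + (fst s 2 + j)) = fst s 29 div fst s 12 ^ j mod fst s 12) \<and>
    (\<forall>a<fst s 0 + fst s 2. snd (sem decode s) a = snd s a)"
proof -
  let ?s = "setr 30 (fst s 29) s" and ?N = "fst s 29" and ?b = "fst s 12" and ?A = "fst s 0 + fst s 2"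
  define P where "P k s' \<longleftrightarrow> fst s' 30 = ?N div ?b ^ k \<and> (\<forall>j<k. snd s' (?A + j) = ?N div ?b ^ j mod ?b) \<and>
      (\<forall>a<?A. snd s' a = snd s a)" for k and s' :: state
  have "P (fst ?s 11) (sem decode s)"
    unfolding decode_def sem.simps(4) sem.simps(2) aval.simps
  proof (rule For_rule, unfold P_def, goal_cases)
    case (2 k s')
    have r: "fst s' 0 = fst s 0" "fst s' 2 = fst s 2" "fst s' 12 = ?b" "fst s' 13 = fst s 13" "fst s' 25 = k"
      using 2(3,4) by simp_all
    have "?N div ?b ^ k \<le> ?N" by (rule div_le_dividend)
    then have "?N div ?b ^ k \<le> fst s 13" using assms(1) by (rule le_trans)
    then have le: "fst s' 30 \<le> fst s' 13" using 2(2) r(4) by simp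
    have b: "0 < fst s' 12" using r assms(2) 2(1) by simp
    have *: "?N div ?b ^ k div ?b = ?N div ?b ^ Suc k" by (simp only: power_Suc2 div_mult2_eq)
    show ?case
      using 2(2) r sem_divide[OF le b] * by (auto simp: less_Suc_eq add.assoc)
  qed simp
  then show ?thesis by (simp add: P_def add.assoc)
qed

text \<open>Surjectivity of the decoding, by Horner's scheme with the least significant digit first,
  so that dividing by \<open>b\<close> strips off \<open>e 0\<close>.\<close>

lemma digits_exist: "(\<And>j. j < m \<Longrightarrow> e j < (b::nat)) \<Longrightarrow> \<exists>N<b ^ m. \<forall>j<m. N div b ^ j mod b = e j"
proof (induction m arbitrary: e)
  case (Suc m)
  from Suc.IH[of "\<lambda>j. e (Suc j)"] Suc.prems
  obtain N where N: "N < b ^ m" "\<forall>j<m. N div b ^ j mod b = e (Suc j)" by auto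
  have e0: "e 0 < b" using Suc.prems by simp
  have "e 0 + b * N < b * Suc N" using e0 by simp
  also have "\<dots> \<le> b ^ Suc m" using N(1) by (simp only: power_Suc mult_le_mono2 Suc_leI)
  finally have "e 0 + b * N < b ^ Suc m" .
  moreover have "(e 0 + b * N) div b ^ j mod b = e j" if "j < Suc m" for j
  proof (cases j)
    case (Suc i)
    have "(e 0 + b * N) div b = N" using e0 by simp
    then show ?thesis using N(2) that Suc by (simp add: div_mult2_eq)
  qed (use e0 in simp)
  ultimately show ?case by blast
qed simp

lemma visits_cong: "(\<And>j. j < m \<Longrightarrow> e j = e' j) \<Longrightarrow> visits m e b p = visits m e' b p"
  by (induction p) (auto intro: filter_cong)

lemma total_cost_cong:
  "(\<And>j. j < length lst \<Longrightarrow> e j = e' j) \<Longrightarrow> total_cost D S r l g \<Lambda> lst n e k = total_cost D S r l g \<Lambda> lst n e' k"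
  unfolding total_cost_def using visits_cong[of "length lst" e e'] by simp

section \<open>Evaluation of candidates by the program\<close>

locale search_setup =
  fixes n k r l g aD aL len :: nat and D :: "nat \<Rightarrow> nat \<Rightarrow> nat" and S :: "nat set"
    and \<Lambda> :: "nat \<Rightarrow> nat" and lst :: "nat list"
  assumes lst: "set lst \<subseteq> {..<n}" "length lst \<le> n"
    and len: "2 + n * n \<le> len" "aD + n \<le> len" "aL + n \<le> len"
begin

definition ready :: "state \<Rightarrow> bool" where
  "ready s \<longleftrightarrow> fst s 0 = len \<and> fst s 2 = n \<and> fst s 3 = k \<and> fst s 4 = r \<and> fst s 5 = l \<and> fst s 6 = g \<and>
     fst s 8 = aD \<and> fst s 10 = aL \<and> fst s 11 = length lst \<and> fst s 12 = k * length lst \<and>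
     fst s 13 = (k * length lst) ^ length lst \<and>
     (\<forall>u<n. \<forall>v<n. snd s (Suc (Suc (n * u + v))) = D u v) \<and> (\<forall>d<n. 0 < snd s (aD + d) \<longleftrightarrow> d \<in> S) \<and>
     (\<forall>v<n. snd s (aL + v) = \<Lambda> v) \<and> (\<forall>j<length lst. snd s (len + j) = lst ! j)"

text \<open>The search only writes registers from 19 on and cells from \<open>len + n\<close> on, so
  the instance, the distances and the representatives survive every step.\<close>

lemma ready_frame:
  assumes "ready s" "\<And>x. x < 19 \<Longrightarrow> fst s' x = fst s x" "\<And>a. a < len + n \<Longrightarrow> snd s' a = snd s a"
  shows "ready s'"
proof -
  have "Suc (Suc (n * u + v)) < len + n" if "u < n" "v < n" for u v
    using cell_less[OF that] len by simp
  then show ?thesis using assms len lst unfolding ready_def by simp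
qed

lemma ready_pure:
  "\<lbrakk>ready s; \<And>x. x < 19 \<Longrightarrow> fst s' x = fst s x; snd s' = snd s\<rbrakk> \<Longrightarrow> ready s'"
  by (rule ready_frame) simp_all

lemma nth_less: "j < length lst \<Longrightarrow> lst ! j < n"
  using lst(1) nth_mem by blast

definition tour_state :: "nat \<Rightarrow> nat list \<Rightarrow> state \<Rightarrow> bool" where
  "tour_state d xs s \<longleftrightarrow> set xs \<subseteq> {..<n} \<and> fst s 37 = last (d # xs) \<and> fst s 38 = plen D (d # xs) \<and>
     fst s 39 = sum_list (map \<Lambda> xs)"

lemma last_less: "\<lbrakk>d < n; set xs \<subseteq> {..<n}\<rbrakk> \<Longrightarrow> last (d # xs) < n"
  using last_in_set[of "d # xs"] by auto

lemma sem_visit: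
  assumes "ready s" "tour_state d xs s" "d < n" "fst s 41 = j" "j < length lst"
  shows "tour_state d (xs @ [lst ! j]) (sem visit s)"
proof -
  have "last (d # xs) < n" using last_less assms by (simp add: tour_state_def)
  moreover have "plen D (d # xs @ [lst ! j]) = plen D (d # xs) + D (last (d # xs)) (lst ! j)"
    using plen_snoc[of "d # xs" D "lst ! j"] by simp
  ultimately show ?thesis using assms nth_less[OF assms(5)]
    by (simp add: visit_def tour_state_def ready_def)
qed

lemma sem_slot:
  assumes s: "ready s" "tour_state d xs s" "d < n"
  shows "tour_state d (xs @ map ((!) lst) (filter (\<lambda>j. snd s (len + n + j) = fst s 33 + fst s 40) [0..<length lst]))
    (sem slot s)"
proof -
  let ?P = "\<lambda>j. snd s (len + n + j) = fst s 33 + fst s 40"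
  have "(\<lambda>k s'. tour_state d (xs @ map ((!) lst) (filter ?P [0..<k])) s') (fst s 11) (sem slot s)"
    unfolding slot_def
  proof (rule For_rule, goal_cases)
    case 1
    then show ?case using s by (simp add: tour_state_def)
  next
    case (2 k s')
    have "ready s'" by (rule ready_pure[OF s(1)]) (use 2(4,5) in auto)
    have k: "k < length lst" using 2(1) s by (simp add: ready_def)
    have r: "fst s' 0 = len" "fst s' 2 = n" "fst s' 33 = fst s 33" "fst s' 40 = fst s 40" "snd s' = snd s"
      using 2(4,5) s by (simp_all add: ready_def)
    show ?case
    proof (cases "?P k")
      case True
      then show ?thesis using sem_visit[OF \<open>ready s'\<close> 2(2) s(3) 2(3) k] r 2(3)
        by (simp add: tour_state_def add.assoc)
    next
      case False
      then show ?thesis using 2(2) r 2(3) by (simp add: tour_state_def add.assoc)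
    qed
  qed
  then show ?thesis using s by (simp add: ready_def)
qed

lemma sem_tour:
  assumes s: "ready s" "fst s 36 = d" "d < n"
  defines "xs \<equiv> map ((!) lst) (visits (length lst) (\<lambda>j. snd s (len + n + j)) (fst s 33) (length lst))"
  shows "fst (sem tour s) 38 = plen D (d # xs @ [d])" "fst (sem tour s) 39 = sum_list (map \<Lambda> xs)"
proof -
  let ?s = "setr 39 0 (setr 38 0 (setr 37 d s))"
  let ?xs = "\<lambda>p. map ((!) lst) (visits (length lst) (\<lambda>j. snd s (len + n + j)) (fst s 33) p)"
  have "(\<lambda>k s'. tour_state d (?xs k) s') (fst ?s 11) (sem (For 40 11 slot) ?s)"
  proof (rule For_rule, goal_cases)
    case 1
    then show ?case by (simp add: tour_state_def)
  next
    case (2 k s')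
    have "ready s'" by (rule ready_pure[OF s(1)]) (use 2(4,5) in auto)
    have r: "fst s' 33 = fst s 33" "snd s' = snd s" using 2(4,5) by simp_all
    show ?case using sem_slot[OF \<open>ready s'\<close> 2(2) s(3)] r 2(3) by (simp add: tour_state_def)
  qed
  then have t: "tour_state d xs (sem (For 40 11 slot) ?s)" using s by (simp add: ready_def xs_def)
  define t where "t = sem (For 40 11 slot) ?s"
  have r: "fst t 2 = n" "fst t 36 = d" "snd t = snd s"
    using s by (simp_all add: t_def ready_def del: sem.simps)
  have "last (d # xs) < n" using last_less[OF s(3)] t by (simp add: tour_state_def)
  moreover have "plen D (d # xs @ [d]) = plen D (d # xs) + D (last (d # xs)) d"
    using plen_snoc[of "d # xs" D d] by simp
  moreover have "sem tour s = sem (mulp 20 21 2 37 ;; SetR 38 (Add (Reg 38) (Mem (cell 20 36)))) t"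
    using s(2) by (simp add: tour_def t_def)
  ultimately show "fst (sem tour s) 38 = plen D (d # xs @ [d])" "fst (sem tour s) 39 = sum_list (map \<Lambda> xs)"
    using t r s unfolding t_def[symmetric] by (simp_all add: tour_state_def ready_def)
qed

lemma sem_vehicle:
  assumes s: "ready s"
  shows "fst (sem vehicle s) 35 = best D S r l g \<Lambda>
    (map ((!) lst) (visits (length lst) (\<lambda>j. snd s (len + n + j)) (fst s 33) (length lst))) n"
proof -
  let ?s = "setr 35 (Suc r) s"
  let ?xs = "map ((!) lst) (visits (length lst) (\<lambda>j. snd s (len + n + j)) (fst s 33) (length lst))"
  define c where "c = Cond (Num 0) (elem 8 36)
     (tour ;; Cond (Reg 5) (Reg 39) Nop (Cond (Reg 6) (Reg 38) Nop
       (Cond (Reg 38) (Reg 35) (SetR 35 (Reg 38)) Nop))) Nop"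
  have "(\<lambda>k s'. fst s' 35 = best D S r l g \<Lambda> ?xs k) (fst ?s 2) (sem (For 36 2 c) ?s)"
  proof (rule For_rule, goal_cases)
    case (2 k s')
    have fr: "fst s' x = fst s x" if "x \<notin> {20, 21, 35, 36, 37, 38, 39, 40, 41, 42}" for x
      using 2(4)[of x] that by (simp add: c_def)
    have M: "snd s' = snd s" using 2(5) by (simp add: c_def)
    have "ready s'" by (rule ready_pure[OF s]) (use fr M in auto)
    have k: "k < n" using 2(1) s by (simp add: ready_def)
    have r: "fst s' 33 = fst s 33" "fst s' 5 = l" "fst s' 6 = g" "fst s' 8 = aD" using s by (simp_all add: fr ready_def)
    have dS: "0 < snd s (aD + k) \<longleftrightarrow> k \<in> S" using s k by (simp add: ready_def)
    show ?case
      using sem_tour[OF \<open>ready s'\<close> 2(3) k] 2(2,3) r M dS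
      unfolding c_def best.simps Let_def by (auto simp: not_less not_le)
  qed simp
  then show ?thesis using s by (simp add: vehicle_def c_def ready_def)
qed

lemma sem_evaluate:
  assumes s: "ready s"
  shows "fst (sem evaluate s) 32 = total_cost D S r l g \<Lambda> lst n (\<lambda>j. snd s (len + n + j)) k"
proof -
  let ?s = "setr 33 0 (setr 32 0 s)" and ?e = "\<lambda>j. snd s (len + n + j)"
  define P where "P i s' \<longleftrightarrow> fst s' 32 = total_cost D S r l g \<Lambda> lst n ?e i \<and> fst s' 33 = i * length lst" for i and s' :: state
  have "P (fst ?s 3) (sem evaluate s)"
    unfolding evaluate_def sem.simps(4) sem.simps(2) aval.simps
  proof (rule For_rule, unfold P_def, goal_cases)
    case (2 i s')
    have "ready s'" by (rule ready_pure[OF s]) (use 2(4,5) in auto)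
    have r: "fst s' 11 = length lst" "snd s' = snd s" using 2(4,5) s by (simp_all add: ready_def)
    show ?case using sem_vehicle[OF \<open>ready s'\<close>] 2(2) r by (simp add: total_cost_def)
  qed (simp add: total_cost_def)
  then show ?thesis using s by (simp add: P_def ready_def)
qed

theorem sem_search:
  assumes s: "ready s"
  shows "fst (sem search s) 19 = 1 \<longleftrightarrow>
    (\<exists>e. (\<forall>j<length lst. e j < k * length lst) \<and> total_cost D S r l g \<Lambda> lst n e k \<le> r)"
proof -
  let ?b = "k * length lst" and ?m = "length lst" and ?s = "setr 19 0 s"
  let ?Q = "\<lambda>N. total_cost D S r l g \<Lambda> lst n (\<lambda>j. N div ?b ^ j mod ?b) k < Suc r"
  define P where "P K s' \<longleftrightarrow> ready s' \<and> fst s' 19 = (if \<exists>N<K. ?Q N then 1 else 0)" for K and s' :: state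
  have "P (fst ?s 13) (sem search s)"
    unfolding search_def sem.simps(4) sem.simps(2) aval.simps
  proof (rule For_rule, unfold P_def, goal_cases)
    case 1
    show ?case using ready_pure[OF s] by simp
  next
    case (2 N s')
    have rs': "ready s'" using 2(2) by simp
    have N: "N < ?b ^ ?m" using 2(1) s by (simp add: ready_def)
    \<comment> \<open>With clients present, base 0 would leave no candidate, so the existence of
      \<open>N\<close> makes it positive. With none, \<open>0 ^ 0 = 1\<close> still yields the one
      empty candidate.\<close>
    have b: "0 < ?b" if "0 < ?m" using N that by (cases "?b = 0") (simp_all add: power_0_left)
    have *: "\<forall>j<?m. snd (sem decode s') (len + n + j) = N div ?b ^ j mod ?b"
      "\<forall>a<len + n. snd (sem decode s') a = snd s' a"
      using sem_decode[of s'] rs' 2(3) N b by (simp_all add: ready_def add.assoc)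
    have rd: "ready (sem decode s')"
      by (rule ready_frame[OF rs']) (use *(2) in auto)
    have re: "ready (sem evaluate (sem decode s'))"
      by (rule ready_pure[OF rd]) auto
    have "fst (sem evaluate (sem decode s')) 32 =
        total_cost D S r l g \<Lambda> lst n (\<lambda>j. N div ?b ^ j mod ?b) k"
      unfolding sem_evaluate[OF rd] by (rule total_cost_cong) (use *(1) in simp)
    moreover have "fst (sem evaluate (sem decode s')) 4 = r" using re by (simp add: ready_def)
    moreover have "ready (setr 29 x (sem evaluate (sem decode s')))"
       "ready (setr 29 x (setr 19 y (sem evaluate (sem decode s'))))" for x y
      by (rule ready_pure[OF re]; simp)+
    ultimately show ?case using 2(2) by (simp add: Ex_less_Suc_nat)
  qed
  then have "fst (sem search s) 19 = 1 \<longleftrightarrow> (\<exists>N<?b ^ ?m. ?Q N)" using s by (simp add: P_def ready_def)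
  also have "\<dots> \<longleftrightarrow> (\<exists>e. (\<forall>j<?m. e j < ?b) \<and> total_cost D S r l g \<Lambda> lst n e k \<le> r)"
  proof
    assume "\<exists>N<?b ^ ?m. ?Q N"
    then obtain N where N: "N < ?b ^ ?m" "?Q N" by blast
    have b: "0 < ?b" if "0 < ?m" using N that by (cases "?b = 0") (simp_all add: power_0_left)
    have "\<forall>j<?m. N div ?b ^ j mod ?b < ?b"
    proof (intro allI impI)
      fix j assume "j < ?m"
      then have "0 < ?m" by linarith
      then show "N div ?b ^ j mod ?b < ?b" by (intro mod_less_divisor b)
    qed
    then show "\<exists>e. (\<forall>j<?m. e j < ?b) \<and> total_cost D S r l g \<Lambda> lst n e k \<le> r"
      using N(2) by (intro exI[of _ "\<lambda>j. N div ?b ^ j mod ?b"] conjI) simp_all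
  next
    assume "\<exists>e. (\<forall>j<?m. e j < ?b) \<and> total_cost D S r l g \<Lambda> lst n e k \<le> r"
    then obtain e where e: "\<And>j. j < ?m \<Longrightarrow> e j < ?b" "total_cost D S r l g \<Lambda> lst n e k \<le> r" by blast
    obtain N where N: "N < ?b ^ ?m" "\<And>j. j < ?m \<Longrightarrow> N div ?b ^ j mod ?b = e j"
      using digits_exist[of ?m e ?b] e(1) by blast
    then have "total_cost D S r l g \<Lambda> lst n (\<lambda>j. N div ?b ^ j mod ?b) k = total_cost D S r l g \<Lambda> lst n e k"
      by (intro total_cost_cong)
    then show "\<exists>N<?b ^ ?m. ?Q N" using N(1) e(2) by auto
  qed
  finally show ?thesis .
qed

end

section \<open>Solving a valid instance\<close>

text \<open>Too many representatives are rejected before \<open>(k * m) ^ m\<close> is formed; this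
  bounds the limits of the loops that follow in terms of \<open>n\<close> and the parameter.\<close>

definition core :: prg where
  "core = init_dist ;; floyd ;; choose_reps ;; mulp 14 21 1 1 ;; SetR 14 (Add (Reg 14) (Reg 1)) ;;
     Cond (Reg 14) (Reg 11) (SetR 0 (Num 0))
       (mulp 12 21 3 11 ;; powp 13 12 11 ;; search ;; SetR 0 (Reg 19))"

text \<open>Covers both bounds: \<open>k * l \<le> \<kappa> * \<kappa>\<close> for loads and
  \<open>k * (g + 1) \<le> \<kappa> * (\<kappa> + 1)\<close> for gas.\<close>

definition max_clients :: "nat \<Rightarrow> nat" where
  "max_clients \<kappa> = \<kappa> * \<kappa> + \<kappa>"

text \<open>One summand for each kind of loop limit. The \<open>+ 1\<close> in the base keeps the
  power monotone in its exponent even where the base would be 0; the last \<open>+ 1\<close> makes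
  the value positive.\<close>

definition growth :: "nat \<Rightarrow> nat" where
  "growth \<kappa> = (\<kappa> * max_clients \<kappa> + 1) ^ max_clients \<kappa> + \<kappa> * max_clients \<kappa> + max_clients \<kappa> + \<kappa> + 1"

definition represents :: "(nat \<Rightarrow> nat) \<Rightarrow> nat \<Rightarrow> nat vrp \<Rightarrow> bool" where
  "represents M n I \<longleftrightarrow> verts I = {..<n} \<and>
     (\<forall>u<n. \<forall>v<n. mat M n u v = (if {u, v} \<in> edges I then weight I {u, v} + 1 else 0)) \<and>
     (\<forall>v<n. M (2 + n * n + v) = (if v \<in> depots I then 1 else 0)) \<and>
     (\<forall>v<n. M (2 + n * n + n + v) = (if v \<in> clients I then 1 else 0)) \<and>
     vehicles I = M (2 + n * n + n + n) \<and> bound I = M (2 + n * n + n + n + 1)"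

lemma walk_clients [simp]:
  "walk (I\<lparr>clients := C\<rparr>) = walk I" "walk_weight (I\<lparr>clients := C\<rparr>) = walk_weight I"
  "upper_dist (I\<lparr>clients := C\<rparr>) = upper_dist I" "lower_dist (I\<lparr>clients := C\<rparr>) = lower_dist I"
proof -
  show w: "walk (I\<lparr>clients := C\<rparr>) = walk I" "walk_weight (I\<lparr>clients := C\<rparr>) = walk_weight I"
    by (auto simp: walk_def walk_weight_def fun_eq_iff)
  show "upper_dist (I\<lparr>clients := C\<rparr>) = upper_dist I" "lower_dist (I\<lparr>clients := C\<rparr>) = lower_dist I"
    by (auto simp: upper_dist_def lower_dist_def reach_def w fun_eq_iff)
qed

definition setup_regs :: "nat \<Rightarrow> nat \<Rightarrow> nat \<Rightarrow> nat \<Rightarrow> nat \<Rightarrow> nat \<Rightarrow> nat \<Rightarrow> nat vrp \<Rightarrow> state \<Rightarrow> bool" where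
  "setup_regs len \<kappa> n l g q aL I s \<longleftrightarrow> fst s 0 = len \<and> fst s 1 = \<kappa> \<and> fst s 2 = n \<and> fst s 3 = vehicles I \<and>
     fst s 4 = bound I \<and> fst s 5 = l \<and> fst s 6 = g \<and> fst s 7 = q \<and> fst s 8 = 2 + n * n \<and>
     fst s 9 = 2 + n * n + n \<and> fst s 10 = aL"

text \<open>\<open>D\<close> and \<open>lst\<close> are what the program computes. The answer refers
  to the instance restricted to \<open>lst\<close>; its relation to all clients depends on the
  problem and enters as the hypothesis of \<open>solver_aux\<close>.\<close>

lemma sem_core:
  assumes I: "vrp_instance I" "represents (snd s) n I"
    and s: "setup_regs len \<kappa> n l g q aL I s"
    and addr: "2 + n * n + n + n \<le> len" "2 + n * n \<le> aL" "aL + n \<le> len"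
    and X: "n \<le> X" "growth \<kappa> \<le> X" "vehicles I \<le> \<kappa>"
  shows "loops_le X core s" "\<exists>D lst. upper_dist I D \<and> lower_dist I D \<and> representatives D q (clients I) lst \<and>
    (fst (sem core s) 0 = 1 \<longleftrightarrow> length lst \<le> max_clients \<kappa> \<and>
      load_gas_cvrp_solvable (I\<lparr>clients := set lst\<rparr>) l (\<lambda>v. snd s (aL + v)) g)"
proof -
  let ?M = "snd s" and ?r = "bound I" and ?k = "vehicles I"
  define s1 where "s1 = sem init_dist s"
  define s2 where "s2 = sem floyd s1"
  define s3 where "s3 = sem choose_reps s2"
  define s4 where "s4 = setr 14 (max_clients \<kappa>) (setr 21 \<kappa> (setr 14 (\<kappa> * \<kappa>) s3))"
  define s5 where "s5 = sem (powp 13 12 11) (sem (mulp 12 21 3 11) s4)"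
  have verts: "verts I = {..<n}" using I(2) by (simp add: represents_def)
  have sub: "depots I \<subseteq> {..<n}" "clients I \<subseteq> {..<n}"
    using I(1) verts by (auto simp: vrp_instance_def)
  have s1: "snd s1 = with_mat ?M n (start_dist ?M n ?r)"
    using sem_init_dist[of s] s by (simp add: s1_def setup_regs_def)
  have E: "start_dist ?M n ?r u v =
      (if u = v then 0 else if {u, v} \<in> edges I then weight I {u, v} else Suc ?r)" if "u < n" "v < n" for u v
    using I(2) that by (auto simp: start_dist_def represents_def)
  have "floyd_inv I n 0 0 0 (start_dist ?M n ?r)"
  proof -
    have "upper_dist I (start_dist ?M n ?r)"
      by (rule upper_dist_init[OF I(1)]) (use verts E in auto)
    then show ?thesis using dom_init[OF I(1) E] by (simp add: floyd_inv_def)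
  qed
  then obtain D where D: "snd s2 = with_mat ?M n D" "upper_dist I D" "lower_dist I D"
    using sem_floyd[OF s1 _ verts] s unfolding s2_def by (auto simp: s1_def setup_regs_def)
  have r2: "fst s2 x = fst s x" if "x < 20" for x
    using that by (simp add: s2_def s1_def)
  have "\<exists>lst. representatives D (fst s2 7) (clients I) lst \<and> fst s3 11 = length lst \<and>
    length lst \<le> n \<and> (\<forall>a<fst s2 0. snd s3 a = snd s2 a) \<and>
    (\<forall>j<length lst. snd s3 (fst s2 0 + j) = lst ! j)"
    unfolding s3_def
  proof (rule sem_choose_reps)
    show "0 < snd s2 (fst s2 9 + c) \<longleftrightarrow> c \<in> clients I" if "c < n" for c
      using I(2) that s r2[of 9] by (simp add: D(1) setup_regs_def represents_def)
    show "mat (snd s2) n u v = D u v" if "u < n" "v < n" for u v using that by (simp add: D(1))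
  qed (use s r2[of 0] r2[of 2] r2[of 9] addr sub in \<open>auto simp: setup_regs_def\<close>)
  then obtain lst where reps: "representatives D q (clients I) lst" "fst s3 11 = length lst" "length lst \<le> n"
    "\<And>a. a < len \<Longrightarrow> snd s3 a = snd s2 a" "\<And>j. j < length lst \<Longrightarrow> snd s3 (len + j) = lst ! j"
    using s r2[of 0] r2[of 7] by (auto simp: setup_regs_def)
  have r3: "fst s3 x = fst s x" if "x < 20" "x \<noteq> 11" for x
    using that r2[of x] by (simp add: s3_def)
  let ?m = "length lst"
  have r5: "fst s5 x = fst s x" if "x < 20" "x \<notin> {11, 12, 13, 14}" for x
    using that r3[of x] by (simp add: s5_def s4_def)
  have r5': "fst s5 11 = ?m" "fst s5 12 = ?k * ?m" "fst s5 13 = (?k * ?m) ^ ?m" "snd s5 = snd s3"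
    using r3[of 3] reps(2) s by (simp_all add: s5_def s4_def setup_regs_def)
  have lst_sub: "set lst \<subseteq> clients I" "distinct lst" using reps(1) by (auto simp: representatives_def)
  interpret search_setup n ?k ?r l g "2 + n * n" aL len D "depots I" "\<lambda>v. ?M (aL + v)" lst
    by unfold_locales (use reps(3) lst_sub sub addr in auto)
  have ready: "ready s5"
  proof -
    have "snd s3 (Suc (Suc (n * u + v))) = D u v" if "u < n" "v < n" for u v
      using that reps(4) cell_less[OF that] addr by (simp add: D(1))
    moreover have "0 < snd s3 (2 + n * n + d) \<longleftrightarrow> d \<in> depots I" if "d < n" for d
      using that I(2) reps(4) addr by (simp add: D(1) represents_def)
    moreover have "snd s3 (aL + v) = ?M (aL + v)" if "v < n" for v
      using that reps(4) addr by (simp add: D(1))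
    ultimately show ?thesis
      using s reps(5) unfolding ready_def by (simp add: r5 r5' setup_regs_def)
  qed
  let ?J = "I\<lparr>clients := set lst\<rparr>"
  have J: "vrp_instance ?J" using I(1) lst_sub by (auto simp: vrp_instance_def)
  have "fst (sem search s5) 19 = 1 \<longleftrightarrow> load_gas_cvrp_solvable ?J l (\<lambda>v. ?M (aL + v)) g"
    unfolding sem_search[OF ready]
  proof
    assume "\<exists>e. (\<forall>j<length lst. e j < ?k * length lst) \<and>
      total_cost D (depots I) ?r l g (\<lambda>v. ?M (aL + v)) lst n e ?k \<le> ?r"
    then obtain e where "\<And>j. j < length lst \<Longrightarrow> e j < ?k * length lst"
      "total_cost D (depots ?J) (bound ?J) l g (\<lambda>v. ?M (aL + v)) lst n e ?k \<le> bound ?J"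
      by auto
    from routing_of_slots[OF J _ _ _ _ this] show "load_gas_cvrp_solvable ?J l (\<lambda>v. ?M (aL + v)) g"
      using verts D(2) lst_sub by simp
  next
    assume "load_gas_cvrp_solvable ?J l (\<lambda>v. ?M (aL + v)) g"
    from slots_of_routing[OF J _ _ _ _ this]
    show "\<exists>e. (\<forall>j<length lst. e j < ?k * length lst) \<and>
      total_cost D (depots I) ?r l g (\<lambda>v. ?M (aL + v)) lst n e ?k \<le> ?r"
      using verts D(3) lst_sub by simp
  qed
  moreover have core: "sem core s = (if max_clients \<kappa> < ?m then setr 0 0 s4 else setr 0 (fst (sem search s5) 19) (sem search s5))"
    using reps(2) r3[of 1] s
    unfolding core_def s5_def s4_def s3_def s2_def s1_def
    by (simp add: setup_regs_def max_clients_def del: sem_powp)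
  ultimately show "\<exists>D lst. upper_dist I D \<and> lower_dist I D \<and> representatives D q (clients I) lst \<and>
    (fst (sem core s) 0 = 1 \<longleftrightarrow> length lst \<le> max_clients \<kappa> \<and>
      load_gas_cvrp_solvable (I\<lparr>clients := set lst\<rparr>) l (\<lambda>v. snd s (aL + v)) g)"
    using D(2,3) reps(1) by (intro exI[of _ D] exI[of _ lst]) auto
  have gr: "max_clients \<kappa> \<le> X" "\<kappa> \<le> X" "\<kappa> * max_clients \<kappa> \<le> X" "(\<kappa> * max_clients \<kappa> + 1) ^ max_clients \<kappa> \<le> X"
    using X(2) by (simp_all add: growth_def)
  have "loops_le X init_dist s" "loops_le X floyd s1" "loops_le X choose_reps s2"
    using X(1) s r2[of 2] by (auto intro!: loops_le_static simp: s1_def setup_regs_def)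
  moreover have "loops_le X (mulp 14 21 1 1) s3"
    using gr s r3[of 1] by (intro loops_le_static) (auto simp: setup_regs_def)
  moreover have "loops_le X (mulp 12 21 3 11) s4" "loops_le X (powp 13 12 11) (sem (mulp 12 21 3 11) s4)"
    "loops_le X search s5" if m: "?m \<le> max_clients \<kappa>"
  proof -
    have k: "fst s4 3 = ?k" "fst s4 11 = ?m" using r3[of 3] s reps(2) by (simp_all add: s4_def setup_regs_def)
    have b: "?k * ?m \<le> \<kappa> * max_clients \<kappa>" using X(3) m by (rule mult_le_mono)
    have "(?k * ?m) ^ ?m \<le> (\<kappa> * max_clients \<kappa> + 1) ^ ?m" using b by (intro power_mono) auto
    also have "\<dots> \<le> (\<kappa> * max_clients \<kappa> + 1) ^ max_clients \<kappa>" using m by (intro power_increasing) auto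
    finally have B: "(?k * ?m) ^ ?m \<le> X" using gr by linarith
    show "loops_le X (mulp 12 21 3 11) s4" using k X(3) gr by (intro loops_le_static) auto
    show "loops_le X (powp 13 12 11) (sem (mulp 12 21 3 11) s4)" using k b m gr
      by (intro loops_le_static) auto
    have "fst s5 2 = n" "fst s5 3 = ?k" using r5[of 2] r5[of 3] s by (simp_all add: setup_regs_def)
    then show "loops_le X search s5" using r5' B b m gr X(1,3)
      by (intro loops_le_static) auto
  qed
  ultimately show "loops_le X core s"
    using reps(2) r3[of 1] s
    unfolding core_def s5_def s4_def s3_def s2_def s1_def
    by (simp add: setup_regs_def max_clients_def del: sem_powp)
qed


section \<open>Reading the input\<close>

definition slice :: "(nat \<Rightarrow> nat) \<Rightarrow> nat \<Rightarrow> nat \<Rightarrow> nat list" where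
  "slice M a m = map (\<lambda>i. M (a + i)) [0..<m]"

lemma length_slice [simp]: "length (slice M a m) = m"
  by (simp add: slice_def)

lemma slice_append: "slice M a m @ slice M (a + m) m' = slice M a (m + m')"
  by (rule nth_equalityI) (auto simp: slice_def nth_append)

lemma slice_init: "x = slice (snd (init (\<kappa> # x))) 1 (length x)"
  by (rule nth_equalityI) (auto simp: slice_def init_def)

lemma slice_eq: "map f [0..<m] = slice M a m \<longleftrightarrow> (\<forall>i<m. M (a + i) = f i)"
  by (auto simp: slice_def)

lemma concat_slice: "concat (map (\<lambda>u. slice M (a + m * u) m) [0..<k]) = slice M a (m * k)"
  by (induction k) (simp_all add: slice_append slice_def[of _ _ 0] add.commute)

lemma concat_eq_iff:
  assumes "\<And>u. u < k \<Longrightarrow> length (f u) = length (g u)"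
  shows "concat (map f [0..<k]) = concat (map g [0..<k]) \<longleftrightarrow> (\<forall>u<k. f u = g u)"
  using assms
proof (induction k)
  case (Suc k)
  have "length (concat (map f [0..<k])) = length (concat (map g [0..<k]))"
    using Suc.prems by (auto simp: length_concat comp_def intro!: arg_cong[of _ _ sum_list] map_cong)
  then show ?case using Suc by (auto simp: less_Suc_eq)
qed simp

text \<open>Being an equivalence, this also turns a word that has passed the checks back into an
  encoded instance.\<close>

lemma encode_vrp_iff:
  assumes "verts I = {..<n}"
  shows "encode_vrp I = slice M 1 (n * n + n + n + 3) \<longleftrightarrow> M 1 = n \<and> represents M n I"
proof -
  let ?f = "\<lambda>u v. if {u, v} \<in> edges I then weight I {u, v} + 1 else 0"
  let ?A = "concat (map (\<lambda>u. map (?f u) [0..<n]) [0..<n])"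
  let ?D = "map (\<lambda>v. if v \<in> depots I then 1 else 0) [0..<n]"
  let ?C = "map (\<lambda>v. if v \<in> clients I then 1 else 0) [0..<n]"
  have lenA: "length ?A = n * n" by (simp add: length_concat comp_def sum_list_triv)
  \<comment> \<open>The 3 counts the cells of \<open>n\<close>, of the number of vehicles and of the
    budget.\<close>
  have sl: "slice M 1 (n * n + n + n + 3) = slice M 1 1 @ slice M 2 (n * n) @ slice M (2 + n * n) n @
      slice M (2 + n * n + n) n @ slice M (2 + n * n + n + n) 2"
    using slice_append[of M 1 1 "n * n + n + n + 2"] slice_append[of M 2 "n * n" "n + n + 2"]
      slice_append[of M "2 + n * n" n "n + 2"] slice_append[of M "2 + n * n + n" n 2]
    by (simp add: numeral_2_eq_2 numeral_3_eq_3 add.assoc)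
  have A: "?A = slice M 2 (n * n) \<longleftrightarrow> (\<forall>u<n. \<forall>v<n. mat M n u v = ?f u v)"
  proof -
    have "?A = slice M 2 (n * n) \<longleftrightarrow> (\<forall>u<n. map (?f u) [0..<n] = slice M (2 + n * u) n)"
      by (subst concat_slice[symmetric], subst concat_eq_iff) simp_all
    then show ?thesis by (simp only: slice_eq add.assoc)
  qed
  have enc: "encode_vrp I = [n] @ ?A @ ?D @ ?C @ [vehicles I, bound I]"
    using assms by (simp add: encode_vrp_def Let_def)
  have two: "slice M a 2 = [M a, M (a + 1)]" "slice M a 1 = [M a]" for a
    by (simp_all add: slice_def numeral_2_eq_2)
  have "encode_vrp I = slice M 1 (n * n + n + n + 3) \<longleftrightarrow> [n] = slice M 1 1 \<and> ?A = slice M 2 (n * n) \<and>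
     ?D = slice M (2 + n * n) n \<and> ?C = slice M (2 + n * n + n) n \<and>
     [vehicles I, bound I] = slice M (2 + n * n + n + n) 2"
    unfolding enc sl two(2) using lenA by simp
  also have "\<dots> \<longleftrightarrow> M 1 = n \<and> represents M n I"
    unfolding A slice_eq two using assms by (auto simp: represents_def)
  finally show ?thesis .
qed

lemma encode_load_iff:
  assumes "verts I = {..<n}" "a' = a + 1"
  shows "encode_load I l \<Lambda> = slice M a (n + 1) \<longleftrightarrow>
    M a = l \<and> (\<forall>v<n. M (a' + v) = (if v \<in> clients I then \<Lambda> v else 0))"
proof -
  have "slice M a (n + 1) = [M a] @ slice M a' n"
    using slice_append[of M a 1 n] assms(2) by (simp add: slice_def[of M a "Suc 0"])
  then show ?thesis using assms(1) by (auto simp: encode_load_def slice_eq)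
qed

lemma represents_checks:
  assumes "vrp_instance I" "represents M n I"
    and "\<And>v. v < n \<Longrightarrow> M (aL + v) = 0 \<longleftrightarrow> v \<notin> clients I"
  shows "\<forall>u<n. vertex_ok M n (2 + n * n) (2 + n * n + n) aL u" "\<exists>u<n. 0 < M (2 + n * n + u)"
proof -
  have "{u} \<notin> edges I" for u using assms(1) by (fastforce simp: vrp_instance_def)
  then show "\<forall>u<n. vertex_ok M n (2 + n * n) (2 + n * n + n) aL u"
    using assms(2,3) by (auto simp: vertex_ok_def represents_def insert_commute)
  obtain d where "d \<in> depots I" "d < n" using assms(1,2) by (fastforce simp: vrp_instance_def represents_def)
  then show "\<exists>u<n. 0 < M (2 + n * n + u)" using assms(2) by (auto simp: represents_def)
qed

lemma represents_exists:
  assumes "\<forall>u<n. vertex_ok M n (2 + n * n) (2 + n * n + n) aL u" "\<exists>u<n. 0 < M (2 + n * n + u)"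
  shows "\<exists>I. vrp_instance I \<and> represents M n I"
proof -
  \<comment> \<open>\<open>Min\<close> and \<open>Max\<close> orient an edge; the matrix is
    symmetric, so the choice does not matter. Subtracting 1 undoes the offset of edge
    entries.\<close>
  let ?I = "\<lparr>verts = {..<n}, edges = {{u, v} |u v. u < n \<and> v < n \<and> 0 < mat M n u v},
    weight = (\<lambda>e. mat M n (Min e) (Max e) - 1), depots = {v. v < n \<and> 0 < M (2 + n * n + v)},
    clients = {v. v < n \<and> 0 < M (2 + n * n + n + v)},
    vehicles = M (2 + n * n + n + n), bound = M (2 + n * n + n + n + 1)\<rparr>"
  have sym: "mat M n u v = mat M n v u" and diag: "mat M n u u = 0"
    and le: "M (2 + n * n + u) \<le> 1" "M (2 + n * n + n + u) \<le> 1" if "u < n" "v < n" for u v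
    using assms(1) that by (auto simp: vertex_ok_def)
  have edge: "{u, v} \<in> edges ?I \<longleftrightarrow> 0 < mat M n u v" if "u < n" "v < n" for u v
    using that sym by (auto simp: doubleton_eq_iff)
  have weight: "weight ?I {u, v} = mat M n u v - 1" if "u < n" "v < n" for u v
    using sym[OF that] by (cases "u \<le> v") (auto simp: min_def max_def)
  have "vrp_instance ?I"
    using assms(2) diag by (auto simp: vrp_instance_def card_insert_if)
  moreover have "represents M n ?I"
    unfolding represents_def
  proof (intro conjI allI impI)
    fix u v assume uv: "u < n" "v < n"
    show "mat M n u v = (if {u, v} \<in> edges ?I then weight ?I {u, v} + 1 else 0)"
      unfolding edge[OF uv] weight[OF uv] by simp
  next
    fix v assume v: "v < n"
    show "M (2 + n * n + v) = (if v \<in> depots ?I then 1 else 0)"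
      "M (2 + n * n + n + v) = (if v \<in> clients ?I then 1 else 0)"
      using v le[OF v v] by auto
  qed simp_all
  ultimately show ?thesis by blast
qed

text \<open>Depending on the problem, \<open>mode\<close> sets the registers 5 (load capacity), 6 (gas capacity), 7
  (clients at a smaller distance from a representative are dropped), 10 (address of the demands), 18
  (expected input length) and 19 (expected parameter).  Register 17 holds the address of the number
  of vehicles.\<close>

definition prepare :: "prg \<Rightarrow> prg" where
  "prepare mode = mulp 15 21 2 2 ;; SetR 8 (Add (Num 2) (Reg 15)) ;; SetR 9 (Add (Reg 8) (Reg 2)) ;;
     SetR 17 (Add (Reg 9) (Reg 2)) ;; SetR 3 (Mem (Reg 17)) ;; SetR 4 (Mem (Add (Reg 17) (Num 1))) ;; mode"

text \<open>Squaring \<open>n\<close> takes \<open>n\<close> rounds, so \<open>n\<close> is first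
  compared with the input length. The comparison of the parameters then bounds the number of
  vehicles.\<close>

definition solver :: "prg \<Rightarrow> prg" where
  "solver mode = SetR 1 (Mem (Num 0)) ;; SetR 2 (Mem (Num 1)) ;;
     Cond (Reg 2) (Reg 0)
      (prepare mode ;;
       ifeq (Reg 0) (Reg 18)
        (ifeq (Reg 1) (Reg 19)
          (input_check ;; ifeq (Reg 16) (Num 1) core (SetR 0 (Num 0)))
          (SetR 0 (Num 0)))
        (SetR 0 (Num 0)))
      (SetR 0 (Num 0))"

locale solver_mode =
  fixes mode :: prg and M :: "nat \<Rightarrow> nat" and \<kappa> n :: nat and x :: "nat list" and aL l g q len par :: nat
  assumes mode: "writes mode = {5, 6, 7, 10, 18, 19}" "no_write mode" "limits mode = {}"
    and M: "M = snd (init (\<kappa> # x))" "n = M 1"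
    and sem_mode: "\<And>s. \<lbrakk>fst s 2 = n; fst s 3 = M (2 + n * n + n + n); fst s 4 = M (2 + n * n + n + n + 1);
        fst s 9 = 2 + n * n + n; fst s 17 = 2 + n * n + n + n; snd s = M\<rbrakk> \<Longrightarrow>
      fst (sem mode s) 5 = l \<and> fst (sem mode s) 6 = g \<and> fst (sem mode s) 7 = q \<and>
      fst (sem mode s) 10 = aL \<and> fst (sem mode s) 18 = len \<and> fst (sem mode s) 19 = par"
    and addr: "2 + n * n + n + n \<le> len" "2 + n * n \<le> aL" "aL + n \<le> len"
    and par: "M (2 + n * n + n + n) \<le> par"
begin

definition valid :: "nat vrp \<Rightarrow> bool" where
  "valid I \<longleftrightarrow> vrp_instance I \<and> represents M n I \<and> (\<forall>v<n. M (aL + v) = 0 \<longleftrightarrow> v \<notin> clients I)"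

text \<open>The memory determines the instance only up to data such as weights of non-edges. Since
  one and the same run answers \<open>Sol\<close> for each valid instance, they all agree, and a
  single run decides the existential statement.\<close>

lemma solver_aux:
  assumes Sol: "\<And>I D lst. \<lbrakk>valid I; \<kappa> = par; upper_dist I D; lower_dist I D; representatives D q (clients I) lst\<rbrakk> \<Longrightarrow>
      length lst \<le> max_clients \<kappa> \<and>
        load_gas_cvrp_solvable (I\<lparr>clients := set lst\<rparr>) l (\<lambda>v. M (aL + v)) g \<longleftrightarrow> Sol I"
  shows "loops_le (growth \<kappa> * length (\<kappa> # x)) (solver mode) (init (\<kappa> # x)) \<and>
    (fst (sem (solver mode) (init (\<kappa> # x))) 0 = 1 \<longleftrightarrow>
      length (\<kappa> # x) = len \<and> \<kappa> = par \<and> (\<exists>I. valid I \<and> Sol I))"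
proof -
  define X where "X = growth \<kappa> * length (\<kappa> # x)"
  have X: "length (\<kappa> # x) \<le> X" "growth \<kappa> \<le> X" by (simp_all add: X_def growth_def)
  let ?s = "setr 2 n (setr 1 \<kappa> (init (\<kappa> # x)))"
  have init: "fst (init (\<kappa> # x)) 0 = length (\<kappa> # x)" "M 0 = \<kappa>" by (simp_all add: init_def M)
  have s: "sem (SetR 2 (Mem (Num 1))) (sem (SetR 1 (Mem (Num 0))) (init (\<kappa> # x))) = ?s"
    using M init by simp
  have "loops_le X (solver mode) (init (\<kappa> # x)) \<and>
    (fst (sem (solver mode) (init (\<kappa> # x))) 0 = 1 \<longleftrightarrow>
      length (\<kappa> # x) = len \<and> \<kappa> = par \<and> (\<exists>I. valid I \<and> Sol I))"
  proof (cases "n < length (\<kappa> # x)")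
    case False
    have "length (\<kappa> # x) \<noteq> len" using False addr by auto
    then show ?thesis using False init s by (auto simp: solver_def)
  next
    case n: True
    define t where "t = sem (prepare mode) ?s"
    define s' where "s' = sem (SetR 4 (Mem (Add (Reg 17) (Num 1)))) (sem (SetR 3 (Mem (Reg 17)))
      (sem (SetR 17 (Add (Reg 9) (Reg 2))) (sem (SetR 9 (Add (Reg 8) (Reg 2)))
      (sem (SetR 8 (Add (Num 2) (Reg 15))) (sem (mulp 15 21 2 2) ?s)))))"
    have t: "t = sem mode s'" by (simp only: t_def s'_def prepare_def sem.simps(4))
    have s': "fst s' 0 = length (\<kappa> # x)" "fst s' 1 = \<kappa>" "fst s' 2 = n" "fst s' 3 = M (2 + n * n + n + n)"
      "fst s' 4 = M (2 + n * n + n + n + 1)" "fst s' 8 = 2 + n * n" "fst s' 9 = 2 + n * n + n"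
      "fst s' 17 = 2 + n * n + n + n" "snd s' = M"
      using M init by (simp_all add: s'_def)
    have tm: "fst t 5 = l" "fst t 6 = g" "fst t 7 = q" "fst t 10 = aL" "fst t 18 = len" "fst t 19 = par"
      using sem_mode[OF s'(3-5,7-9)] by (simp_all add: t)
    have tr: "fst t 0 = length (\<kappa> # x)" "fst t 1 = \<kappa>" "fst t 2 = n" "fst t 3 = M (2 + n * n + n + n)"
      "fst t 4 = M (2 + n * n + n + n + 1)" "fst t 8 = 2 + n * n" "fst t 9 = 2 + n * n + n" "snd t = M"
      using s' mode by (simp_all add: t)
    define c where "c = sem input_check t"
    have chk: "fst c 16 = 1 \<longleftrightarrow>
      (\<forall>u<n. vertex_ok M n (2 + n * n) (2 + n * n + n) aL u) \<and> (\<exists>u<n. 0 < M (2 + n * n + u))"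
      unfolding c_def sem_input_check using tm tr by simp
    have le_prep: "loops_le X (prepare mode) ?s"
      using n X mode by (intro loops_le_static) (auto simp: prepare_def)
    have le_chk: "loops_le X input_check t"
      using n X tr by (intro loops_le_static) auto
    have core: "loops_le X core c \<and> (fst (sem core c) 0 = 1 \<longleftrightarrow> Sol I)"
      if "length (\<kappa> # x) = len" "\<kappa> = par" "valid I" for I
    proof -
      have cM: "snd c = M" using tr by (simp add: c_def)
      have I: "vrp_instance I" "represents (snd c) n I" using that(3) cM by (simp_all add: valid_def)
      then have v: "vehicles I = M (2 + n * n + n + n)" "bound I = M (2 + n * n + n + n + 1)"
        using cM by (simp_all add: represents_def)
      have regs: "setup_regs (length (\<kappa> # x)) \<kappa> n l g q aL I c"
        using tr tm v by (simp add: setup_regs_def c_def)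
      have *: "2 + n * n + n + n \<le> length (\<kappa> # x)" "2 + n * n \<le> aL" "aL + n \<le> length (\<kappa> # x)" "n \<le> X"
          "vehicles I \<le> \<kappa>"
        using addr that(1,2) par v n X by simp_all
      note core = sem_core[OF I regs *(1-4) X(2) *(5)]
      from core(2) obtain D lst where "upper_dist I D" "lower_dist I D" "representatives D q (clients I) lst"
        "fst (sem core c) 0 = 1 \<longleftrightarrow> length lst \<le> max_clients \<kappa> \<and>
          load_gas_cvrp_solvable (I\<lparr>clients := set lst\<rparr>) l (\<lambda>v. snd c (aL + v)) g" by blast
      then show ?thesis using core(1) Sol[OF that(3,2)] cM by simp
    qed
    have sem: "fst (sem (solver mode) (init (\<kappa> # x))) 0 = 1 \<longleftrightarrow>
        length (\<kappa> # x) = len \<and> \<kappa> = par \<and> fst c 16 = 1 \<and> fst (sem core c) 0 = 1"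
      using n s init tm tr unfolding solver_def
      by (simp add: t_def[symmetric] c_def[symmetric] del: One_nat_def)
    have le: "loops_le X (solver mode) (init (\<kappa> # x)) \<longleftrightarrow>
        (length (\<kappa> # x) = len \<longrightarrow> \<kappa> = par \<longrightarrow> fst c 16 = 1 \<longrightarrow> loops_le X core c)"
      using n s init tm tr le_prep le_chk unfolding solver_def
      by (simp add: t_def[symmetric] c_def[symmetric] del: One_nat_def)
    have ex: "(\<exists>I. valid I) \<longleftrightarrow> fst c 16 = 1"
    proof
      assume "\<exists>I. valid I"
      then show "fst c 16 = 1" using represents_checks[of _ M n aL] unfolding chk valid_def by blast
    next
      assume "fst c 16 = 1"
      then obtain I where I: "vrp_instance I" "represents M n I" and ok: "\<forall>u<n. vertex_ok M n (2 + n * n) (2 + n * n + n) aL u"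
        using represents_exists[of n M aL] unfolding chk by blast
      have "M (aL + v) = 0 \<longleftrightarrow> v \<notin> clients I" if "v < n" for v
        using ok I(2) that unfolding vertex_ok_def represents_def by (metis zero_neq_one)
      then show "\<exists>I. valid I" using I by (auto simp: valid_def)
    qed
    show ?thesis unfolding sem le using core ex by blast
  qed
  then show ?thesis by (simp only: X_def)
qed

end

text \<open>Threshold 0 keeps every client, and the budget takes the place of the gas
  capacity.\<close>

definition load_mode :: prg where
  "load_mode = SetR 5 (Mem (Add (Reg 17) (Num 2))) ;; SetR 6 (Reg 4) ;; SetR 7 (Num 0) ;;
     SetR 10 (Add (Reg 17) (Num 3)) ;; SetR 18 (Add (Reg 17) (Add (Num 3) (Reg 2))) ;; SetR 19 (Add (Reg 3) (Reg 5))"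

definition load_gas_mode :: prg where
  "load_gas_mode = SetR 5 (Mem (Add (Reg 17) (Num 2))) ;; SetR 6 (Mem (Add (Reg 17) (Add (Num 3) (Reg 2)))) ;;
     SetR 7 (Num 0) ;; SetR 10 (Add (Reg 17) (Num 3)) ;; SetR 18 (Add (Reg 17) (Add (Num 4) (Reg 2))) ;;
     SetR 19 (Add (Reg 3) (Reg 5))"

text \<open>Every client gets demand 1, and the load capacity admits all clients.\<close>

definition gas_mode :: prg where
  "gas_mode = SetR 5 (Reg 2) ;; SetR 6 (Mem (Add (Reg 17) (Num 2))) ;; SetR 7 (Num 1) ;;
     SetR 10 (Reg 9) ;; SetR 18 (Add (Reg 17) (Num 3)) ;; SetR 19 (Add (Reg 3) (Reg 6))"

lemma mode_simps [simp]:
  "writes load_mode = {5, 6, 7, 10, 18, 19}" "no_write load_mode" "limits load_mode = {}" "wf_prg load_mode"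
  "writes load_gas_mode = {5, 6, 7, 10, 18, 19}" "no_write load_gas_mode" "limits load_gas_mode = {}" "wf_prg load_gas_mode"
  "writes gas_mode = {5, 6, 7, 10, 18, 19}" "no_write gas_mode" "limits gas_mode = {}" "wf_prg gas_mode"
  by (auto simp: load_mode_def load_gas_mode_def gas_mode_def)

lemma wf_solver: "wf_prg mode \<Longrightarrow> wf_prg (solver mode)"
  by (simp add: solver_def prepare_def core_def)

text \<open>The factor in the time bound has itself to be computed by a machine; \<open>a\<close>
  and \<open>d\<close> are constants of that program.\<close>

lemma growth_computable: "computable (\<lambda>\<kappa>. a * growth \<kappa> ^ d)"
proof -
  let ?p = "SetR 1 (Mem (Num 0)) ;; mulp 14 21 1 1 ;; SetR 14 (Add (Reg 14) (Reg 1)) ;; mulp 12 21 1 14 ;;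
    SetR 13 (Add (Reg 12) (Num 1)) ;; powp 11 13 14 ;;
    SetR 13 (Add (Add (Add (Add (Reg 11) (Reg 12)) (Reg 14)) (Reg 1)) (Num 1)) ;;
    SetR 11 (Num d) ;; powp 12 13 11 ;; SetR 11 (Num a) ;; mulp 0 21 11 12"
  show ?thesis
  proof (rule computable_prg)
    show "wf_prg ?p" by simp
    show "fst (sem ?p (init [\<kappa>])) 0 = a * growth \<kappa> ^ d" for \<kappa>
      by (simp add: init_def growth_def max_clients_def)
  qed
qed

lemma FPT_solver:
  assumes "wf_prg mode"
    and "\<And>\<kappa> x. loops_le (growth \<kappa> * length (\<kappa> # x)) (solver mode) (init (\<kappa> # x)) \<and>
      (fst (sem (solver mode) (init (\<kappa> # x))) 0 = 1 \<longleftrightarrow> (x, \<kappa>) \<in> L)"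
  shows "L \<in> FPT"
proof -
  obtain a d where "\<forall>X\<ge>1. tbound (solver mode) X \<le> a * X ^ d" using tbound_poly by blast
  then show ?thesis
    using FPT_prg[OF wf_solver[OF assms(1)] growth_computable[of a d], of L] assms(2)
    by (simp add: growth_def)
qed


section \<open>The three problems\<close>

lemma length_encode_load [simp]: "verts I = {..<n} \<Longrightarrow> length (encode_load I l \<Lambda>) = n + 1"
  by (simp add: encode_load_def)

lemma word_iff:
  assumes "verts I = {..<n}" and M: "M = snd (init (\<kappa> # x))"
  shows "x = encode_vrp I @ rest \<longleftrightarrow> M 1 = n \<and> represents M n I \<and>
    length x = n * n + n + n + 3 + length rest \<and> rest = slice M (2 + n * n + n + n + 2) (length rest)"
proof -
  have len: "length (encode_vrp I) = n * n + n + n + 3"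
    using assms(1) by (simp add: encode_vrp_def Let_def length_concat comp_def sum_list_triv)
  have "x = encode_vrp I @ rest \<longleftrightarrow> length x = n * n + n + n + 3 + length rest \<and>
      slice M 1 (length x) = encode_vrp I @ rest"
    using slice_init[of x \<kappa>] len unfolding M by auto
  also have "\<dots> \<longleftrightarrow> length x = n * n + n + n + 3 + length rest \<and>
      encode_vrp I = slice M 1 (n * n + n + n + 3) \<and> rest = slice M (2 + n * n + n + n + 2) (length rest)"
  proof -
    have "1 + (n * n + n + n + 3) = 2 + n * n + n + n + 2" by simp
    then have "slice M 1 (n * n + n + n + 3 + length rest) =
        slice M 1 (n * n + n + n + 3) @ slice M (2 + n * n + n + n + 2) (length rest)"
      using slice_append[of M 1 "n * n + n + n + 3" "length rest"] by metis
    then show ?thesis using len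
      append_eq_append_conv[of "slice M 1 (n * n + n + n + 3)" "encode_vrp I"
        "slice M (2 + n * n + n + n + 2) (length rest)" rest] unfolding length_slice by metis
  qed
  finally show ?thesis using encode_vrp_iff[OF assms(1)] by blast
qed

lemma load_constraint_cong:
  assumes "\<And>c. c \<in> clients I \<Longrightarrow> \<Lambda> c = \<Lambda>' c"
  shows "load_constraint I l \<Lambda> = load_constraint I l \<Lambda>'"
proof -
  have "(\<Sum>c | c \<in> clients I \<and> A c = i. \<Lambda> c) = (\<Sum>c | c \<in> clients I \<and> A c = i. \<Lambda>' c)" for A and i :: nat
    by (rule sum.cong) (use assms in auto)
  then show ?thesis by (intro ext) (simp add: load_constraint_def)
qed

lemma load_client_bound':
  assumes "vrp_instance I" "positive_demands I \<Lambda>" "load_cvrp_solvable I l \<Lambda>" "vehicles I + l = \<kappa>"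
  shows "card (clients I) \<le> max_clients \<kappa>"
proof -
  have "card (clients I) \<le> vehicles I * l" using load_client_bound assms by blast
  also have "\<dots> \<le> \<kappa> * \<kappa>" using assms(4) by (intro mult_le_mono) auto
  finally show ?thesis by (simp add: max_clients_def)
qed

text \<open>The word stores demand 0 outside the clients, whatever \<open>\<Lambda>\<close> is
  there. Only demands of clients are summed, so the load constraint is the same.\<close>

lemma decode_load:
  assumes "encode_load I l \<Lambda> = slice M a (n + 1)" "a' = a + 1" "verts I = {..<n}"
    and "vrp_instance I" "positive_demands I \<Lambda>"
  shows "M a = l" "\<forall>v<n. M (a' + v) = 0 \<longleftrightarrow> v \<notin> clients I"
    "load_constraint I l \<Lambda> = load_constraint I l (\<lambda>v. M (a' + v))"
proof -
  have e: "M a = l" "\<And>v. v < n \<Longrightarrow> M (a' + v) = (if v \<in> clients I then \<Lambda> v else 0)"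
    using assms(1) encode_load_iff[OF assms(3,2)] by auto
  then show "M a = l" "\<forall>v<n. M (a' + v) = 0 \<longleftrightarrow> v \<notin> clients I"
    using assms(5) by (auto simp: positive_demands_def)
  have "clients I \<subseteq> {..<n}" using assms(3,4) by (auto simp: vrp_instance_def)
  then show "load_constraint I l \<Lambda> = load_constraint I l (\<lambda>v. M (a' + v))"
    using e(2) by (intro load_constraint_cong) auto
qed

lemma encode_load_self:
  assumes "a' = a + 1" "vrp_instance I" "verts I = {..<n}" "\<forall>v<n. M (a' + v) = 0 \<longleftrightarrow> v \<notin> clients I"
  shows "encode_load I (M a) (\<lambda>v. M (a' + v)) = slice M a (n + 1)" "positive_demands I (\<lambda>v. M (a' + v))"
proof -
  show "encode_load I (M a) (\<lambda>v. M (a' + v)) = slice M a (n + 1)"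
    unfolding encode_load_iff[OF assms(3,1)] using assms(4) by simp
  have "clients I \<subseteq> {..<n}" using assms(2,3) by (auto simp: vrp_instance_def)
  then show "positive_demands I (\<lambda>v. M (a' + v))"
    using assms(4) by (auto simp: positive_demands_def)
qed

lemma LoadCVRP_FPT: "LoadCVRP (\<lambda>k l. k + l) \<in> FPT"
proof (rule FPT_solver)
  fix \<kappa> x
  define M where "M = snd (init (\<kappa> # x))"
  define n where "n = M 1"
  \<comment> \<open>\<open>b\<close> is the address of the number of vehicles. The budget is at
    \<open>b + 1\<close>, the load capacity at \<open>b + 2\<close>, and the demands start at
    \<open>b + 3\<close>.\<close>
  define b where "b = 2 + n * n + n + n"
  interpret solver_mode load_mode M \<kappa> n x "b + 3" "M (b + 2)" "M (b + 1)" 0 "b + 3 + n" "M b + M (b + 2)"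
    by unfold_locales (auto simp: M_def n_def b_def load_mode_def)
  let ?\<Lambda> = "\<lambda>v. M (b + 3 + v)"
  have validD: "vrp_instance I" "represents M n I" "\<forall>v<n. ?\<Lambda> v = 0 \<longleftrightarrow> v \<notin> clients I"
    "verts I = {..<n}" "vehicles I = M b" "bound I = M (b + 1)" if "valid I" for I
    using that unfolding valid_def by (auto simp: represents_def b_def)
  have b3: "b + 3 = b + 2 + 1" by simp
  have "(x, \<kappa>) \<in> LoadCVRP (\<lambda>k l. k + l) \<longleftrightarrow> length (\<kappa> # x) = b + 3 + n \<and> \<kappa> = M b + M (b + 2) \<and>
      (\<exists>I. valid I \<and> load_cvrp_solvable I (M (b + 2)) ?\<Lambda>)" (is "_ \<longleftrightarrow> ?R")
  proof
    assume "(x, \<kappa>) \<in> LoadCVRP (\<lambda>k l. k + l)"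
    then obtain I l \<Lambda> n' where I: "x = encode_vrp I @ encode_load I l \<Lambda>" "\<kappa> = vehicles I + l" "vrp_instance I"
      "verts I = {..<n'}" "positive_demands I \<Lambda>" "load_cvrp_solvable I l \<Lambda>"
      unfolding LoadCVRP_def standard_verts_def by blast
    have r: "n' = n" "represents M n I" "length x = n * n + n + n + 3 + (n + 1)"
      "encode_load I l \<Lambda> = slice M (b + 2) (n + 1)"
      using I(1) length_encode_load[OF I(4)] unfolding word_iff[OF I(4) M_def] by (auto simp: n_def b_def)
    note e = decode_load[OF r(4) b3 I(4)[unfolded r(1)] I(3,5)]
    have "valid I" using I(3) r(2) e(2) unfolding valid_def by blast
    moreover have "load_cvrp_solvable I (M (b + 2)) ?\<Lambda>" using I(6) e(1,3) by (simp add: load_cvrp_solvable_def)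
    moreover have "length (\<kappa> # x) = b + 3 + n" using r(3) by (simp add: b_def)
    ultimately show ?R using I(2) e(1) validD(5) by auto
  next
    assume ?R
    then obtain I where I: "length (\<kappa> # x) = b + 3 + n" "\<kappa> = M b + M (b + 2)" "valid I"
      "load_cvrp_solvable I (M (b + 2)) ?\<Lambda>" by blast
    note e = encode_load_self[OF b3 validD(1,4,3)[OF I(3)]]
    have "x = encode_vrp I @ encode_load I (M (b + 2)) ?\<Lambda>"
      unfolding word_iff[OF validD(4)[OF I(3)] M_def] e(1) using I(1) validD(2)[OF I(3)]
      by (auto simp: n_def b_def)
    then have "(x, \<kappa>) = (encode_vrp I @ encode_load I (M (b + 2)) ?\<Lambda>, vehicles I + M (b + 2))"
      using I(2) validD(5)[OF I(3)] by simp
    then show "(x, \<kappa>) \<in> LoadCVRP (\<lambda>k l. k + l)"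
      using I(4) validD(1,4)[OF I(3)] e(2) unfolding LoadCVRP_def standard_verts_def by blast
  qed
  \<comment> \<open>If the instance is solvable, the load bound shows that the clients pass the
    counting test, so early rejection is sound.\<close>
  moreover have "length lst \<le> max_clients \<kappa> \<and>
        load_gas_cvrp_solvable (I\<lparr>clients := set lst\<rparr>) (M (b + 2)) ?\<Lambda> (M (b + 1)) \<longleftrightarrow>
      load_cvrp_solvable I (M (b + 2)) ?\<Lambda>"
    if "valid I" "\<kappa> = M b + M (b + 2)" "representatives D 0 (clients I) lst" for I D lst
  proof -
    have "set lst = clients I" "length lst = card (clients I)"
      using that(3) representatives_0[OF that(3)] by (auto simp: representatives_def distinct_card[symmetric])
    moreover have "I\<lparr>clients := clients I\<rparr> = I" by simp
    moreover note e = encode_load_self[OF b3 validD(1,4,3)[OF that(1)]]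
    ultimately show ?thesis
      using load_gas_of_load[of I "M (b + 2)" ?\<Lambda>] load_client_bound'[OF validD(1)[OF that(1)] e(2)]
        validD(5,6)[OF that(1)] that(2) by metis
  qed
  ultimately show "loops_le (growth \<kappa> * length (\<kappa> # x)) (solver load_mode) (init (\<kappa> # x)) \<and>
      (fst (sem (solver load_mode) (init (\<kappa> # x))) 0 = 1 \<longleftrightarrow> (x, \<kappa>) \<in> LoadCVRP (\<lambda>k l. k + l))"
    using solver_aux[of "\<lambda>I. load_cvrp_solvable I (M (b + 2)) ?\<Lambda>"] by blast
qed simp

text \<open>The gas capacity can stay out of the parameter: the load constraint alone bounds the
  number of clients, and \<open>g\<close> limits no loop.\<close>

lemma LoadGasCVRP_FPT: "LoadGasCVRP (\<lambda>k l g. k + l) \<in> FPT"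
proof (rule FPT_solver)
  fix \<kappa> x
  define M where "M = snd (init (\<kappa> # x))"
  define n where "n = M 1"
  define b where "b = 2 + n * n + n + n"
  define g where "g = M (b + 3 + n)"
  interpret solver_mode load_gas_mode M \<kappa> n x "b + 3" "M (b + 2)" g 0 "b + 4 + n" "M b + M (b + 2)"
    by unfold_locales (auto simp: M_def n_def b_def g_def load_gas_mode_def add.assoc)
  let ?\<Lambda> = "\<lambda>v. M (b + 3 + v)"
  have validD: "vrp_instance I" "represents M n I" "\<forall>v<n. ?\<Lambda> v = 0 \<longleftrightarrow> v \<notin> clients I"
    "verts I = {..<n}" "vehicles I = M b" "bound I = M (b + 1)" if "valid I" for I
    using that unfolding valid_def by (auto simp: represents_def b_def)
  have b3: "b + 3 = b + 2 + 1" by simp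
  have sl: "slice M (b + 2) (n + 2) = slice M (b + 2) (n + 1) @ [g]"
  proof -
    have "slice M (b + 2) (n + 1 + 1) = slice M (b + 2) (n + 1) @ slice M (b + 2 + (n + 1)) 1"
      by (rule slice_append[symmetric])
    also have "b + 2 + (n + 1) = b + 3 + n" by simp
    also have "slice M (b + 3 + n) 1 = [g]" by (simp add: slice_def g_def)
    finally show ?thesis by simp
  qed
  have "(x, \<kappa>) \<in> LoadGasCVRP (\<lambda>k l g. k + l) \<longleftrightarrow> length (\<kappa> # x) = b + 4 + n \<and> \<kappa> = M b + M (b + 2) \<and>
      (\<exists>I. valid I \<and> load_gas_cvrp_solvable I (M (b + 2)) ?\<Lambda> g)" (is "_ \<longleftrightarrow> ?R")
  proof
    assume "(x, \<kappa>) \<in> LoadGasCVRP (\<lambda>k l g. k + l)"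
    then obtain I l \<Lambda> g' n' where I: "x = encode_vrp I @ encode_load I l \<Lambda> @ [g']" "\<kappa> = vehicles I + l" "vrp_instance I"
      "verts I = {..<n'}" "positive_demands I \<Lambda>" "load_gas_cvrp_solvable I l \<Lambda> g'"
      unfolding LoadGasCVRP_def standard_verts_def by blast
    have "length (encode_load I l \<Lambda> @ [g']) = n' + 2" using length_encode_load[OF I(4)] by simp
    then have r: "n' = n" "represents M n I" "length x = n * n + n + n + 3 + (n + 2)"
      "encode_load I l \<Lambda> @ [g'] = slice M (b + 2) (n + 2)"
      using I(1) unfolding word_iff[OF I(4) M_def] by (auto simp: n_def b_def)
    have r4: "encode_load I l \<Lambda> = slice M (b + 2) (n + 1)" "g' = g"
      using r(4) unfolding sl by simp_all
    note e = decode_load[OF r4(1) b3 I(4)[unfolded r(1)] I(3,5)]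
    have "valid I" using I(3) r(2) e(2) unfolding valid_def by blast
    moreover have "load_gas_cvrp_solvable I (M (b + 2)) ?\<Lambda> g"
      using I(6) e(1,3) r4(2) by (simp add: load_gas_cvrp_solvable_def)
    moreover have "length (\<kappa> # x) = b + 4 + n" using r(3) by (simp add: b_def)
    ultimately show ?R using I(2) e(1) validD(5) by auto
  next
    assume ?R
    then obtain I where I: "length (\<kappa> # x) = b + 4 + n" "\<kappa> = M b + M (b + 2)" "valid I"
      "load_gas_cvrp_solvable I (M (b + 2)) ?\<Lambda> g" by blast
    note e = encode_load_self[OF b3 validD(1,4,3)[OF I(3)]]
    have "x = encode_vrp I @ slice M (b + 2) (n + 2)"
      unfolding word_iff[OF validD(4)[OF I(3)] M_def] using I(1) validD(2)[OF I(3)]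
      by (auto simp: n_def b_def)
    then have "(x, \<kappa>) = (encode_vrp I @ encode_load I (M (b + 2)) ?\<Lambda> @ [g], vehicles I + M (b + 2))"
      using I(2) validD(5)[OF I(3)] e(1) sl by simp
    then show "(x, \<kappa>) \<in> LoadGasCVRP (\<lambda>k l g. k + l)"
      using I(4) validD(1,4)[OF I(3)] e(2) unfolding LoadGasCVRP_def standard_verts_def by blast
  qed
  moreover have "length lst \<le> max_clients \<kappa> \<and>
        load_gas_cvrp_solvable (I\<lparr>clients := set lst\<rparr>) (M (b + 2)) ?\<Lambda> g \<longleftrightarrow>
      load_gas_cvrp_solvable I (M (b + 2)) ?\<Lambda> g"
    if "valid I" "\<kappa> = M b + M (b + 2)" "representatives D 0 (clients I) lst" for I D lst
  proof -
    have "set lst = clients I" "length lst = card (clients I)"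
      using that(3) representatives_0[OF that(3)] by (auto simp: representatives_def distinct_card[symmetric])
    moreover have "I\<lparr>clients := clients I\<rparr> = I" by simp
    moreover note e = encode_load_self[OF b3 validD(1,4,3)[OF that(1)]]
    moreover have "load_cvrp_solvable I (M (b + 2)) ?\<Lambda>" if "load_gas_cvrp_solvable I (M (b + 2)) ?\<Lambda> g"
      using that unfolding load_gas_cvrp_solvable_def load_cvrp_solvable_def by blast
    ultimately show ?thesis
      using load_client_bound'[OF validD(1)[OF that(1)] e(2)] validD(5)[OF that(1)] that(2) by metis
  qed
  ultimately show "loops_le (growth \<kappa> * length (\<kappa> # x)) (solver load_gas_mode) (init (\<kappa> # x)) \<and>
      (fst (sem (solver load_gas_mode) (init (\<kappa> # x))) 0 = 1 \<longleftrightarrow> (x, \<kappa>) \<in> LoadGasCVRP (\<lambda>k l g. k + l))"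
    using solver_aux[of "\<lambda>I. load_gas_cvrp_solvable I (M (b + 2)) ?\<Lambda> g"] by blast
qed simp

lemma GasCVRP_FPT: "GasCVRP (\<lambda>k g. k + g) \<in> FPT"
proof (rule FPT_solver)
  fix \<kappa> x
  define M where "M = snd (init (\<kappa> # x))"
  define n where "n = M 1"
  define b where "b = 2 + n * n + n + n"
  let ?g = "M (b + 2)" and ?a = "2 + n * n + n"
  \<comment> \<open>The client vector doubles as demand vector, and \<open>n\<close> is the load
    capacity.\<close>
  interpret solver_mode gas_mode M \<kappa> n x ?a n ?g 1 "b + 3" "M b + ?g"
    by unfold_locales (auto simp: M_def n_def b_def gas_mode_def)
  let ?\<Lambda> = "\<lambda>v. M (?a + v)"
  have validD: "vrp_instance I" "represents M n I" "\<forall>v<n. ?\<Lambda> v = (if v \<in> clients I then 1 else 0)"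
    "verts I = {..<n}" "vehicles I = M b" if "valid I" for I
    using that unfolding valid_def by (auto simp: represents_def b_def)
  have sl: "slice M (b + 2) 1 = [?g]" by (simp add: slice_def)
  have "(x, \<kappa>) \<in> GasCVRP (\<lambda>k g. k + g) \<longleftrightarrow> length (\<kappa> # x) = b + 3 \<and> \<kappa> = M b + ?g \<and>
      (\<exists>I. valid I \<and> gas_cvrp_solvable I ?g)" (is "_ \<longleftrightarrow> ?R")
  proof
    assume "(x, \<kappa>) \<in> GasCVRP (\<lambda>k g. k + g)"
    then obtain I g n' where I: "x = encode_vrp I @ [g]" "\<kappa> = vehicles I + g" "vrp_instance I"
      "verts I = {..<n'}" "gas_cvrp_solvable I g"
      unfolding GasCVRP_def standard_verts_def by blast
    have "length [g] = 1" by simp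
    then have r: "n' = n" "represents M n I" "length x = n * n + n + n + 3 + 1" "[g] = slice M (b + 2) 1"
      using I(1) unfolding word_iff[OF I(4) M_def] by (auto simp: n_def b_def)
    have "valid I" using I(3) r(2) unfolding valid_def by (auto simp: represents_def)
    moreover have "length (\<kappa> # x) = b + 3" using r(3) by (simp add: b_def)
    ultimately show ?R using I(2,5) r(4) validD(5) sl by auto
  next
    assume ?R
    then obtain I where I: "length (\<kappa> # x) = b + 3" "\<kappa> = M b + ?g" "valid I" "gas_cvrp_solvable I ?g" by blast
    have "x = encode_vrp I @ slice M (b + 2) 1"
      unfolding word_iff[OF validD(4)[OF I(3)] M_def] using I(1) validD(2)[OF I(3)]
      by (auto simp: n_def b_def)
    then have "(x, \<kappa>) = (encode_vrp I @ [?g], vehicles I + ?g)"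
      using I(2) validD(5)[OF I(3)] sl by simp
    then show "(x, \<kappa>) \<in> GasCVRP (\<lambda>k g. k + g)"
      using I(4) validD(1,4)[OF I(3)] unfolding GasCVRP_def standard_verts_def by blast
  qed
  moreover have "length lst \<le> max_clients \<kappa> \<and>
        load_gas_cvrp_solvable (I\<lparr>clients := set lst\<rparr>) n ?\<Lambda> ?g \<longleftrightarrow> gas_cvrp_solvable I ?g"
    if "valid I" "\<kappa> = M b + ?g" and D: "upper_dist I D" "lower_dist I D"
      and lst: "representatives D 1 (clients I) lst" for I D lst
  proof -
    let ?J = "I\<lparr>clients := set lst\<rparr>"
    note I = validD[OF that(1)]
    have "clients I \<subseteq> verts I" using I(1) by (simp add: vrp_instance_def)
    note rep = representatives_1[OF lst D this]
    have sub: "set lst \<subseteq> clients I" and len: "length lst = card (set lst)"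
      using lst by (auto simp: representatives_def distinct_card)
    have J: "vrp_instance ?J" using I(1) sub by (auto simp: vrp_instance_def)
    have "card (set lst) \<le> card {..<n}" using sub I(4) \<open>clients I \<subseteq> verts I\<close> by (intro card_mono) auto
    then have "load_gas_cvrp_solvable ?J n ?\<Lambda> ?g \<longleftrightarrow> gas_cvrp_solvable ?J ?g"
    proof (intro load_gas_of_gas)
      show "?\<Lambda> c = 1" if "c \<in> clients ?J" for c
      proof -
        have "c \<in> clients I" using that sub by auto
        then show ?thesis using I(3,4) \<open>clients I \<subseteq> verts I\<close> by auto
      qed
    qed simp_all
    moreover have "gas_cvrp_solvable ?J ?g \<longleftrightarrow> gas_cvrp_solvable I ?g"
      by (rule gas_reduce[OF I(1) D(1) sub rep(2)])
    \<comment> \<open>The bound is applied to the reduced instance, because the original one may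
      have any number of clients.\<close>
    moreover have "length lst \<le> max_clients \<kappa>" if "gas_cvrp_solvable ?J ?g"
    proof -
      have "card (clients ?J) \<le> vehicles ?J * Suc ?g"
        by (rule gas_client_bound[OF J _ that]) (use D(2) rep(1) in auto)
      also have "\<dots> \<le> \<kappa> * Suc \<kappa>" using I(5) \<open>\<kappa> = M b + ?g\<close> by (intro mult_le_mono) auto
      finally show ?thesis using len by (simp add: max_clients_def)
    qed
    ultimately show ?thesis by blast
  qed
  ultimately show "loops_le (growth \<kappa> * length (\<kappa> # x)) (solver gas_mode) (init (\<kappa> # x)) \<and>
      (fst (sem (solver gas_mode) (init (\<kappa> # x))) 0 = 1 \<longleftrightarrow> (x, \<kappa>) \<in> GasCVRP (\<lambda>k g. k + g))"
    using solver_aux[of "\<lambda>I. gas_cvrp_solvable I ?g"] by blast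
qed simp

theorem theorem4p4:
  shows "LoadCVRP (\<lambda>k l. k + l) \<in> FPT \<and>
    GasCVRP (\<lambda>k g. k + g) \<in> FPT \<and>
    LoadGasCVRP (\<lambda>k l g. k + l) \<in> FPT"
  using LoadCVRP_FPT GasCVRP_FPT LoadGasCVRP_FPT by blast

end
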